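(* Let $n\ge1$ be an integer, let $\lambda_{\mathrm p},\lambda_{\mathrm d},r_{\mathrm d}>0$, and let $\Phi$ be the $n$-dimensional Matérn cluster process with parameters $\lambda_{\mathrm p},\lambda_{\mathrm d},r_{\mathrm d}$. For an integer $k\ge1$, let $R'_k$ be the $k$th nearest neighbor distance of $\Phi$ and $R_k$ its $k$th contact distance. Then for every $r>0$ the CDF of $R'_k$ is $$F_{R'_k}(r)=1-\sum_{i=1}^{k}q_{k-i}(r)\,\overline F_{R_i}(r),$$ where $\overline F_{R_i}(r)=1-F_{R_i}(r)$ is the complementary CDF of $R_i$.
   Context: $\mathcal B(\boldsymbol x,r)$ is the ball in $\mathbb R^n$ with center $\boldsymbol x$ and radius $r$; $\mathrm o$ is the origin. For $x\ge 0$, $\mathcal A(r,r_{\mathrm d},x)$ is the volume of $\mathcal B(\mathrm o,r)\cap\mathcal B(\boldsymbol x,r_{\mathrm d})$ for any $\boldsymbol x\in\mathbb R^n$ with $\|\boldsymbol x\|=x$. For integers $j\ge0$, $$q_j(r)=\frac1{j!}\int_0^{r_{\mathrm d}}(\lambda_{\mathrm d}\mathcal A(r,r_{\mathrm d},y))^{j}e^{-\lambda_{\mathrm d}\mathcal A(r,r_{\mathrm d},y)}\frac{n\,y^{n-1}}{r_{\mathrm d}^{\,n}}\,\mathrm dy .$$ Matérn cluster process (MCP): let $\Phi_{\mathrm p}=\{\mathbf X_i\}$ be a homogeneous Poisson point process on $\mathbb R^n$ with intensity $\lambda_{\mathrm p}$ (parents). To each $\mathbf X_i$ attach a daughter process $\Phi_{\mathbf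 X_i}$, a Poisson point process with intensity function $\boldsymbol y\mapsto\lambda_{\mathrm d}\mathbf 1(\|\boldsymbol y\|\le r_{\mathrm d})$; the daughter processes are i.i.d. and independent of $\Phi_{\mathrm p}$. The MCP is $\Phi=\bigcup_{\mathbf X_i\in\Phi_{\mathrm p}}(\mathbf X_i+\Phi_{\mathbf X_i})$ (parents themselves are not included); it is a stationary point process. The $k$th contact distance $R_k$ is the distance from the origin to the $k$th closest point of $\Phi$ (ordinary distribution), so $F_{R_k}(r)=\mathbb P[R_k\le r]$ is the probability that $\mathcal B(\mathrm o,r)$ contains at least $k$ points of $\Phi$. The $k$th nearest neighbor distance $R'_k$ is the distance from the typical point of $\Phi$, taken at the origin, to its $k$th nearest neighbor in $\Phi$; that is, $F_{R'_k}(r)=1-\mathbb P^{!\mathrm o}[N\le k-1]$, where $N$ is the number of points in $\mathcal B(\mathrm o,r)$ and the reduced Palm measure $\mathbb P^{!\mathrm o}$ is the distribution of $\Phi\setminus\{\mathrm o\}$ conditioned on the occurrence of a point of $\Phi$ at $\mathrm o$ (in the usual Palm sense for stationary point processes). Convention: $0^0=1$. *)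

theory Defs
  imports "HOL-Probability.Probability"
begin

text \<open>
  The space \<open>\<real>\<^sup>n\<close> is an arbitrary type \<open>'a\<close> of class \<open>euclidean_space\<close>, with \<open>n = DIM('a) \<ge> 1\<close>.
  All balls are closed.
\<close>

section \<open>Point processes\<close>

definition locally_finite_set :: "'a::euclidean_space set \<Rightarrow> bool" where
  "locally_finite_set S \<longleftrightarrow> (\<forall>B. bounded B \<longrightarrow> finite (S \<inter> B))"

text \<open>
  The measurable space of locally finite point configurations, with the \<open>\<sigma>\<close>-algebra generated by
  the counting maps of the bounded Borel sets. Only its sets matter; it carries no particular measure.
\<close>

definition point_configs :: "'a::euclidean_space set measure" where
  "point_configs = sigma {S. locally_finite_set S}
     {{S. locally_finite_set S \<and> card (S \<inter> B) = k} | B k. B \<in> sets borel \<and> bounded B}"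

definition point_process :: "'w measure \<Rightarrow> ('w \<Rightarrow> 'a::euclidean_space set) \<Rightarrow> bool" where
  "point_process M \<Phi> \<longleftrightarrow> prob_space M \<and> \<Phi> \<in> measurable M point_configs"

text \<open>
  Poisson point process with intensity function \<open>f\<close>. The Poisson weights are written out because
  \<open>poisson_pmf\<close> is unspecified for mean \<open>0\<close>, which does occur here.
\<close>

definition poisson_process ::
    "'w measure \<Rightarrow> ('a::euclidean_space \<Rightarrow> real) \<Rightarrow> ('w \<Rightarrow> 'a set) \<Rightarrow> bool" where
  "poisson_process M f \<Phi> \<longleftrightarrow>
     point_process M \<Phi> \<and>
     (\<forall>B k. B \<in> sets borel \<and> bounded B \<longrightarrow>
        measure M {\<omega> \<in> space M. card (\<Phi> \<omega> \<inter> B) = k} =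
          (LINT y:B|lborel. f y) ^ k / fact k * exp (- (LINT y:B|lborel. f y))) \<and>
     (\<forall>\<B>. finite \<B> \<and> disjoint \<B> \<and> (\<forall>B\<in>\<B>. B \<in> sets borel \<and> bounded B) \<longrightarrow>
        prob_space.indep_vars M (\<lambda>_. count_space UNIV) (\<lambda>B \<omega>. card (\<Phi> \<omega> \<inter> B)) \<B>)"

section \<open>The Matern cluster process\<close>

text \<open>
  The parents are enumerated as \<open>X 0, X 1, \<dots>\<close> (almost surely there are infinitely many), and \<open>D i\<close>
  is the daughter process of \<open>X i\<close>. The daughter processes are identically distributed because
  they are Poisson processes with the same intensity function. Independence from the parents is
  independence of the \<open>\<sigma>\<close>-algebras generated by the two families; as the enumeration may use
  randomness beyond the parent point set, the whole sequence \<open>X\<close> is used. The union is required to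
  be \<open>\<Phi>\<close> only almost surely, because it may fail to be locally finite on a null set.
\<close>

definition matern_cluster_process ::
    "'w measure \<Rightarrow> real \<Rightarrow> real \<Rightarrow> real \<Rightarrow> ('w \<Rightarrow> 'a::euclidean_space set) \<Rightarrow> bool" where
  "matern_cluster_process M lp ld rd \<Phi> \<longleftrightarrow>
     point_process M \<Phi> \<and>
     (\<exists>\<Phi>p (X :: nat \<Rightarrow> 'w \<Rightarrow> 'a) (D :: nat \<Rightarrow> 'w \<Rightarrow> 'a set).
        poisson_process M (\<lambda>_. lp) \<Phi>p \<and>
        (\<forall>i. X i \<in> borel_measurable M) \<and>
        (AE \<omega> in M. inj (\<lambda>i. X i \<omega>) \<and> range (\<lambda>i. X i \<omega>) = \<Phi>p \<omega>) \<and>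
        (\<forall>i. poisson_process M (\<lambda>y. ld * indicator {y. norm y \<le> rd} y) (D i)) \<and>
        prob_space.indep_vars M (\<lambda>_. point_configs) D UNIV \<and>
        prob_space.indep_set M
          {(\<lambda>\<omega> i. X i \<omega>) -` A \<inter> space M | A. A \<in> sets (Pi\<^sub>M UNIV (\<lambda>_. borel))}
          {(\<lambda>\<omega> i. D i \<omega>) -` A \<inter> space M | A. A \<in> sets (Pi\<^sub>M UNIV (\<lambda>_. point_configs))} \<and>
        (AE \<omega> in M. \<Phi> \<omega> = (\<Union>i. (\<lambda>y. X i \<omega> + y) ` D i \<omega>)))"

section \<open>Reduced Palm measure and distances\<close>

text \<open>
  The reduced Palm measure of a stationary point process of finite positive intensity, with the
  unit cube (volume \<open>1\<close>) as reference window: the denominator is the intensity, and the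
  numerator is the expected number of points \<open>x\<close> in the cube such that the configuration seen
  from \<open>x\<close>, without \<open>x\<close> itself, lies in \<open>E\<close>.
\<close>

definition reduced_palm ::
    "'w measure \<Rightarrow> ('w \<Rightarrow> 'a::euclidean_space set) \<Rightarrow> 'a set set \<Rightarrow> real" where
  "reduced_palm M \<Phi> E =
     (\<integral>\<omega>. (\<Sum>x\<in>\<Phi> \<omega> \<inter> cbox 0 One. indicator E ((\<lambda>y. y - x) ` \<Phi> \<omega> - {0})) \<partial>M) /
     (\<integral>\<omega>. real (card (\<Phi> \<omega> \<inter> cbox 0 One)) \<partial>M)"

text \<open>
  Distance from the origin to the \<open>k\<close>th closest point of a configuration, counting ties
  separately; it is \<open>\<infinity>\<close> if there are fewer than \<open>k\<close> points.
\<close>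

definition kth_distance :: "nat \<Rightarrow> 'a::euclidean_space set \<Rightarrow> ereal" where
  "kth_distance k S = (INF r\<in>{r. 0 \<le> r \<and> k \<le> card (S \<inter> cball 0 r)}. ereal r)"

lemma kth_distance_le_iff:
  assumes S: "locally_finite_set S" and r: "0 \<le> r"
  shows "kth_distance k S \<le> ereal r \<longleftrightarrow> k \<le> card (S \<inter> cball 0 r)"
proof
  assume "k \<le> card (S \<inter> cball 0 r)"
  then show "kth_distance k S \<le> ereal r"
    unfolding kth_distance_def using r by (intro INF_lower) auto
next
  assume le: "kth_distance k S \<le> ereal r"
  define F where "F = norm ` (S \<inter> cball 0 (r + 1) - cball 0 r)"
  have "finite F"
    using S unfolding F_def locally_finite_set_def by auto
  define e where "e = Min (insert (r + 1) F)"
  have "r < e"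
    using \<open>finite F\<close> unfolding e_def by (subst Min_gr_iff) (auto simp: F_def)
  then have "kth_distance k S < ereal e"
    using le by (meson le_less_trans less_ereal.simps(1))
  then obtain s where s: "s < e" "k \<le> card (S \<inter> cball 0 s)"
    unfolding kth_distance_def INF_less_iff by auto
  have "S \<inter> cball 0 s \<subseteq> S \<inter> cball 0 r"
  proof
    fix x assume x: "x \<in> S \<inter> cball 0 s"
    show "x \<in> S \<inter> cball 0 r"
    proof (rule ccontr)
      assume "x \<notin> S \<inter> cball 0 r"
      moreover have "e \<le> r + 1"
        using \<open>finite F\<close> unfolding e_def by (intro Min_le) auto
      ultimately have "norm x \<in> F"
        using x s unfolding F_def by auto
      then have "e \<le> norm x"
        using \<open>finite F\<close> unfolding e_def by (intro Min_le) auto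
      then show False using x s by auto
    qed
  qed
  moreover have "finite (S \<inter> cball 0 r)"
    using S unfolding locally_finite_set_def by auto
  ultimately show "k \<le> card (S \<inter> cball 0 r)"
    using s(2) card_mono le_trans by blast
qed

definition contact_cdf ::
    "'w measure \<Rightarrow> ('w \<Rightarrow> 'a::euclidean_space set) \<Rightarrow> nat \<Rightarrow> real \<Rightarrow> real" where
  "contact_cdf M \<Phi> k r = measure M {\<omega> \<in> space M. kth_distance k (\<Phi> \<omega>) \<le> ereal r}"

text \<open>
  The event is the complement of \<open>{S. card (S \<inter> cball 0 r) \<le> k - 1}\<close> by
  \<open>kth_distance_le_iff\<close>, so this is \<open>1\<close> minus its reduced Palm probability.
\<close>

definition nearest_neighbor_cdf ::
    "'w measure \<Rightarrow> ('w \<Rightarrow> 'a::euclidean_space set) \<Rightarrow> nat \<Rightarrow> real \<Rightarrow> real" where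
  "nearest_neighbor_cdf M \<Phi> k r = reduced_palm M \<Phi> {S. kth_distance k S \<le> ereal r}"

section \<open>The weights\<close>

text \<open>
  The volume depends on the second centre only through its norm \<open>y \<ge> 0\<close>, so an arbitrary unit
  vector fixes its direction.
\<close>

definition overlap_volume :: "'a::euclidean_space itself \<Rightarrow> real \<Rightarrow> real \<Rightarrow> real \<Rightarrow> real" where
  "overlap_volume _ r rd y =
     measure lborel (cball 0 r \<inter> cball (y *\<^sub>R (SOME u::'a. norm u = 1)) rd)"

definition q_weight ::
    "'a::euclidean_space itself \<Rightarrow> real \<Rightarrow> real \<Rightarrow> nat \<Rightarrow> real \<Rightarrow> real" where
  "q_weight T ld rd j r =
     1 / fact j *
     (LINT y:{0..rd}|lborel.
        (ld * overlap_volume T r rd y) ^ j * exp (- (ld * overlap_volume T r rd y)) *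
        (real DIM('a) * y ^ (DIM('a) - 1) / rd ^ DIM('a)))"

end

theory Submission
  imports Defs
begin

text \<open>
  A typical point of the process sees the whole process together with an independent copy of its own
  cluster, so for \<open>0 < t \<le> 1\<close> the generating function of the number of points of \<open>\<Phi>\<close> in the
  \<open>r\<close>-ball around a typical point is \<open>t\<close> times the product of the generating functions of the
  sequence \<open>q\<^sub>j\<close> and of the number of points in a fixed \<open>r\<close>-ball. This identity is
  obtained from the generating functional of the process, \<open>E (s ^ \<Phi>(A) * t ^ \<Phi>(B))\<close> for disjoint
  \<open>A\<close> and \<open>B\<close>: its derivative in \<open>s\<close> gives \<open>E (\<Phi>(A) * t ^ \<Phi>(B))\<close> for \<open>A \<subseteq> B\<close>, and the sum over
  the points of the unit cube is the limit of such expectations with \<open>A\<close> ranging over the cells of a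
  refining grid and \<open>B\<close> a slightly enlarged ball around a corner of the cell. Comparing coefficients
  of powers of \<open>t\<close> yields the distribution function.
\<close>

section \<open>Grid approximation\<close>

text \<open>\<open>reduced_palm\<close> sums over the random points of a random configuration, while
  \<open>poisson_process\<close> speaks only of counts in fixed bounded windows; this gap is why
  expectations are approximated cell by cell. A second obstacle is the enumeration \<open>X\<close>:
  the law of a single \<open>X i\<close> is unknown and may use randomness beyond the parent set.
  Nothing is therefore computed for one parent; only the product over all parents near a window,
  which depends on the parent set alone, is evaluated. Finally \<Phi> is a set, so counts add up
  over clusters only if clusters are almost surely disjoint, and this has to be proved. The product
  form comes from differentiating an exponential: the exponential itself survives as the factor of
  the whole process, and the derivative of its exponent is an integral over the positions of one
  parent, the factor of the own cluster. Given a point, its parent is uniform in the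
  \<open>rd\<close>-ball around it; radial integration turns this into the density in
  \<open>q_weight\<close>. The factor \<open>t\<close> is the point counted in its own ball and
  causes the shift between counts and numbers of neighbours.\<close>

definition grid :: "nat \<Rightarrow> 'a::euclidean_space \<Rightarrow> 'a" where
  "grid n x = (\<Sum>b\<in>Basis. (real_of_int \<lfloor>real (Suc n) * (x \<bullet> b)\<rfloor> / real (Suc n)) *\<^sub>R b)"

text \<open>The side \<open>1 / Suc n\<close> summed over the coordinates: the l1 norm bounds the
  distance from a point to the corner of its cell. Grids for successive \<open>n\<close> are not
  nested, so limits are driven by this bound. The type argument carries the dimension.\<close>

definition mesh :: "'a::euclidean_space itself \<Rightarrow> nat \<Rightarrow> real" where
  "mesh _ n = real DIM('a) / real (Suc n)"

lemma mesh_pos: "0 < mesh TYPE('a::euclidean_space) n"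
  by (simp add: mesh_def)

lemma mesh_tendsto_0: "mesh TYPE('a::euclidean_space) \<longlonglongrightarrow> 0"
  unfolding mesh_def using LIMSEQ_Suc[OF lim_const_over_n] by blast

lemma borel_measurable_grid [measurable]: "grid n \<in> borel_measurable borel"
  unfolding grid_def by measurable

lemma grid_inner: "b \<in> Basis \<Longrightarrow> grid n x \<bullet> b = real_of_int \<lfloor>real (Suc n) * (x \<bullet> b)\<rfloor> / real (Suc n)"
  by (simp add: grid_def inner_sum_left inner_Basis if_distrib cong: if_cong)

lemma grid_inner_bounds:
  assumes "b \<in> Basis"
  shows "grid n x \<bullet> b \<le> x \<bullet> b" "x \<bullet> b < grid n x \<bullet> b + 1 / real (Suc n)"
proof -
  have 1: "real_of_int \<lfloor>real (Suc n) * (x \<bullet> b)\<rfloor> \<le> real (Suc n) * (x \<bullet> b)"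
    by linarith
  show "grid n x \<bullet> b \<le> x \<bullet> b"
    unfolding grid_inner[OF assms] using 1 by (simp add: divide_simps mult.commute)
  have 2: "real (Suc n) * (x \<bullet> b) < real_of_int \<lfloor>real (Suc n) * (x \<bullet> b)\<rfloor> + 1"
    by linarith
  show "x \<bullet> b < grid n x \<bullet> b + 1 / real (Suc n)"
    unfolding grid_inner[OF assms] using 2 by (simp add: divide_simps mult.commute)
qed

lemma dist_grid:
  fixes x :: "'a::euclidean_space"
  shows "dist (grid n x) x \<le> mesh TYPE('a) n"
proof -
  have "norm (grid n x - x) \<le> (\<Sum>b\<in>Basis. \<bar>(grid n x - x) \<bullet> b\<bar>)"
    by (rule norm_le_l1)
  also have "\<dots> \<le> (\<Sum>b\<in>(Basis::'a set). 1 / real (Suc n))"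
  proof (rule sum_mono)
    fix b :: 'a assume "b \<in> Basis"
    from grid_inner_bounds[OF this, where n=n and x=x] show "\<bar>(grid n x - x) \<bullet> b\<bar> \<le> 1 / real (Suc n)"
      unfolding inner_diff_left by linarith
  qed
  also have "\<dots> = mesh TYPE('a) n"
    by (simp add: mesh_def)
  finally show ?thesis by (simp add: dist_norm)
qed

text \<open>A corner is coded by one integer per basis vector. Countability allows measurability to
  be checked corner by corner for functions evaluated at \<open>grid n x\<close> with variable
  \<open>x\<close>.\<close>

lemma countable_range_grid: "countable (range (grid n :: 'a::euclidean_space \<Rightarrow> 'a))"
proof -
  have "range (grid n :: 'a \<Rightarrow> 'a) \<subseteq> (\<lambda>f. \<Sum>b\<in>Basis. (real_of_int (f b) / real (Suc n)) *\<^sub>R b)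
      ` (\<Pi>\<^sub>E b\<in>Basis. UNIV)"
  proof
    fix v :: 'a assume "v \<in> range (grid n)"
    then obtain x where v: "v = grid n x" by auto
    show "v \<in> (\<lambda>f. \<Sum>b\<in>Basis. (real_of_int (f b) / real (Suc n)) *\<^sub>R b) ` (\<Pi>\<^sub>E b\<in>Basis. UNIV)"
      unfolding v grid_def
      by (rule image_eqI[where x="\<lambda>b\<in>Basis. \<lfloor>real (Suc n) * (x \<bullet> b)\<rfloor>"]) (auto intro!: sum.cong)
  qed
  then show ?thesis
    by (rule countable_subset) (intro countable_image countable_PiE finite_Basis countableI_type)
qed

lemma finite_grid_image:
  fixes C :: "'a::euclidean_space set"
  assumes "bounded C"
  shows "finite (grid n ` C)"
proof -
  obtain R where R: "\<And>x. x \<in> C \<Longrightarrow> norm x \<le> R"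
    using assms unfolding bounded_iff by auto
  let ?I = "{\<lfloor>- real (Suc n) * R\<rfloor>..\<lfloor>real (Suc n) * R\<rfloor>}"
  have "grid n ` C \<subseteq> (\<lambda>f. \<Sum>b\<in>Basis. (real_of_int (f b) / real (Suc n)) *\<^sub>R b)
      ` (\<Pi>\<^sub>E b\<in>Basis. ?I)"
  proof
    fix v assume "v \<in> grid n ` C"
    then obtain x where v: "v = grid n x" "x \<in> C" by auto
    have "(\<lambda>b\<in>Basis. \<lfloor>real (Suc n) * (x \<bullet> b)\<rfloor>) \<in> (\<Pi>\<^sub>E b\<in>Basis. ?I)"
    proof (intro restrict_PiE_iff[THEN iffD2] ballI)
      fix b :: 'a assume "b \<in> Basis"
      then have "\<bar>x \<bullet> b\<bar> \<le> R"
        using R[OF v(2)] Basis_le_norm order_trans by blast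
      then have "real (Suc n) * (x \<bullet> b) \<le> real (Suc n) * R"
        "real (Suc n) * (-R) \<le> real (Suc n) * (x \<bullet> b)"
        by (intro mult_left_mono; simp)+
      then show "\<lfloor>real (Suc n) * (x \<bullet> b)\<rfloor> \<in> ?I"
        by (intro atLeastAtMost_iff[THEN iffD2] conjI floor_mono) (simp_all del: of_nat_Suc)
    qed
    then show "v \<in> (\<lambda>f. \<Sum>b\<in>Basis. (real_of_int (f b) / real (Suc n)) *\<^sub>R b) ` (\<Pi>\<^sub>E b\<in>Basis. ?I)"
      unfolding v grid_def
      by (intro image_eqI[where x="\<lambda>b\<in>Basis. \<lfloor>real (Suc n) * (x \<bullet> b)\<rfloor>"]) (auto intro!: sum.cong)
  qed
  then show ?thesis
    by (rule finite_subset) (intro finite_imageI finite_PiE finite_Basis finite_atLeastAtMost_int)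
qed

lemma grid_cell_borel [measurable]: "grid n -` {v} \<in> sets borel"
  using measurable_sets[OF borel_measurable_grid, of "{v}" n] by simp

lemma measurable_grid_count_space:
  "(grid n :: 'a::euclidean_space \<Rightarrow> 'a) \<in> measurable borel (count_space (range (grid n)))"
  using countable_range_grid
  by (subst measurable_count_space_eq_countable) auto

lemma grid_cell_subset:
  "grid n -` {v} \<subseteq> cbox v (v + (1 / real (Suc n)) *\<^sub>R One)"
proof
  fix x assume "x \<in> grid n -` {v}"
  then have "grid n x = v" by auto
  then show "x \<in> cbox v (v + (1 / real (Suc n)) *\<^sub>R One)"
    using grid_inner_bounds[where n=n and x=x] by (auto simp: mem_box inner_add_left intro: less_imp_le)
qed

lemma bounded_grid_cell: "bounded (grid n -` {v} :: 'a::euclidean_space set)"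
  by (rule bounded_subset[OF bounded_cbox grid_cell_subset])

lemma measure_grid_cell: "measure lborel (grid n -` {v} :: 'a::euclidean_space set) \<le> 1 / real (Suc n)"
proof -
  have "measure lborel (grid n -` {v} :: 'a set) \<le> measure lborel (cbox v (v + (1 / real (Suc n)) *\<^sub>R One))"
    by (intro measure_mono_fmeasurable grid_cell_subset) auto
  also have "\<dots> = (\<Prod>b\<in>(Basis::'a set). 1 / real (Suc n))"
    by (subst measure_lborel_cbox_eq) (auto simp: inner_add_left)
  also have "\<dots> = (1 / real (Suc n)) ^ DIM('a)"
    by simp
  \<comment> \<open>The dimension is at least 1, so one factor survives; the collision estimate for
    two clusters asks only for a cell volume that vanishes with \<open>n\<close>.\<close>
  also have "\<dots> \<le> (1 / real (Suc n)) ^ 1"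
    by (rule power_decreasing) (auto simp: Suc_le_eq)
  finally show ?thesis by simp
qed

lemma sum_measure_grid_cells:
  fixes C :: "'a::euclidean_space set"
  assumes C: "C \<in> sets borel" "bounded C"
  shows "(\<Sum>v\<in>grid n ` C. measure lborel (C \<inter> grid n -` {v})) = measure lborel C"
proof -
  have "measure lborel (\<Union>v\<in>grid n ` C. C \<inter> grid n -` {v}) = (\<Sum>v\<in>grid n ` C. measure lborel (C \<inter> grid n -` {v}))"
    using C emeasure_bounded_finite[OF bounded_subset[OF C(2)]]
    by (intro measure_finite_Union finite_grid_image) (auto simp: disjoint_family_on_def less_top[symmetric])
  moreover have "(\<Union>v\<in>grid n ` C. C \<inter> grid n -` {v}) = C" by auto
  ultimately show ?thesis by simp
qed

section \<open>Counting points of locally finite configurations\<close>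

lemma space_point_configs [simp]: "space point_configs = {S. locally_finite_set S}"
  unfolding point_configs_def by (rule space_measure_of) auto

lemma measurable_card_Int:
  assumes "B \<in> sets borel" "bounded B"
  shows "(\<lambda>S. card (S \<inter> B)) \<in> measurable point_configs (count_space UNIV)"
proof (rule measurable_count_space_eq2_countable[THEN iffD2], safe)
  fix k
  have "{S. locally_finite_set S \<and> card (S \<inter> B) = k} \<in> sets point_configs"
    unfolding point_configs_def using assms
    by (subst sets_measure_of) (auto intro!: sigma_sets.Basic)
  moreover have "(\<lambda>S. card (S \<inter> B)) -` {k} \<inter> space point_configs = {S. locally_finite_set S \<and> card (S \<inter> B) = k}"
    by auto
  ultimately show "(\<lambda>S. card (S \<inter> B)) -` {k} \<inter> space point_configs \<in> sets point_configs"
    by simp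
qed auto

lemma finite_Int_locally_finite:
  "locally_finite_set S \<Longrightarrow> bounded B \<Longrightarrow> finite (S \<inter> B)"
  by (simp add: locally_finite_set_def)

text \<open>Only the finitely many points of \<open>S\<close> in \<open>W\<close> matter, so
  pointwise eventual agreement becomes simultaneous. The sets are equal from some \<open>n\<close>
  on, hence any function of the count converges, without continuity.\<close>

lemma eventually_Int_locally_finite:
  assumes S: "locally_finite_set S" and W: "bounded W"
    and sub: "\<And>n. L n \<subseteq> W" "K \<subseteq> W"
    and ev: "\<And>y. y \<in> S \<inter> W \<Longrightarrow> \<forall>\<^sub>F n in F. y \<in> L n \<longleftrightarrow> y \<in> K"
  shows "\<forall>\<^sub>F n in F. S \<inter> L n = S \<inter> K"
proof -
  have "\<forall>\<^sub>F n in F. \<forall>y\<in>S \<inter> W. y \<in> L n \<longleftrightarrow> y \<in> K"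
    using finite_Int_locally_finite[OF S W] ev by (intro eventually_ball_finite) auto
  then show ?thesis
    by eventually_elim (use sub in blast)
qed

text \<open>
  Enlarging the radius by the mesh makes the ball around the corner \<open>grid n x\<close> contain the ball
  around \<open>x\<close>, so that no point on the boundary sphere is lost in the limit.
\<close>

lemma eventually_card_cball_grid:
  fixes S :: "'a::euclidean_space set"
  assumes S: "locally_finite_set S"
  shows "\<forall>\<^sub>F n in sequentially. S \<inter> cball (grid n x) (r + mesh TYPE('a) n) = S \<inter> cball x r"
proof (rule eventually_Int_locally_finite[OF S])
  let ?m = "mesh TYPE('a)"
  have m: "?m n \<le> DIM('a)" for n
    by (simp add: mesh_def divide_simps)
  \<comment> \<open>\<open>DIM('a)\<close> bounds the mesh, which enters twice: as displacement of
    the centre and in the enlarged radius. The same doubling gives the threshold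
    \<open>(dist x y - r) / 2\<close> below.\<close>
  show "bounded (cball x (r + 2 * DIM('a)))" by simp
  show "cball (grid n x) (r + ?m n) \<subseteq> cball x (r + 2 * DIM('a))" for n
  proof
    fix y assume "y \<in> cball (grid n x) (r + ?m n)"
    then show "y \<in> cball x (r + 2 * DIM('a))"
      using dist_triangle[of x y "grid n x"] dist_grid[of n x] m[of n] by (simp add: dist_commute)
  qed
  show "cball x r \<subseteq> cball x (r + 2 * DIM('a))"
    by (auto simp: subset_cball)
  fix y
  show "\<forall>\<^sub>F n in sequentially. y \<in> cball (grid n x) (r + ?m n) \<longleftrightarrow> y \<in> cball x r"
  proof (cases "dist x y \<le> r")
    case True
    then have "y \<in> cball (grid n x) (r + ?m n)" for n
      using dist_triangle[of "grid n x" y x] dist_grid[of n x] by simp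
    then show ?thesis using True by simp
  next
    case False
    then have "\<forall>\<^sub>F n in sequentially. ?m n < (dist x y - r) / 2"
      using order_tendstoD(2)[OF mesh_tendsto_0[where 'a='a]] by (simp del: divide_less_eq_numeral1 less_divide_eq_numeral1)
    then show ?thesis
    proof eventually_elim
      case (elim n)
      then show ?case
        using False dist_triangle[of x y "grid n x"] dist_grid[of n x] by (simp add: dist_commute)
    qed
  qed
qed

text \<open>Grouping the points by the cell that contains them. Read from right to left, a sum over
  random points becomes a sum over deterministic cells, each term involving only a cell count and a
  fixed corner.\<close>

lemma sum_card_grid_cells:
  fixes u :: "'a::euclidean_space \<Rightarrow> real"
  assumes "bounded C" "locally_finite_set S"
  shows "(\<Sum>v\<in>grid n ` C. real (card (S \<inter> (C \<inter> grid n -` {v}))) * u v) = (\<Sum>x\<in>S \<inter> C. u (grid n x))"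
proof -
  have fin: "finite (S \<inter> C)"
    using assms by (simp add: finite_Int_locally_finite)
  have "(\<Sum>x\<in>S \<inter> C. u (grid n x)) = (\<Sum>v\<in>grid n ` C. \<Sum>x\<in>{x\<in>S \<inter> C. grid n x = v}. u (grid n x))"
    by (rule sum.group[symmetric]) (use fin finite_grid_image[OF assms(1)] in auto)
  also have "\<dots> = (\<Sum>v\<in>grid n ` C. real (card (S \<inter> (C \<inter> grid n -` {v}))) * u v)"
  proof (rule sum.cong[OF refl])
    fix v
    have eq: "{x\<in>S \<inter> C. grid n x = v} = S \<inter> (C \<inter> grid n -` {v})"
      by auto
    have "(\<Sum>x\<in>{x\<in>S \<inter> C. grid n x = v}. u (grid n x)) = (\<Sum>x\<in>{x\<in>S \<inter> C. grid n x = v}. u v)"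
      by (rule sum.cong) auto
    then show "(\<Sum>x\<in>{x\<in>S \<inter> C. grid n x = v}. u (grid n x)) = real (card (S \<inter> (C \<inter> grid n -` {v}))) * u v"
      by (simp only: sum_constant eq)
  qed
  finally show ?thesis ..
qed

text \<open>\<open>S \<inter> C\<close> is finite and each ball count is eventually the right one,
  so the sequence is eventually constant; this is why \<open>u\<close> may be arbitrary.\<close>

lemma grid_sum_tendsto:
  fixes S C :: "'a::euclidean_space set" and u :: "nat \<Rightarrow> real"
  assumes C: "bounded C" and S: "locally_finite_set S"
  shows "(\<lambda>n. \<Sum>v\<in>grid n ` C. real (card (S \<inter> (C \<inter> grid n -` {v}))) *
            u (card (S \<inter> cball v (r + mesh TYPE('a) n))))
         \<longlonglongrightarrow> (\<Sum>x\<in>S \<inter> C. u (card (S \<inter> cball x r)))"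
  unfolding sum_card_grid_cells[OF C S]
proof (rule tendsto_eventually, rule eventually_mono)
  show "\<forall>\<^sub>F n in sequentially. \<forall>x\<in>S \<inter> C. S \<inter> cball (grid n x) (r + mesh TYPE('a) n) = S \<inter> cball x r"
    using eventually_card_cball_grid[OF S]
    by (intro eventually_ball_finite finite_Int_locally_finite[OF S C]) auto
qed simp

text \<open>
  Replacing \<open>x\<close> by \<open>grid n x\<close> leaves only countably many translates; for a closed set the error is
  absorbed by a closed neighbourhood that shrinks to it.
\<close>

lemma measurable_grid_card_shift:
  fixes K :: "'a::euclidean_space set"
  assumes K: "closed K" "bounded K" "K \<noteq> {}"
  shows "(\<lambda>(x, S). real (card (S \<inter> (\<lambda>y. x + y) -` K))) \<in> borel_measurable (borel \<Otimes>\<^sub>M point_configs)"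
proof -
  let ?m = "mesh TYPE('a)"
  \<comment> \<open>The mesh-wide closed neighbourhood of \<open>K\<close>, pulled back by the shift
    \<open>v\<close>. For \<open>v = grid n x\<close> it contains the pull-back of \<open>K\<close>
    by \<open>x\<close>, and it is a closed bounded window that can be counted.\<close>
  define L where "L n v = {y. infdist (v + y) K \<le> ?m n}" for n and v :: 'a
  obtain R where R: "K \<subseteq> cball 0 R"
    using K(2) unfolding bounded_any_center[of K 0] by (auto simp: subset_eq)
  have m: "?m n \<le> DIM('a)" for n
    by (simp add: mesh_def divide_simps)
  have L_sub: "L n v \<subseteq> cball 0 (norm v + R + ?m n)" for n v
  proof
    fix y assume "y \<in> L n v"
    then have y: "infdist (v + y) K \<le> ?m n" by (simp add: L_def)
    obtain z where z: "z \<in> K" "infdist (v + y) K = dist (v + y) z"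
      using infdist_attains_inf[OF K(1,3)] by blast
    have "norm z \<le> R" using R z(1) by auto
    then show "y \<in> cball 0 (norm v + R + ?m n)"
      using y z(2) norm_triangle_ineq[of "v + y - z" z] norm_triangle_ineq4[of "v + y" v]
      by (simp add: dist_norm)
  qed
  have L_closed: "closed (L n v)" for n v
    unfolding L_def by (intro closed_Collect_le continuous_intros)
  have meas: "(\<lambda>(x, S). real (card (S \<inter> L n (grid n x)))) \<in> borel_measurable (borel \<Otimes>\<^sub>M point_configs)" for n
    unfolding split_beta
  \<comment> \<open>For a frozen corner \<open>v\<close> the count depends on \<open>S\<close>
    alone, and there are only countably many corners.\<close>
  proof (rule measurable_compose_countable'[where I = "range (grid n)" and g = "\<lambda>p. grid n (fst p)"])
    fix v :: 'a
    have "(\<lambda>S. card (S \<inter> L n v)) \<in> measurable point_configs (count_space UNIV)"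
      using L_closed bounded_subset[OF bounded_cball L_sub] by (intro measurable_card_Int) auto
    then show "(\<lambda>x. real (card (snd x \<inter> L n v))) \<in> borel_measurable (borel \<Otimes>\<^sub>M point_configs)"
      by measurable
  next
    show "(\<lambda>p. grid n (fst p)) \<in> borel \<Otimes>\<^sub>M point_configs \<rightarrow>\<^sub>M count_space (range (grid n))"
      by (rule measurable_compose[OF measurable_fst measurable_grid_count_space])
  qed (rule countable_range_grid)
  show ?thesis
  proof (rule borel_measurable_LIMSEQ_real[OF _ meas])
    fix p :: "'a \<times> 'a set" assume "p \<in> space (borel \<Otimes>\<^sub>M point_configs)"
    then obtain x S where p: "p = (x, S)" and S: "locally_finite_set S"
      by (auto simp: space_pair_measure)
    have "\<forall>\<^sub>F n in sequentially. S \<inter> L n (grid n x) = S \<inter> (\<lambda>y. x + y) -` K"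
    proof (rule eventually_Int_locally_finite[OF S])
      let ?W = "cball 0 (norm x + R + 2 * DIM('a))"
      show "bounded ?W" by simp
      show "L n (grid n x) \<subseteq> ?W" for n
      proof
        fix y assume "y \<in> L n (grid n x)"
        then have "norm y \<le> norm (grid n x) + R + ?m n"
          using L_sub by fastforce
        then show "y \<in> ?W"
          using dist_grid[of n x] m[of n] norm_triangle_ineq[of "grid n x - x" x] by (simp add: dist_norm)
      qed
      show "(\<lambda>y. x + y) -` K \<subseteq> ?W"
      proof
        fix y assume "y \<in> (\<lambda>y. x + y) -` K"
        then have "norm (x + y) \<le> R" using R by auto
        then have "norm y \<le> norm x + R"
          using norm_triangle_ineq4[of "x + y" x] by simp
        then show "y \<in> ?W"
          by (auto intro: order_trans)
      qed
      fix y
      have d: "dist (grid n x + y) (x + y) \<le> ?m n" for n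
        using dist_grid[of n x] by (simp add: dist_norm)
      show "\<forall>\<^sub>F n in sequentially. y \<in> L n (grid n x) \<longleftrightarrow> y \<in> (\<lambda>y. x + y) -` K"
      proof (cases "x + y \<in> K")
        case True
        then have "y \<in> L n (grid n x)" for n
          using d[of n] infdist_le[of "x + y" K "grid n x + y"] by (simp add: L_def)
        then show ?thesis using True by simp
      next
        case False
        then have "infdist (x + y) K > 0"
          using K infdist_pos_not_in_closed by blast
        then have "\<forall>\<^sub>F n in sequentially. ?m n < infdist (x + y) K / 2"
          using order_tendstoD(2)[OF mesh_tendsto_0[where 'a='a]] by (simp del: divide_less_eq_numeral1 less_divide_eq_numeral1)
        then show ?thesis
        proof eventually_elim
          case (elim n)
          then show ?case
            using False d[of n] infdist_triangle[of "x + y" K "grid n x + y"]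
            by (simp add: L_def dist_commute)
        qed
      qed
    qed
    then have "\<forall>\<^sub>F n in sequentially. real (card (S \<inter> L n (grid n x))) = real (card (S \<inter> (\<lambda>y. x + y) -` K))"
      by eventually_elim simp
    then show "(\<lambda>n. case p of (x, S) \<Rightarrow> real (card (S \<inter> L n (grid n x))))
        \<longlonglongrightarrow> (case p of (x, S) \<Rightarrow> real (card (S \<inter> (\<lambda>y. x + y) -` K)))"
      unfolding p by (simp add: tendsto_eventually)
  qed
qed

lemma bounded_vimage_shift:
  fixes x :: "'a::euclidean_space"
  assumes "bounded A" shows "bounded ((\<lambda>y. x + y) -` A)"
proof -
  have "(\<lambda>y. x + y) -` A = (\<lambda>y. - x + y) ` A"
    by (auto simp: image_iff intro!: bexI[where x="x + _"])
  then show ?thesis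
    using bounded_translation[OF assms] by metis
qed

text \<open>A daughter set is seen from a random parent, so its count in \<open>A\<close> shifted by
  \<open>- x\<close> must be measurable jointly in shift and configuration. Closed sets are covered
  by the grid argument and form an intersection-stable generator of the Borel sets; complements and
  disjoint unions follow by subtracting and summing counts.\<close>

lemma measurable_card_shift:
  fixes A :: "'a::euclidean_space set"
  assumes A: "A \<in> sets borel" "bounded A"
  shows "(\<lambda>(x, S). card (S \<inter> (\<lambda>y. x + y) -` A)) \<in> measurable (borel \<Otimes>\<^sub>M point_configs) (count_space UNIV)"
proof -
  obtain R where R: "A \<subseteq> cball 0 R"
    using A(2) unfolding bounded_any_center[of A 0] by (auto simp: subset_eq)
  define W :: "'a set" where "W = cball 0 R"
  have W: "closed W" "bounded W" by (auto simp: W_def)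
  \<comment> \<open>Cutting with the bounded \<open>W\<close> keeps the count finite for every Borel
    \<open>B\<close>, so that a complement is a genuine difference. Real values allow this
    difference and the limit.\<close>
  define N where "N B = (\<lambda>(x, S). real (card (S \<inter> (\<lambda>y. x + y) -` (B \<inter> W))))" for B
  let ?M = "borel \<Otimes>\<^sub>M (point_configs :: 'a set measure)"
  have closed: "N B \<in> borel_measurable ?M" if "closed B" for B
  proof (cases "B \<inter> W = {}")
    case False
    then show ?thesis
      unfolding N_def using that W by (intro measurable_grid_card_shift) auto
  qed (simp add: N_def)
  have fin: "finite (S \<inter> (\<lambda>y. x + y) -` W)" if "(x, S) \<in> space ?M" for x S
    using that W by (intro finite_Int_locally_finite bounded_vimage_shift) (auto simp: space_pair_measure)
  have "Int_stable (Collect closed :: 'a set set)" "Collect closed \<subseteq> Pow (UNIV :: 'a set)"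
    "A \<in> sigma_sets UNIV (Collect closed)"
    using A(1) by (auto simp: Int_stable_def borel_eq_closed)
  then have "N A \<in> borel_measurable ?M"
  proof (induction rule: sigma_sets_induct_disjoint)
    case (basic B)
    then show ?case using closed by simp
  next
    case empty
    show ?case using closed[of "{}"] by simp
  next
    case (compl B)
    have "(\<lambda>p. N UNIV p - N B p) \<in> borel_measurable ?M"
      using compl closed[of UNIV] by measurable
    moreover have "N UNIV p - N B p = N (UNIV - B) p" if p: "p \<in> space ?M" for p
    proof -
      obtain x S where xS: "p = (x, S)" by (cases p)
      have f: "finite (S \<inter> (\<lambda>y. x + y) -` W)" using fin p xS by simp
      have eq: "S \<inter> (\<lambda>y. x + y) -` W = S \<inter> (\<lambda>y. x + y) -` (B \<inter> W) \<union> S \<inter> (\<lambda>y. x + y) -` ((UNIV - B) \<inter> W)"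
        by auto
      have "card (S \<inter> (\<lambda>y. x + y) -` W) = card (S \<inter> (\<lambda>y. x + y) -` (B \<inter> W)) + card (S \<inter> (\<lambda>y. x + y) -` ((UNIV - B) \<inter> W))"
        unfolding eq
      proof (rule card_Un_disjoint)
        show "finite (S \<inter> (\<lambda>y. x + y) -` (B \<inter> W))" "finite (S \<inter> (\<lambda>y. x + y) -` ((UNIV - B) \<inter> W))"
          by (rule finite_subset[OF _ f]; auto)+
      qed auto
      then show ?thesis by (simp add: N_def xS)
    qed
    ultimately show ?case
      by (subst measurable_cong[where g="\<lambda>p. N UNIV p - N B p"]) auto
  next
    case (union B)
    have Bn: "N (B i) \<in> borel_measurable ?M" for i using union by auto
    have "(\<lambda>p. \<Sum>i<n. N (B i) p) \<in> borel_measurable ?M" for n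
      using Bn by measurable
    moreover have "(\<lambda>n. \<Sum>i<n. N (B i) p) \<longlonglongrightarrow> N (\<Union>i. B i) p" if p: "p \<in> space ?M" for p
    proof -
      obtain x S where xS: "p = (x, S)" by (cases p)
      have S: "locally_finite_set S" using p xS by (auto simp: space_pair_measure)
      let ?sh = "\<lambda>B. (\<lambda>y. x + y) -` B"
      have "(\<Sum>i<n. N (B i) p) = real (card (S \<inter> ?sh ((\<Union>i<n. B i) \<inter> W)))" for n
      proof -
        have "S \<inter> ?sh ((\<Union>i<n. B i) \<inter> W) = (\<Union>i<n. S \<inter> ?sh (B i \<inter> W))" by auto
        also have "card \<dots> = (\<Sum>i<n. card (S \<inter> ?sh (B i \<inter> W)))"
        proof (rule card_UN_disjoint)
          have "finite (S \<inter> ?sh W)" using fin p xS by simp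
          then show "\<forall>i\<in>{..<n}. finite (S \<inter> ?sh (B i \<inter> W))"
            by (auto intro: finite_subset[of _ "S \<inter> ?sh W"])
          show "\<forall>i\<in>{..<n}. \<forall>j\<in>{..<n}. i \<noteq> j \<longrightarrow> S \<inter> ?sh (B i \<inter> W) \<inter> (S \<inter> ?sh (B j \<inter> W)) = {}"
            using union(1) unfolding disjoint_family_on_def by blast
        qed simp
        finally show ?thesis by (simp add: N_def xS)
      qed
      moreover have "\<forall>\<^sub>F n in sequentially. S \<inter> ?sh ((\<Union>i<n. B i) \<inter> W) = S \<inter> ?sh ((\<Union>i. B i) \<inter> W)"
      proof (rule eventually_Int_locally_finite[OF S bounded_vimage_shift[OF W(2), of x]])
        fix y
        show "\<forall>\<^sub>F n in sequentially. y \<in> ?sh ((\<Union>i<n. B i) \<inter> W) \<longleftrightarrow> y \<in> ?sh ((\<Union>i. B i) \<inter> W)"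
        proof (cases "\<exists>i. x + y \<in> B i")
          case True
          then obtain i where "x + y \<in> B i" by auto
          then show ?thesis
            by (intro eventually_mono[OF eventually_gt_at_top[of i]]) auto
        qed auto
      qed auto
      ultimately show ?thesis
        by (intro tendsto_eventually) (auto simp: N_def xS elim!: eventually_mono)
    qed
    ultimately show ?case
      by (rule borel_measurable_LIMSEQ_real[rotated])
  qed
  moreover have "A \<inter> W = A" using R by (auto simp: W_def)
  ultimately have m: "(\<lambda>(x, S). real (card (S \<inter> (\<lambda>y. x + y) -` A))) \<in> borel_measurable ?M"
    by (simp add: N_def)
  have "(\<lambda>p. nat \<lfloor>(\<lambda>(x, S). real (card (S \<inter> (\<lambda>y. x + y) -` A))) p\<rfloor>) \<in> ?M \<rightarrow>\<^sub>M count_space UNIV"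
    using m by measurable
  then show ?thesis by (simp add: split_beta)
qed

section \<open>Generating functionals of Poisson processes\<close>

text \<open>The \<open>n\<close>-th partial sum is the expectation of \<open>c (N \<omega>)\<close>
  cut off to \<open>N \<omega> < n\<close>, and \<open>C\<close> dominates. It turns expectations of
  powers of \<open>t\<close> into power series of point probabilities.\<close>

lemma (in prob_space) sums_expectation_nat:
  fixes c :: "nat \<Rightarrow> real"
  assumes N [measurable]: "N \<in> measurable M (count_space UNIV)" and c: "\<And>k. \<bar>c k\<bar> \<le> C"
  shows "(\<lambda>k. c k * prob {\<omega> \<in> space M. N \<omega> = k}) sums (\<integral>\<omega>. c (N \<omega>) \<partial>M)"
proof -
  let ?S = "\<lambda>n \<omega>. \<Sum>k<n. c k * indicator {\<omega> \<in> space M. N \<omega> = k} \<omega>"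
  have eq: "?S n \<omega> = (if N \<omega> < n then c (N \<omega>) else 0)" if "\<omega> \<in> space M" for n \<omega>
  proof -
    have "?S n \<omega> = (\<Sum>k<n. if k = N \<omega> then c k else 0)"
      using that by (intro sum.cong) (auto simp: indicator_def)
    also have "\<dots> = (if N \<omega> < n then c (N \<omega>) else 0)" by simp
    finally show ?thesis .
  qed
  have "(\<lambda>n. \<integral>\<omega>. ?S n \<omega> \<partial>M) \<longlonglongrightarrow> (\<integral>\<omega>. c (N \<omega>) \<partial>M)"
  proof (rule integral_dominated_convergence[where w="\<lambda>_. C"])
    show "AE \<omega> in M. (\<lambda>n. ?S n \<omega>) \<longlonglongrightarrow> c (N \<omega>)"
    proof (rule AE_I2)
      fix \<omega> assume "\<omega> \<in> space M"
      then have "\<forall>\<^sub>F n in sequentially. ?S n \<omega> = c (N \<omega>)"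
        by (intro eventually_mono[OF eventually_gt_at_top[of "N \<omega>"]]) (simp only: eq if_True)
      then show "(\<lambda>n. ?S n \<omega>) \<longlonglongrightarrow> c (N \<omega>)"
        by (rule tendsto_eventually)
    qed
    show "AE \<omega> in M. norm (?S n \<omega>) \<le> C" for n
      using c order_trans[OF abs_ge_zero c] by (intro AE_I2) (simp only: eq, simp)
  qed auto
  moreover have "(\<integral>\<omega>. ?S n \<omega> \<partial>M) = (\<Sum>k<n. c k * prob {\<omega> \<in> space M. N \<omega> = k})" for n
    by (subst Bochner_Integration.integral_sum)
      (auto simp: less_top[symmetric] Int_absorb2 intro!: integrable_mult_right integrable_real_indicator sum.cong)
  ultimately show ?thesis
    by (simp add: sums_def)
qed

lemma poisson_processD:
  assumes "poisson_process M f \<Phi>"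
  shows "prob_space M" "\<Phi> \<in> measurable M point_configs"
    "\<And>\<omega>. \<omega> \<in> space M \<Longrightarrow> locally_finite_set (\<Phi> \<omega>)"
    "\<And>B k. B \<in> sets borel \<Longrightarrow> bounded B \<Longrightarrow>
        measure M {\<omega> \<in> space M. card (\<Phi> \<omega> \<inter> B) = k} =
          (LINT y:B|lborel. f y) ^ k / fact k * exp (- (LINT y:B|lborel. f y))"
    "\<And>\<B>. finite \<B> \<Longrightarrow> disjoint \<B> \<Longrightarrow> (\<And>B. B \<in> \<B> \<Longrightarrow> B \<in> sets borel \<and> bounded B) \<Longrightarrow>
        prob_space.indep_vars M (\<lambda>_. count_space UNIV) (\<lambda>B \<omega>. card (\<Phi> \<omega> \<inter> B)) \<B>"
proof -
  show *: "prob_space M" "\<Phi> \<in> measurable M point_configs"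
    using assms by (auto simp: poisson_process_def point_process_def)
  show "locally_finite_set (\<Phi> \<omega>)" if "\<omega> \<in> space M" for \<omega>
    using measurable_space[OF *(2) that] by simp
qed (use assms in \<open>auto simp: poisson_process_def\<close>)

lemma measurable_card_process:
  assumes "\<Phi> \<in> measurable M point_configs" "B \<in> sets borel" "bounded B"
  shows "(\<lambda>\<omega>. card (\<Phi> \<omega> \<inter> B)) \<in> measurable M (count_space UNIV)"
  by (rule measurable_compose[OF assms(1) measurable_card_Int[OF assms(2,3)]])

lemma poisson_pgf:
  assumes \<Phi>: "poisson_process M f \<Phi>" and B: "B \<in> sets borel" "bounded B" and s: "0 \<le> s" "s \<le> 1"
  shows "(\<integral>\<omega>. s ^ card (\<Phi> \<omega> \<inter> B) \<partial>M) = exp (- ((1 - s) * (LINT y:B|lborel. f y)))"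
proof -
  interpret prob_space M using poisson_processD(1)[OF \<Phi>] .
  let ?m = "LINT y:B|lborel. f y"
  have "(\<lambda>k. s ^ k * prob {\<omega> \<in> space M. card (\<Phi> \<omega> \<inter> B) = k}) sums (\<integral>\<omega>. s ^ card (\<Phi> \<omega> \<inter> B) \<partial>M)"
    using s by (intro sums_expectation_nat[where C=1] measurable_card_process poisson_processD(2)[OF \<Phi>] B)
      (auto simp: power_le_one)
  moreover have "(\<lambda>k. s ^ k * prob {\<omega> \<in> space M. card (\<Phi> \<omega> \<inter> B) = k}) sums (exp (s * ?m) * exp (- ?m))"
    unfolding poisson_processD(4)[OF \<Phi> B]
    using sums_mult2[OF exp_converges[of "s * ?m"], of "exp (- ?m)"]
    by (simp add: power_mult_distrib divide_inverse mult_ac)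
  ultimately have "(\<integral>\<omega>. s ^ card (\<Phi> \<omega> \<inter> B) \<partial>M) = exp (s * ?m) * exp (- ?m)"
    by (rule sums_unique2)
  then show ?thesis
    by (simp add: exp_add[symmetric] algebra_simps)
qed

text \<open>\<open>poisson_process\<close> states independence for a set of windows, so the indexed
  family is replaced by its image. Disjoint windows are distinct when they are nonempty, which makes
  \<open>A\<close> injective and allows reindexing. Empty windows contribute a factor 1 and are
  added in \<open>poisson_pgf_prod\<close>.\<close>

lemma poisson_pgf_prod_nonempty:
  fixes c :: "'i \<Rightarrow> real"
  assumes \<Phi>: "poisson_process M f \<Phi>"
    and I: "finite I" "disjoint_family_on A I"
    and A: "\<And>i. i \<in> I \<Longrightarrow> A i \<in> sets borel" "\<And>i. i \<in> I \<Longrightarrow> bounded (A i)"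
    and ne: "\<And>i. i \<in> I \<Longrightarrow> A i \<noteq> {}"
    and c: "\<And>i. i \<in> I \<Longrightarrow> 0 \<le> c i" "\<And>i. i \<in> I \<Longrightarrow> c i \<le> 1"
  shows "(\<integral>\<omega>. (\<Prod>i\<in>I. c i ^ card (\<Phi> \<omega> \<inter> A i)) \<partial>M)
       = exp (- (\<Sum>i\<in>I. (1 - c i) * (LINT y:A i|lborel. f y)))"
proof -
  interpret prob_space M using poisson_processD(1)[OF \<Phi>] .
  have inj: "inj_on A I"
    using I(2) ne by (fastforce simp: inj_on_def disjoint_family_on_def)
  define d where "d B = c (inv_into I A B)" for B
  have d: "d (A i) = c i" if "i \<in> I" for i
    using inv_into_f_f[OF inj that] by (simp add: d_def)
  have "disjoint (A ` I)"
    using I(2) by (rule disjoint_family_on_disjoint_image)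
  then have ind: "indep_vars (\<lambda>_. count_space UNIV) (\<lambda>B \<omega>. card (\<Phi> \<omega> \<inter> B)) (A ` I)"
    using A I by (intro poisson_processD(5)[OF \<Phi>]) auto
  have "indep_vars (\<lambda>_. borel) (\<lambda>B \<omega>. d B ^ card (\<Phi> \<omega> \<inter> B)) (A ` I)"
    by (rule indep_vars_compose2[OF ind, where Y="\<lambda>B k. d B ^ k"]) simp
  then have "(\<integral>\<omega>. (\<Prod>B\<in>A ` I. d B ^ card (\<Phi> \<omega> \<inter> B)) \<partial>M) = (\<Prod>B\<in>A ` I. \<integral>\<omega>. d B ^ card (\<Phi> \<omega> \<inter> B) \<partial>M)"
  proof (rule indep_vars_lebesgue_integral[rotated])
    fix B assume "B \<in> A ` I"
    then obtain i where i: "i \<in> I" "B = A i" by auto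
    then show "integrable M (\<lambda>\<omega>. d B ^ card (\<Phi> \<omega> \<inter> B))"
      using c[of i] A[of i]
      by (intro integrable_const_bound[where B=1] AE_I2 measurable_compose[OF measurable_card_process[OF poisson_processD(2)[OF \<Phi>]]])
        (auto simp: d power_le_one)
  qed (use I in auto)
  also have "\<dots> = (\<Prod>i\<in>I. \<integral>\<omega>. c i ^ card (\<Phi> \<omega> \<inter> A i) \<partial>M)"
    by (subst prod.reindex[OF inj]) (auto intro!: prod.cong simp: d)
  also have "\<dots> = (\<Prod>i\<in>I. exp (- ((1 - c i) * (LINT y:A i|lborel. f y))))"
    by (intro prod.cong refl poisson_pgf[OF \<Phi>]) (use A c in auto)
  also have "\<dots> = exp (- (\<Sum>i\<in>I. (1 - c i) * (LINT y:A i|lborel. f y)))"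
    using I by (simp add: exp_sum sum_negf[symmetric])
  also have "(\<integral>\<omega>. (\<Prod>B\<in>A ` I. d B ^ card (\<Phi> \<omega> \<inter> B)) \<partial>M) = (\<integral>\<omega>. (\<Prod>i\<in>I. c i ^ card (\<Phi> \<omega> \<inter> A i)) \<partial>M)"
    by (subst prod.reindex[OF inj]) (auto intro!: Bochner_Integration.integral_cong prod.cong simp: d)
  finally show ?thesis .
qed

lemma poisson_pgf_prod:
  fixes c :: "'i \<Rightarrow> real"
  assumes \<Phi>: "poisson_process M f \<Phi>"
    and I: "finite I" "disjoint_family_on A I"
    and A: "\<And>i. i \<in> I \<Longrightarrow> A i \<in> sets borel" "\<And>i. i \<in> I \<Longrightarrow> bounded (A i)"
    and c: "\<And>i. i \<in> I \<Longrightarrow> 0 \<le> c i" "\<And>i. i \<in> I \<Longrightarrow> c i \<le> 1"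
  shows "(\<integral>\<omega>. (\<Prod>i\<in>I. c i ^ card (\<Phi> \<omega> \<inter> A i)) \<partial>M)
       = exp (- (\<Sum>i\<in>I. (1 - c i) * (LINT y:A i|lborel. f y)))"
proof -
  let ?I = "{i \<in> I. A i \<noteq> {}}"
  have "(\<integral>\<omega>. (\<Prod>i\<in>I. c i ^ card (\<Phi> \<omega> \<inter> A i)) \<partial>M) = (\<integral>\<omega>. (\<Prod>i\<in>?I. c i ^ card (\<Phi> \<omega> \<inter> A i)) \<partial>M)"
    using I by (intro Bochner_Integration.integral_cong refl prod.mono_neutral_right) auto
  also have "\<dots> = exp (- (\<Sum>i\<in>?I. (1 - c i) * (LINT y:A i|lborel. f y)))"
    using I A c by (intro poisson_pgf_prod_nonempty[OF \<Phi>]) (auto simp: disjoint_family_on_def)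
  also have "(\<Sum>i\<in>?I. (1 - c i) * (LINT y:A i|lborel. f y)) = (\<Sum>i\<in>I. (1 - c i) * (LINT y:A i|lborel. f y))"
    using I by (intro sum.mono_neutral_left) (auto simp: set_lebesgue_integral_def)
  finally show ?thesis .
qed

lemma prod_finite_range:
  fixes g :: "'a \<Rightarrow> real"
  assumes "finite (S \<inter> W)" "finite (g ` W)"
  shows "(\<Prod>x\<in>S \<inter> W. g x) = (\<Prod>c\<in>g ` W. c ^ card (S \<inter> (W \<inter> g -` {c})))"
proof -
  have "(\<Prod>x\<in>S \<inter> W. g x) = (\<Prod>c\<in>g ` W. \<Prod>x\<in>{x \<in> S \<inter> W. g x = c}. g x)"
    by (rule prod.group[symmetric]) (use assms in auto)
  also have "\<dots> = (\<Prod>c\<in>g ` W. c ^ card (S \<inter> (W \<inter> g -` {c})))"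
  proof (rule prod.cong[OF refl])
    fix c
    have eq: "{x \<in> S \<inter> W. g x = c} = S \<inter> (W \<inter> g -` {c})" by auto
    have "(\<Prod>x\<in>{x \<in> S \<inter> W. g x = c}. g x) = (\<Prod>x\<in>{x \<in> S \<inter> W. g x = c}. c)"
      by (rule prod.cong) auto
    then show "(\<Prod>x\<in>{x \<in> S \<inter> W. g x = c}. g x) = c ^ card (S \<inter> (W \<inter> g -` {c}))"
      by (simp only: prod_constant eq)
  qed
  finally show ?thesis .
qed

text \<open>The level sets of \<open>g\<close> in \<open>W\<close> are finitely many disjoint
  windows, and grouping the points by their value turns the product into powers of window
  counts.\<close>

lemma poisson_functional_finite_range:
  fixes g :: "'a::euclidean_space \<Rightarrow> real"
  assumes \<Phi>: "poisson_process M (\<lambda>_. l) \<Phi>" and W: "W \<in> sets borel" "bounded W"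
    and g [measurable]: "g \<in> borel_measurable borel" and g01: "\<And>x. 0 \<le> g x" "\<And>x. g x \<le> 1"
    and fin: "finite (g ` W)"
  shows "(\<lambda>\<omega>. \<Prod>x\<in>\<Phi> \<omega> \<inter> W. g x) \<in> borel_measurable M" (is ?m)
    and "(\<integral>\<omega>. (\<Prod>x\<in>\<Phi> \<omega> \<inter> W. g x) \<partial>M) = exp (- (l * (LINT x:W|lborel. 1 - g x)))" (is ?i)
proof -
  let ?A = "\<lambda>c. W \<inter> g -` {c}"
  have A: "?A c \<in> sets borel" "bounded (?A c)" for c
    using W measurable_sets_borel[OF g, of "{c}"] by (auto intro: bounded_subset)
  have eq: "(\<Prod>x\<in>\<Phi> \<omega> \<inter> W. g x) = (\<Prod>c\<in>g ` W. c ^ card (\<Phi> \<omega> \<inter> ?A c))" if "\<omega> \<in> space M" for \<omega>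
    using finite_Int_locally_finite[OF poisson_processD(3)[OF \<Phi> that] W(2)] fin
    by (rule prod_finite_range)
  have [measurable]: "(\<lambda>\<omega>. card (\<Phi> \<omega> \<inter> ?A c)) \<in> M \<rightarrow>\<^sub>M count_space UNIV" for c
    by (rule measurable_card_process[OF poisson_processD(2)[OF \<Phi>] A])
  have "(\<lambda>\<omega>. \<Prod>c\<in>g ` W. c ^ card (\<Phi> \<omega> \<inter> ?A c)) \<in> borel_measurable M"
    by measurable
  then show ?m
    by (rule measurable_cong[THEN iffD1, rotated]) (simp add: eq)
  have "(\<integral>\<omega>. (\<Prod>x\<in>\<Phi> \<omega> \<inter> W. g x) \<partial>M) = (\<integral>\<omega>. (\<Prod>c\<in>g ` W. c ^ card (\<Phi> \<omega> \<inter> ?A c)) \<partial>M)"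
    by (intro Bochner_Integration.integral_cong) (simp_all add: eq)
  also have "\<dots> = exp (- (\<Sum>c\<in>g ` W. (1 - c) * (LINT y:?A c|lborel. l)))"
    using A g01 by (intro poisson_pgf_prod_nonempty[OF \<Phi> fin]) (auto simp: disjoint_family_on_def)
  also have "(\<Sum>c\<in>g ` W. (1 - c) * (LINT y:?A c|lborel. l)) = l * (\<Sum>c\<in>g ` W. (1 - c) * measure lborel (?A c))"
    unfolding sum_distrib_left by (intro sum.cong) (auto simp: set_lebesgue_integral_def)
  also have "(\<Sum>c\<in>g ` W. (1 - c) * measure lborel (?A c)) = (LINT x:W|lborel. 1 - g x)"
  proof -
    have fm: "emeasure lborel (?A c) < \<infinity>" for c
      using emeasure_bounded_finite[OF A(2)] by simp
    have "(LINT x:W|lborel. 1 - g x) = (\<integral>x. (\<Sum>c\<in>g ` W. (1 - c) * indicator (?A c) x) \<partial>lborel)"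
      unfolding set_lebesgue_integral_def
    proof (intro Bochner_Integration.integral_cong refl)
      fix x
      have "(\<Sum>c\<in>g ` W. (1 - c) * indicator (?A c) x) = (\<Sum>c\<in>g ` W. if g x = c then indicator W x * (1 - c) else 0 :: real)"
        by (intro sum.cong) (auto simp: indicator_def)
      also have "\<dots> = indicator W x *\<^sub>R (1 - g x)"
        using fin by (auto simp: indicator_def)
      finally show "indicator W x *\<^sub>R (1 - g x) = (\<Sum>c\<in>g ` W. (1 - c) * indicator (?A c) x)" ..
    qed
    also have "\<dots> = (\<Sum>c\<in>g ` W. (1 - c) * measure lborel (?A c))"
      using A fm by (subst Bochner_Integration.integral_sum)
        (auto intro!: integrable_mult_right integrable_real_indicator)
    finally show ?thesis ..
  qed
  finally show ?i .
qed

text \<open>The generating functional of a homogeneous Poisson process on a window. Rounding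
  \<open>g\<close> down to multiples of \<open>1 / Suc n\<close> leaves finitely many values; the
  products over the finite set of points converge, and all quantities stay in \<open>[0, 1]\<close>,
  so dominated convergence passes to \<open>g\<close> on both sides.\<close>

lemma poisson_functional:
  fixes g :: "'a::euclidean_space \<Rightarrow> real"
  assumes \<Phi>: "poisson_process M (\<lambda>_. l) \<Phi>" and W: "W \<in> sets borel" "bounded W"
    and g [measurable]: "g \<in> borel_measurable borel" and g01: "\<And>x. 0 \<le> g x" "\<And>x. g x \<le> 1"
  shows "(\<lambda>\<omega>. \<Prod>x\<in>\<Phi> \<omega> \<inter> W. g x) \<in> borel_measurable M" (is ?m)
    and "(\<integral>\<omega>. (\<Prod>x\<in>\<Phi> \<omega> \<inter> W. g x) \<partial>M) = exp (- (l * (LINT x:W|lborel. 1 - g x)))" (is ?i)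
proof -
  interpret prob_space M using poisson_processD(1)[OF \<Phi>] .
  define h where "h n x = real_of_int \<lfloor>real (Suc n) * g x\<rfloor> / real (Suc n)" for n x
  have [measurable]: "h n \<in> borel_measurable borel" for n
    unfolding h_def by measurable
  have h_le: "h n x \<le> g x" for n x
  proof -
    have "real_of_int \<lfloor>real (Suc n) * g x\<rfloor> \<le> real (Suc n) * g x" by linarith
    then show ?thesis by (simp add: h_def divide_simps mult.commute)
  qed
  have h_ge: "g x - 1 / real (Suc n) \<le> h n x" for n x
  proof -
    have "real (Suc n) * g x - 1 \<le> real_of_int \<lfloor>real (Suc n) * g x\<rfloor>" by linarith
    then show ?thesis by (simp add: h_def divide_simps mult.commute)
  qed
  have h01: "0 \<le> h n x" "h n x \<le> 1" for n x
    using g01[of x] h_le[of n x] by (simp_all add: h_def order_trans)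
  have lim: "(\<lambda>n. h n x) \<longlonglongrightarrow> g x" for x
  proof (rule tendsto_sandwich)
    show "(\<lambda>n. g x - 1 / real (Suc n)) \<longlonglongrightarrow> g x"
      using tendsto_diff[OF tendsto_const LIMSEQ_Suc[OF lim_const_over_n[of 1]], of "g x"] by simp
  qed (use h_le h_ge in auto)
  have fin: "finite (h n ` W)" for n
  proof (rule finite_subset)
    show "h n ` W \<subseteq> (\<lambda>i. real_of_int i / real (Suc n)) ` {0..int (Suc n)}"
    proof
      fix y assume "y \<in> h n ` W"
      then obtain x where y: "y = h n x" by auto
      have "real (Suc n) * g x \<le> real (Suc n) * 1"
        using g01 by (intro mult_left_mono) auto
      then have "\<lfloor>real (Suc n) * g x\<rfloor> \<le> int (Suc n)"
        by (simp only: mult_1_right floor_le_iff)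
      moreover have "0 \<le> \<lfloor>real (Suc n) * g x\<rfloor>"
        using g01[of x] by simp
      ultimately show "y \<in> (\<lambda>i. real_of_int i / real (Suc n)) ` {0..int (Suc n)}"
        unfolding y h_def by auto
    qed
  qed simp
  note fr = poisson_functional_finite_range[OF \<Phi> W _ h01 fin]
  have lim_prod: "(\<lambda>n. \<Prod>x\<in>\<Phi> \<omega> \<inter> W. h n x) \<longlonglongrightarrow> (\<Prod>x\<in>\<Phi> \<omega> \<inter> W. g x)" for \<omega>
    by (intro tendsto_prod lim)
  have meas: "(\<lambda>\<omega>. \<Prod>x\<in>\<Phi> \<omega> \<inter> W. h n x) \<in> borel_measurable M" for n
    by (rule fr) auto
  show ?m
    by (rule borel_measurable_LIMSEQ_real[OF lim_prod meas])
  have "(\<lambda>n. \<integral>\<omega>. (\<Prod>x\<in>\<Phi> \<omega> \<inter> W. h n x) \<partial>M) \<longlonglongrightarrow> (\<integral>\<omega>. (\<Prod>x\<in>\<Phi> \<omega> \<inter> W. g x) \<partial>M)"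
    by (rule integral_dominated_convergence[where w="\<lambda>_. 1"])
      (use \<open>?m\<close> meas lim_prod h01 in \<open>auto simp: abs_prod intro!: prod_le_1\<close>)
  moreover have "(\<lambda>n. \<integral>\<omega>. (\<Prod>x\<in>\<Phi> \<omega> \<inter> W. h n x) \<partial>M) \<longlonglongrightarrow> exp (- (l * (LINT x:W|lborel. 1 - g x)))"
  proof -
    have eq: "(\<integral>\<omega>. (\<Prod>x\<in>\<Phi> \<omega> \<inter> W. h n x) \<partial>M) = exp (- (l * (LINT x:W|lborel. 1 - h n x)))" for n
      by (rule fr) auto
    have "(\<lambda>n. LINT x:W|lborel. 1 - h n x) \<longlonglongrightarrow> (LINT x:W|lborel. 1 - g x)"
      unfolding set_lebesgue_integral_def
    proof (rule integral_dominated_convergence[where w="indicator W"])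
      show "integrable lborel (indicator W :: 'a \<Rightarrow> real)"
        using W emeasure_bounded_finite[OF W(2)] by (intro integrable_real_indicator) auto
      show "AE x in lborel. (\<lambda>n. indicator W x *\<^sub>R (1 - h n x)) \<longlonglongrightarrow> indicator W x *\<^sub>R (1 - g x)"
        by (intro AE_I2 tendsto_intros lim)
      show "AE x in lborel. norm (indicator W x *\<^sub>R (1 - h n x)) \<le> indicator W x" for n
        using h01[of n] by (intro AE_I2) (auto simp: indicator_def)
    qed (use W in measurable)
    then show ?thesis
      unfolding eq by (intro tendsto_intros)
  qed
  ultimately show ?i
    by (rule LIMSEQ_unique)
qed

section \<open>Lebesgue measure of shifted sets and of windows cut by a moving ball\<close>

lemma emeasure_lborel_shift:
  fixes B :: "'a::euclidean_space set"
  assumes "B \<in> sets borel"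
  shows "emeasure lborel ((\<lambda>y. x + y) -` B) = emeasure lborel B"
  using arg_cong[OF lborel_distr_plus[of x], of "\<lambda>m. emeasure m B"] assms
  by (simp add: emeasure_distr)

lemma measure_lborel_shift:
  fixes B :: "'a::euclidean_space set"
  assumes "B \<in> sets borel"
  shows "measure lborel ((\<lambda>y. x + y) -` B) = measure lborel B"
  by (simp add: measure_def emeasure_lborel_shift[OF assms])

lemma shift_borel [measurable]:
  fixes B :: "'a::euclidean_space set"
  assumes [measurable]: "B \<in> sets borel"
  shows "(\<lambda>y. x + y) -` B \<in> sets borel"
  by (rule measurable_sets_borel[OF _ assms]) measurable

lemma emeasure_Int_cball_eq:
  fixes A :: "'a::euclidean_space set"
  assumes [measurable]: "A \<in> sets borel"
  shows "emeasure lborel (A \<inter> cball x rd) = ennreal (measure lborel (A \<inter> cball x rd))"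
proof -
  have "bounded (A \<inter> cball x rd)" by (auto intro: bounded_subset[of "cball x rd"])
  then show ?thesis
    by (intro emeasure_eq_ennreal_measure) (use emeasure_bounded_finite in force)
qed

text \<open>The measure is an integral over \<open>y\<close> of an indicator that is jointly
  measurable in \<open>x\<close> and \<open>y\<close>, hence measurable in the parameter.\<close>

lemma borel_measurable_measure_Int_cball:
  fixes A :: "'a::euclidean_space set"
  assumes [measurable]: "A \<in> sets borel"
  shows "(\<lambda>x. measure lborel (A \<inter> cball x rd)) \<in> borel_measurable borel"
proof -
  have "(\<lambda>x. \<integral>\<^sup>+y. indicator A y * indicator {p. dist (fst p) (snd p) \<le> rd} (x, y) \<partial>lborel) \<in> borel_measurable borel"
    by measurable
  also have "(\<lambda>x. \<integral>\<^sup>+y. indicator A y * indicator {p. dist (fst p) (snd p) \<le> rd} (x, y) \<partial>lborel)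
      = (\<lambda>x. emeasure lborel (A \<inter> cball x rd))"
  proof
    fix x
    have "(\<integral>\<^sup>+y. indicator A y * indicator {p. dist (fst p) (snd p) \<le> rd} (x, y) \<partial>lborel)
        = (\<integral>\<^sup>+y. indicator (A \<inter> cball x rd) y \<partial>lborel)"
      by (intro nn_integral_cong) (auto simp: indicator_def)
    then show "(\<integral>\<^sup>+y. indicator A y * indicator {p. dist (fst p) (snd p) \<le> rd} (x, y) \<partial>lborel)
        = emeasure lborel (A \<inter> cball x rd)" by simp
  qed
  finally show ?thesis
    unfolding measure_def by measurable
qed

text \<open>This is the mean number of daughters in \<open>A\<close> of a parent at
  \<open>x\<close>: shifting by \<open>x\<close> moves the support of the intensity to
  \<open>cball x rd\<close>.\<close>

lemma LINT_daughter_intensity: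
  fixes A :: "'a::euclidean_space set"
  assumes A: "A \<in> sets borel"
  shows "(LINT y:(\<lambda>y. x + y) -` A|lborel. ld * indicator {y. norm y \<le> rd} y) = ld * measure lborel (A \<inter> cball x rd)"
proof -
  have eq: "(\<lambda>y. x + y) -` A \<inter> cball 0 rd = (\<lambda>y. x + y) -` (A \<inter> cball x rd)"
    by (auto simp: dist_norm)
  have "(LINT y:(\<lambda>y. x + y) -` A|lborel. ld * indicator {y. norm y \<le> rd} y)
      = (\<integral>y. ld * indicator ((\<lambda>y. x + y) -` A \<inter> cball 0 rd) y \<partial>lborel)"
    unfolding set_lebesgue_integral_def
    by (intro Bochner_Integration.integral_cong) (auto simp: indicator_def)
  also have "\<dots> = ld * measure lborel ((\<lambda>y. x + y) -` (A \<inter> cball x rd))"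
    unfolding eq by simp
  also have "\<dots> = ld * measure lborel (A \<inter> cball x rd)"
    using A by (subst measure_lborel_shift) auto
  finally show ?thesis .
qed

section \<open>The cluster process\<close>

text \<open>The existential witnesses of \<open>matern_cluster_process\<close> become parameters, so
  that parents, enumeration and daughters can be named across lemmas.\<close>

locale cluster_process = prob_space M
  for M :: "'w measure" and lp ld rd :: real and \<Phi> :: "'w \<Rightarrow> 'a::euclidean_space set"
    and \<Phi>p :: "'w \<Rightarrow> 'a set" and X :: "nat \<Rightarrow> 'w \<Rightarrow> 'a" and D :: "nat \<Rightarrow> 'w \<Rightarrow> 'a set" +
  assumes lp_pos: "lp > 0" and ld_pos: "ld > 0" and rd_pos: "rd > 0"
    and Phi_meas: "\<Phi> \<in> measurable M point_configs"
    and parents: "poisson_process M (\<lambda>_. lp) \<Phi>p"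
    and X_meas [measurable]: "\<And>i. X i \<in> borel_measurable M"
    and X_enum: "AE \<omega> in M. inj (\<lambda>i. X i \<omega>) \<and> range (\<lambda>i. X i \<omega>) = \<Phi>p \<omega>"
    and daughters: "\<And>i. poisson_process M (\<lambda>y. ld * indicator {y. norm y \<le> rd} y) (D i)"
    and D_indep: "indep_vars (\<lambda>_. point_configs) D UNIV"
    and X_D_indep: "indep_set
          {(\<lambda>\<omega> i. X i \<omega>) -` A \<inter> space M | A. A \<in> sets (Pi\<^sub>M UNIV (\<lambda>_. borel))}
          {(\<lambda>\<omega> i. D i \<omega>) -` A \<inter> space M | A. A \<in> sets (Pi\<^sub>M UNIV (\<lambda>_. point_configs))}"
    and union: "AE \<omega> in M. \<Phi> \<omega> = (\<Union>i. (\<lambda>y. X i \<omega> + y) ` D i \<omega>)"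
begin

lemma D_meas [measurable]: "D i \<in> measurable M point_configs"
  by (rule poisson_processD(2)[OF daughters])

text \<open>Independence of the two sequences makes their joint law a product, so the daughters are
  integrated out with the parents frozen; independence among the daughters then factors the inner
  integral. The outer integral remains, since the joint law of the \<open>X i\<close> is not at
  hand. Values in \<open>ennreal\<close> avoid integrability conditions.\<close>

lemma nn_integral_clusters:
  fixes \<phi> :: "nat \<Rightarrow> 'a \<times> 'a set \<Rightarrow> ennreal"
  assumes J: "finite J" and \<phi> [measurable]: "\<And>i. \<phi> i \<in> borel_measurable (borel \<Otimes>\<^sub>M point_configs)"
  shows "(\<integral>\<^sup>+\<omega>. (\<Prod>i\<in>J. \<phi> i (X i \<omega>, D i \<omega>)) \<partial>M)
       = (\<integral>\<^sup>+\<omega>. (\<Prod>i\<in>J. \<integral>\<^sup>+\<omega>'. \<phi> i (X i \<omega>, D i \<omega>') \<partial>M) \<partial>M)"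
proof -
  let ?PX = "Pi\<^sub>M UNIV (\<lambda>_::nat. borel :: 'a measure)"
  let ?PD = "Pi\<^sub>M UNIV (\<lambda>_::nat. point_configs :: 'a set measure)"
  let ?X = "\<lambda>\<omega> i. X i \<omega>" and ?D = "\<lambda>\<omega> i. D i \<omega>"
  have X [measurable]: "?X \<in> measurable M ?PX"
    by (intro measurable_PiM_single') (auto simp: PiE_def extensional_def)
  have D [measurable]: "?D \<in> measurable M ?PD"
    using measurable_space[OF D_meas] by (intro measurable_PiM_single') (auto simp: PiE_def extensional_def)
  \<comment> \<open>Agreement on rectangles is enough to identify the joint law with the product
    measure.\<close>
  have prob_eq: "emeasure (distr M ?PX ?X) A * emeasure (distr M ?PD ?D) B
      = emeasure (distr M (?PX \<Otimes>\<^sub>M ?PD) (\<lambda>\<omega>. (?X \<omega>, ?D \<omega>))) (A \<times> B)"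
    if A: "A \<in> sets ?PX" and B: "B \<in> sets ?PD" for A B
  proof -
    have "prob ((?X -` A \<inter> space M) \<inter> (?D -` B \<inter> space M)) = prob (?X -` A \<inter> space M) * prob (?D -` B \<inter> space M)"
      using A B by (intro indep_setD[OF X_D_indep]) auto
    moreover have "(?X -` A \<inter> space M) \<inter> (?D -` B \<inter> space M) = (\<lambda>\<omega>. (?X \<omega>, ?D \<omega>)) -` (A \<times> B) \<inter> space M"
      by auto
    ultimately show ?thesis
      using A B by (simp add: emeasure_distr emeasure_eq_measure ennreal_mult)
  qed
  have distr_eq: "distr M ?PX ?X \<Otimes>\<^sub>M distr M ?PD ?D = distr M (?PX \<Otimes>\<^sub>M ?PD) (\<lambda>\<omega>. (?X \<omega>, ?D \<omega>))"
  proof (rule pair_measure_eqI)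
    show "sigma_finite_measure (distr M ?PX ?X)" "sigma_finite_measure (distr M ?PD ?D)"
      using prob_space_distr[OF X] prob_space_distr[OF D] by (auto simp: prob_space_imp_sigma_finite)
    show "sets (distr M ?PX ?X \<Otimes>\<^sub>M distr M ?PD ?D) = sets (distr M (?PX \<Otimes>\<^sub>M ?PD) (\<lambda>\<omega>. (?X \<omega>, ?D \<omega>)))"
      by (simp cong: sets_pair_measure_cong)
  qed (use prob_eq in simp)
  interpret PD: prob_space "distr M ?PD ?D" by (rule prob_space_distr[OF D])
  define F where "F = (\<lambda>(x, d). \<Prod>i\<in>J. \<phi> i (x i, d i))"
  have F [measurable]: "F \<in> borel_measurable (?PX \<Otimes>\<^sub>M ?PD)"
    unfolding F_def by measurable
  have "(\<integral>\<^sup>+\<omega>. (\<Prod>i\<in>J. \<phi> i (X i \<omega>, D i \<omega>)) \<partial>M) = (\<integral>\<^sup>+p. F p \<partial>distr M (?PX \<Otimes>\<^sub>M ?PD) (\<lambda>\<omega>. (?X \<omega>, ?D \<omega>)))"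
    by (subst nn_integral_distr) (auto simp: F_def)
  also have "\<dots> = (\<integral>\<^sup>+x. \<integral>\<^sup>+d. F (x, d) \<partial>distr M ?PD ?D \<partial>distr M ?PX ?X)"
    unfolding distr_eq[symmetric] by (rule PD.nn_integral_fst[symmetric]) (simp cong: measurable_cong_sets)
  also have "\<dots> = (\<integral>\<^sup>+\<omega>. \<integral>\<^sup>+d. F (?X \<omega>, d) \<partial>distr M ?PD ?D \<partial>M)"
    by (intro nn_integral_distr X PD.borel_measurable_nn_integral_fst) (simp cong: measurable_cong_sets)
  also have "\<dots> = (\<integral>\<^sup>+\<omega>. (\<Prod>i\<in>J. \<integral>\<^sup>+\<omega>'. \<phi> i (X i \<omega>, D i \<omega>') \<partial>M) \<partial>M)"
  proof (rule nn_integral_cong)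
    fix \<omega> assume "\<omega> \<in> space M"
    have x: "?X \<omega> \<in> space ?PX" by (simp add: space_PiM)
    have "(\<integral>\<^sup>+d. F (?X \<omega>, d) \<partial>distr M ?PD ?D) = (\<integral>\<^sup>+\<omega>'. F (?X \<omega>, ?D \<omega>') \<partial>M)"
      using measurable_Pair2[OF F x] by (intro nn_integral_distr D) simp
    also have "\<dots> = (\<integral>\<^sup>+\<omega>'. (\<Prod>i\<in>J. \<phi> i (X i \<omega>, D i \<omega>')) \<partial>M)"
      by (simp add: F_def)
    also have "\<dots> = (\<Prod>i\<in>J. \<integral>\<^sup>+\<omega>'. \<phi> i (X i \<omega>, D i \<omega>') \<partial>M)"
    proof (rule indep_vars_nn_integral[OF J])
      show "indep_vars (\<lambda>_. borel) (\<lambda>i \<omega>'. \<phi> i (X i \<omega>, D i \<omega>')) J"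
        by (rule indep_vars_compose2[OF indep_vars_subset[OF D_indep], where Y="\<lambda>i S. \<phi> i (X i \<omega>, S)"])
          (auto intro: measurable_Pair2[OF \<phi>])
    qed simp
    finally show "(\<integral>\<^sup>+d. F (?X \<omega>, d) \<partial>distr M ?PD ?D) = (\<Prod>i\<in>J. \<integral>\<^sup>+\<omega>'. \<phi> i (X i \<omega>, D i \<omega>') \<partial>M)" .
  qed
  finally show ?thesis .
qed

lemma daughter_pgf:
  assumes A: "A \<in> sets borel" "bounded A" and B: "B \<in> sets borel" "bounded B" "A \<inter> B = {}"
    and s: "0 \<le> s" "s \<le> 1" and t: "0 \<le> t" "t \<le> 1"
  shows "(\<integral>\<^sup>+\<omega>. ennreal (s ^ card (D i \<omega> \<inter> (\<lambda>y. x + y) -` A) * t ^ card (D i \<omega> \<inter> (\<lambda>y. x + y) -` B)) \<partial>M)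
    = ennreal (exp (- (ld * ((1 - s) * measure lborel (A \<inter> cball x rd) + (1 - t) * measure lborel (B \<inter> cball x rd)))))"
proof -
  \<comment> \<open>Indexing the two windows by \<open>bool\<close> keeps them apart even if both
    are empty and hence equal.\<close>
  let ?A = "\<lambda>b. (\<lambda>y. x + y) -` (if b then A else B)" and ?c = "\<lambda>b. if b then s else t"
  have sets: "?A b \<in> sets borel" "bounded (?A b)" for b
    using A B by (auto intro!: bounded_vimage_shift)
  have "(\<integral>\<omega>. (\<Prod>b\<in>UNIV. ?c b ^ card (D i \<omega> \<inter> ?A b)) \<partial>M)
      = exp (- (\<Sum>b\<in>UNIV. (1 - ?c b) * (LINT y:?A b|lborel. ld * indicator {y. norm y \<le> rd} y)))"
    using s t B(3) by (intro poisson_pgf_prod[OF daughters] sets) (auto simp: disjoint_family_on_def)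
  also have "(\<integral>\<omega>. (\<Prod>b\<in>UNIV. ?c b ^ card (D i \<omega> \<inter> ?A b)) \<partial>M)
      = (\<integral>\<omega>. s ^ card (D i \<omega> \<inter> (\<lambda>y. x + y) -` A) * t ^ card (D i \<omega> \<inter> (\<lambda>y. x + y) -` B) \<partial>M)"
    by (simp add: UNIV_bool mult.commute)
  also have "(\<Sum>b\<in>UNIV. (1 - ?c b) * (LINT y:?A b|lborel. ld * indicator {y. norm y \<le> rd} y))
      = ld * ((1 - s) * measure lborel (A \<inter> cball x rd) + (1 - t) * measure lborel (B \<inter> cball x rd))"
  proof -
    have "(LINT y:?A b|lborel. ld * indicator {y. norm y \<le> rd} y)
        = ld * measure lborel ((if b then A else B) \<inter> cball x rd)" for b
      using A B by (intro LINT_daughter_intensity) auto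
    then show ?thesis
      by (simp only:) (simp add: UNIV_bool algebra_simps)
  qed
  finally have eq: "(\<integral>\<omega>. s ^ card (D i \<omega> \<inter> (\<lambda>y. x + y) -` A) * t ^ card (D i \<omega> \<inter> (\<lambda>y. x + y) -` B) \<partial>M)
      = exp (- (ld * ((1 - s) * measure lborel (A \<inter> cball x rd) + (1 - t) * measure lborel (B \<inter> cball x rd))))" .
  have [measurable]: "(\<lambda>\<omega>. card (D i \<omega> \<inter> (\<lambda>y. x + y) -` A)) \<in> M \<rightarrow>\<^sub>M count_space UNIV"
    "(\<lambda>\<omega>. card (D i \<omega> \<inter> (\<lambda>y. x + y) -` B)) \<in> M \<rightarrow>\<^sub>M count_space UNIV"
    using A B by (auto intro!: measurable_card_process bounded_vimage_shift)
  show ?thesis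
    unfolding eq[symmetric] using s t
    by (intro nn_integral_eq_integral integrable_const_bound[where B=1] AE_I2)
      (auto intro!: mult_le_one power_le_one)
qed

text \<open>From \<open>1 - exp (- m) \<le> m\<close>. Forgetting the ball around \<open>x\<close>
  makes the bound uniform in the parent, whose law is unknown.\<close>

lemma daughter_hitting_prob:
  assumes A: "A \<in> sets borel" "bounded A"
  shows "(\<integral>\<^sup>+\<omega>. of_bool (card (D i \<omega> \<inter> (\<lambda>y. x + y) -` A) \<noteq> 0) \<partial>M) \<le> ennreal (ld * measure lborel A)"
proof -
  let ?N = "\<lambda>\<omega>. card (D i \<omega> \<inter> (\<lambda>y. x + y) -` A)"
  let ?m = "ld * measure lborel (A \<inter> cball x rd)"
  have sets: "(\<lambda>y. x + y) -` A \<in> sets borel" "bounded ((\<lambda>y. x + y) -` A)"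
    using A by (auto intro: bounded_vimage_shift)
  have [measurable]: "?N \<in> M \<rightarrow>\<^sub>M count_space UNIV"
    using sets by (intro measurable_card_process) auto
  have "(\<integral>\<^sup>+\<omega>. of_bool (?N \<omega> \<noteq> 0) \<partial>M) = (\<integral>\<^sup>+\<omega>. indicator (space M - {\<omega> \<in> space M. ?N \<omega> = 0}) \<omega> \<partial>M)"
    by (intro nn_integral_cong) (auto simp: indicator_def)
  also have "\<dots> = emeasure M (space M - {\<omega> \<in> space M. ?N \<omega> = 0})"
    by (intro nn_integral_indicator) measurable
  also have "\<dots> = ennreal (1 - prob {\<omega> \<in> space M. ?N \<omega> = 0})"
    by (subst emeasure_eq_measure) (subst prob_compl, measurable)
  also have "prob {\<omega> \<in> space M. ?N \<omega> = 0} = exp (- ?m)"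
    using poisson_processD(4)[OF daughters sets, of i 0]
    by (simp only: LINT_daughter_intensity[OF A(1)]) simp
  also have "ennreal (1 - exp (- ?m)) \<le> ennreal (ld * measure lborel A)"
  proof (rule ennreal_leI)
    have "1 - exp (- ?m) \<le> ?m"
      using exp_ge_add_one_self[of "- ?m"] by simp
    also have "\<dots> \<le> ld * measure lborel A"
      using A ld_pos emeasure_bounded_finite[OF A(2)]
      by (intro mult_left_mono measure_mono_fmeasurable) (auto simp: fmeasurable_def)
    finally show "1 - exp (- ?m) \<le> ld * measure lborel A" .
  qed
  finally show ?thesis .
qed

text \<open>
  Two clusters that meet in \<open>W\<close> both hit a common grid cell; for a fixed cell this has probability at
  most the square of its expected number of daughters, and these squares sum to \<open>O(1 / n)\<close>.
\<close>

lemma AE_clusters_disjoint_window: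
  assumes W: "W \<in> sets borel" "bounded W" and ij: "i \<noteq> j"
  shows "AE \<omega> in M. (\<lambda>y. X i \<omega> + y) ` D i \<omega> \<inter> (\<lambda>y. X j \<omega> + y) ` D j \<omega> \<inter> W = {}"
proof -
  let ?cell = "\<lambda>n v. W \<inter> grid n -` {v}"
  let ?hit = "\<lambda>n v (x, S). of_bool (card (S \<inter> (\<lambda>y. x + y) -` ?cell n v) \<noteq> 0) :: ennreal"
  define Z where "Z n \<omega> = (\<Sum>v\<in>grid n ` W. \<Prod>l\<in>{i, j}. ?hit n v (X l \<omega>, D l \<omega>))" for n \<omega>
  have cell: "?cell n v \<in> sets borel" "bounded (?cell n v)" for n v
    using W by (auto intro: bounded_subset)
  have [measurable]: "(\<lambda>(x, S). card (S \<inter> (\<lambda>y. x + y) -` ?cell n v)) \<in> borel \<Otimes>\<^sub>M point_configs \<rightarrow>\<^sub>M count_space UNIV" for n v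
    by (rule measurable_card_shift[OF cell])
  have hit [measurable]: "?hit n v \<in> borel_measurable (borel \<Otimes>\<^sub>M point_configs)" for n v
    unfolding split_beta by measurable
  have [measurable]: "Z n \<in> borel_measurable M" for n
    unfolding Z_def by measurable
  have prod_ij: "(\<Prod>l\<in>{i, j}. f l) = f i * f j" for f :: "nat \<Rightarrow> ennreal"
    using ij by simp
  have Z: "(\<integral>\<^sup>+\<omega>. Z n \<omega> \<partial>M) \<le> ennreal (ld\<^sup>2 * measure lborel W / real (Suc n))" for n
  proof -
    have "(\<integral>\<^sup>+\<omega>. Z n \<omega> \<partial>M) = (\<Sum>v\<in>grid n ` W. \<integral>\<^sup>+\<omega>. (\<Prod>l\<in>{i, j}. ?hit n v (X l \<omega>, D l \<omega>)) \<partial>M)"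
      unfolding Z_def by (rule nn_integral_sum) measurable
    also have "\<dots> = (\<Sum>v\<in>grid n ` W. \<integral>\<^sup>+\<omega>. (\<Prod>l\<in>{i, j}. \<integral>\<^sup>+\<omega>'. ?hit n v (X l \<omega>, D l \<omega>') \<partial>M) \<partial>M)"
      by (intro sum.cong refl nn_integral_clusters[where \<phi>="\<lambda>_. ?hit n _"]) (use hit in auto)
    \<comment> \<open>The hitting bound does not depend on the parent, so the outer integral becomes
      that of a constant.\<close>
    also have "\<dots> \<le> (\<Sum>v\<in>grid n ` W. \<integral>\<^sup>+\<omega>. (\<Prod>l\<in>{i, j}. ennreal (ld * measure lborel (?cell n v))) \<partial>M)"
      using daughter_hitting_prob[OF cell]
      unfolding prod_ij by (intro sum_mono nn_integral_mono mult_mono zero_le) (simp_all only: prod.case)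
    also have "\<dots> = (\<Sum>v\<in>grid n ` W. ennreal ((ld * measure lborel (?cell n v))\<^sup>2))"
      unfolding prod_ij using ld_pos by (simp add: emeasure_space_1 power2_eq_square ennreal_mult)
    also have "\<dots> = ennreal (\<Sum>v\<in>grid n ` W. (ld * measure lborel (?cell n v))\<^sup>2)"
      by (rule sum_ennreal) simp
    also have "\<dots> \<le> ennreal (ld\<^sup>2 * measure lborel W / real (Suc n))"
    proof (rule ennreal_leI)
      \<comment> \<open>One factor of each squared cell volume is bounded by
        \<open>1 / Suc n\<close>; the other is kept and sums to the volume of
        \<open>W\<close>.\<close>
      have "(\<Sum>v\<in>grid n ` W. (ld * measure lborel (?cell n v))\<^sup>2)
          \<le> (\<Sum>v\<in>grid n ` W. ld\<^sup>2 * (1 / real (Suc n) * measure lborel (?cell n v)))"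
      proof (rule sum_mono)
        fix v
        have "measure lborel (?cell n v) \<le> measure lborel (grid n -` {v} :: 'a set)"
          using cell emeasure_bounded_finite[OF bounded_grid_cell]
          by (intro measure_mono_fmeasurable) (auto simp: fmeasurable_def)
        also have "\<dots> \<le> 1 / real (Suc n)" by (rule measure_grid_cell)
        finally show "(ld * measure lborel (?cell n v))\<^sup>2 \<le> ld\<^sup>2 * (1 / real (Suc n) * measure lborel (?cell n v))"
          unfolding power_mult_distrib power2_eq_square[of "measure _ _"]
          by (intro mult_left_mono mult_right_mono) auto
      qed
      also have "\<dots> = ld\<^sup>2 * measure lborel W / real (Suc n)"
        by (simp only: sum_distrib_left[symmetric] sum_measure_grid_cells[OF W]) simp
      finally show "(\<Sum>v\<in>grid n ` W. (ld * measure lborel (?cell n v))\<^sup>2) \<le> ld\<^sup>2 * measure lborel W / real (Suc n)" .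
    qed
    finally show ?thesis .
  qed
  \<comment> \<open>Measurability of the collision event is not at hand; it is enclosed in the
    measurable event that every grid shows a common hit, and this one is null.\<close>
  let ?N = "{\<omega> \<in> space M. \<forall>n. 1 \<le> Z n \<omega>}"
  have "emeasure M ?N \<le> ennreal (ld\<^sup>2 * measure lborel W / real (Suc n))" for n
  proof -
    have "emeasure M ?N = (\<integral>\<^sup>+\<omega>. indicator ?N \<omega> \<partial>M)"
      by (rule nn_integral_indicator[symmetric]) measurable
    also have "\<dots> \<le> (\<integral>\<^sup>+\<omega>. Z n \<omega> \<partial>M)"
      by (intro nn_integral_mono) (auto simp: indicator_def)
    finally show ?thesis using Z order_trans by blast
  qed
  moreover have "(\<lambda>n. ennreal (ld\<^sup>2 * measure lborel W / real (Suc n))) \<longlonglongrightarrow> ennreal 0"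
    by (intro tendsto_ennrealI LIMSEQ_Suc[OF lim_const_over_n])
  ultimately have N0: "emeasure M ?N = 0"
    using LIMSEQ_le_const[of "\<lambda>n. ennreal (ld\<^sup>2 * measure lborel W / real (Suc n))" 0 "emeasure M ?N"] by auto
  show ?thesis
  proof (rule AE_I[OF _ N0])
    show "{\<omega> \<in> space M. (\<lambda>y. X i \<omega> + y) ` D i \<omega> \<inter> (\<lambda>y. X j \<omega> + y) ` D j \<omega> \<inter> W \<noteq> {}} \<subseteq> ?N"
    proof safe
      fix \<omega> n y z assume \<omega>: "\<omega> \<in> space M" and y: "y \<in> D i \<omega>" and z: "z \<in> D j \<omega>"
        and eq: "X i \<omega> + y = X j \<omega> + z" and w: "X i \<omega> + y \<in> W"
      let ?v = "grid n (X i \<omega> + y)"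
      have lf: "locally_finite_set (D l \<omega>)" for l
        using measurable_space[OF D_meas \<omega>] by simp
      have ne: "card (D l \<omega> \<inter> (\<lambda>y. X l \<omega> + y) -` ?cell n ?v) \<noteq> 0"
        if "u \<in> D l \<omega>" "X l \<omega> + u = X i \<omega> + y" for l u
      proof -
        have "u \<in> D l \<omega> \<inter> (\<lambda>y. X l \<omega> + y) -` ?cell n ?v"
          using that w by simp
        then show ?thesis
          using finite_Int_locally_finite[OF lf bounded_vimage_shift[OF cell(2)]] card_gt_0_iff by blast
      qed
      have "(\<Prod>l\<in>{i, j}. ?hit n ?v (X l \<omega>, D l \<omega>)) = 1"
        using ne[OF y] ne[OF z] eq by (intro prod.neutral) auto
      then show "1 \<le> Z n \<omega>"
        unfolding Z_def using w finite_grid_image[OF W(2)]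
        by (subst sum.remove[of _ ?v]) auto
    qed
    show "?N \<in> sets M" by measurable
  qed
qed

text \<open>\<Phi> is a set, so a point shared by two clusters would be counted once; disjointness
  makes the count of the union additive. Countably many pairs and balls suffice.\<close>

lemma AE_clusters_disjoint:
  "AE \<omega> in M. \<forall>i j. i \<noteq> j \<longrightarrow> (\<lambda>y. X i \<omega> + y) ` D i \<omega> \<inter> (\<lambda>y. X j \<omega> + y) ` D j \<omega> = {}"
proof -
  have "AE \<omega> in M. i \<noteq> j \<longrightarrow> (\<lambda>y. X i \<omega> + y) ` D i \<omega> \<inter> (\<lambda>y. X j \<omega> + y) ` D j \<omega> \<inter> cball 0 (real m) = {}" for i j m
    using AE_clusters_disjoint_window[of "cball 0 (real m)" i j] by (cases "i = j") auto
  then have "AE \<omega> in M. \<forall>i j m. i \<noteq> j \<longrightarrow>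
      (\<lambda>y. X i \<omega> + y) ` D i \<omega> \<inter> (\<lambda>y. X j \<omega> + y) ` D j \<omega> \<inter> cball 0 (real m) = {}"
    unfolding AE_all_countable by blast
  then show ?thesis
  proof eventually_elim
    case (elim \<omega>)
    show ?case
    proof (intro allI impI equals0I)
      fix i j y assume "i \<noteq> j" and y: "y \<in> (\<lambda>y. X i \<omega> + y) ` D i \<omega> \<inter> (\<lambda>y. X j \<omega> + y) ` D j \<omega>"
      obtain m where "norm y \<le> real m" using real_arch_simple by blast
      then have "y \<in> cball 0 (real m)" by simp
      then show False using elim \<open>i \<noteq> j\<close> y by blast
    qed
  qed
qed

text \<open>Each annulus beyond \<open>rd\<close> has mean count 0, and countably many annuli
  exhaust the outside. Hence only parents within \<open>rd\<close> of a window contribute to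
  it.\<close>

lemma AE_daughters_subset_cball: "AE \<omega> in M. \<forall>i. D i \<omega> \<subseteq> cball 0 rd"
proof -
  have "AE \<omega> in M. D i \<omega> \<inter> (cball 0 (real m) - cball 0 rd) = {}" for i m
  proof -
    let ?B = "cball 0 (real m) - cball 0 rd :: 'a set"
    have B: "?B \<in> sets borel" "bounded ?B" by (auto intro: bounded_subset[of "cball 0 (real m)"])
    have "(LINT y:?B|lborel. ld * indicator {y. norm y \<le> rd} y) = 0"
      unfolding set_lebesgue_integral_def by (intro integral_eq_zero_AE AE_I2) (auto simp: indicator_def)
    then have p: "prob {\<omega> \<in> space M. card (D i \<omega> \<inter> ?B) = 0} = 1"
      using poisson_processD(4)[OF daughters B, of i 0] by simp
    have [measurable]: "(\<lambda>\<omega>. card (D i \<omega> \<inter> ?B)) \<in> M \<rightarrow>\<^sub>M count_space UNIV"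
      by (rule measurable_card_process[OF D_meas B])
    have "AE \<omega> in M. \<omega> \<in> {\<omega> \<in> space M. card (D i \<omega> \<inter> ?B) = 0}"
      by (rule AE_prob_1[OF p])
    then show ?thesis
    proof (rule AE_mp, intro AE_I2 impI)
      fix \<omega> assume "\<omega> \<in> space M" and c: "\<omega> \<in> {\<omega> \<in> space M. card (D i \<omega> \<inter> ?B) = 0}"
      then have "finite (D i \<omega> \<inter> ?B)"
        using poisson_processD(3)[OF daughters] finite_Int_locally_finite[OF _ B(2)] by blast
      then show "D i \<omega> \<inter> ?B = {}" using c by simp
    qed
  qed
  then have "AE \<omega> in M. \<forall>i m. D i \<omega> \<inter> (cball 0 (real m) - cball 0 rd) = {}"
    unfolding AE_all_countable by blast
  then show ?thesis
  proof eventually_elim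
    case (elim \<omega>)
    show ?case
    proof (intro allI subsetI)
      fix i y assume y: "y \<in> D i \<omega>"
      obtain m where "norm y \<le> real m" using real_arch_simple by blast
      then have "y \<in> cball 0 (real m)" by simp
      then show "y \<in> cball 0 rd" using elim y by blast
    qed
  qed
qed

end

section \<open>The generating functional of the cluster process\<close>

text \<open>Parents out of reach add nothing, so \<open>I\<close> may be any finite set containing
  those within reach. This admits initial segments \<open>{..<n}\<close>, over which products of
  cluster factors can be integrated.\<close>

lemma card_cluster_union:
  fixes x :: "nat \<Rightarrow> 'a::euclidean_space" and d :: "nat \<Rightarrow> 'a set"
  assumes I: "finite I" "{i. norm (x i) \<le> R + rd} \<subseteq> I" and A: "A \<subseteq> cball 0 R"
    and d: "\<And>i. d i \<subseteq> cball 0 rd" "\<And>i. locally_finite_set (d i)"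
    and disj: "\<And>i j. i \<noteq> j \<Longrightarrow> (\<lambda>y. x i + y) ` d i \<inter> (\<lambda>y. x j + y) ` d j = {}"
  shows "card ((\<Union>i. (\<lambda>y. x i + y) ` d i) \<inter> A) = (\<Sum>i\<in>I. card (d i \<inter> (\<lambda>y. x i + y) -` A))"
proof -
  have in_I: "i \<in> I" if "y \<in> d i" "x i + y \<in> A" for i y
  proof -
    have "norm y \<le> rd" "norm (x i + y) \<le> R"
      using d(1)[of i] A that by (auto simp: subset_eq)
    then have "norm (x i) \<le> R + rd"
      using norm_triangle_ineq4[of "x i + y" y] by simp
    then show ?thesis using I(2) by auto
  qed
  have bA: "bounded A" using A by (rule bounded_subset[OF bounded_cball])
  have eq: "(\<Union>i. (\<lambda>y. x i + y) ` d i) \<inter> A = (\<Union>i\<in>I. (\<lambda>y. x i + y) ` (d i \<inter> (\<lambda>y. x i + y) -` A))"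
    using in_I by auto
  show ?thesis
    unfolding eq
  proof (subst card_UN_disjoint[OF I(1)])
    show "\<forall>i\<in>I. finite ((\<lambda>y. x i + y) ` (d i \<inter> (\<lambda>y. x i + y) -` A))"
      using finite_Int_locally_finite[OF d(2) bounded_vimage_shift[OF bA]] by blast
    show "\<forall>i\<in>I. \<forall>j\<in>I. i \<noteq> j \<longrightarrow> (\<lambda>y. x i + y) ` (d i \<inter> (\<lambda>y. x i + y) -` A) \<inter> (\<lambda>y. x j + y) ` (d j \<inter> (\<lambda>y. x j + y) -` A) = {}"
      using disj by blast
  qed (simp add: card_image)
qed

context cluster_process
begin

lemma card_Phi_meas:
  "A \<in> sets borel \<Longrightarrow> bounded A \<Longrightarrow> (\<lambda>\<omega>. card (\<Phi> \<omega> \<inter> A)) \<in> M \<rightarrow>\<^sub>M count_space UNIV"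
  by (rule measurable_card_process[OF Phi_meas])

lemma Phi_locally_finite: "\<omega> \<in> space M \<Longrightarrow> locally_finite_set (\<Phi> \<omega>)"
  using measurable_space[OF Phi_meas] by auto

text \<open>Given the parents, one at \<open>x\<close> contributes the factor
  \<open>\<gamma> x\<close>, independently of the others, and \<open>poisson_functional\<close>
  integrates the product of these factors. The daughters are integrated out for the first
  \<open>n\<close> parents of the enumeration; only in the limit does the product depend on the
  parent set alone.\<close>

lemma cluster_pgf:
  assumes A: "A \<in> sets borel" "bounded A" and B: "B \<in> sets borel" "bounded B" "A \<inter> B = {}"
    and s: "0 \<le> s" "s \<le> 1" and t: "0 \<le> t" "t \<le> 1"
  shows "(\<integral>\<omega>. s ^ card (\<Phi> \<omega> \<inter> A) * t ^ card (\<Phi> \<omega> \<inter> B) \<partial>M) = exp (- (lp * (\<integral>x. 1 - exp (- (ld *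
      ((1 - s) * measure lborel (A \<inter> cball x rd) + (1 - t) * measure lborel (B \<inter> cball x rd)))) \<partial>lborel)))"
proof -
  obtain R where R: "A \<union> B \<subseteq> cball 0 R" "R \<ge> 0"
  proof -
    have "bounded (A \<union> B)" using A B by simp
    then obtain R where "\<forall>y\<in>A \<union> B. dist 0 y \<le> R" unfolding bounded_any_center[of _ 0] by blast
    then show ?thesis by (intro that[of "max 0 R"]) (auto simp: le_max_iff_disj)
  qed
  \<comment> \<open>A parent outside this ball cannot reach \<open>A \<union> B\<close> and has
    factor 1, so the parents in a bounded window carry the whole product.\<close>
  define W where "W = (cball 0 (R + rd) :: 'a set)"
  have W: "W \<in> sets borel" "bounded W" by (auto simp: W_def)
  define \<gamma> where "\<gamma> x = exp (- (ld * ((1 - s) * measure lborel (A \<inter> cball x rd) + (1 - t) * measure lborel (B \<inter> cball x rd))))" for x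
  have \<gamma>_meas [measurable]: "\<gamma> \<in> borel_measurable borel"
    using borel_measurable_measure_Int_cball[OF A(1), of rd] borel_measurable_measure_Int_cball[OF B(1), of rd]
    unfolding \<gamma>_def by measurable
  have \<gamma>01: "0 \<le> \<gamma> x" "\<gamma> x \<le> 1" for x
    using ld_pos s t by (auto simp: \<gamma>_def intro!: mult_nonneg_nonneg add_nonneg_nonneg)
  have \<gamma>_out: "\<gamma> x = 1" if "x \<notin> W" for x
  proof -
    have "C \<inter> cball x rd = {}" if "C \<subseteq> cball 0 R" for C
    proof (rule equals0I)
      fix y assume "y \<in> C \<inter> cball x rd"
      then have "norm y \<le> R" "dist x y \<le> rd" using that by (auto simp: subset_eq)
      then have "norm x \<le> R + rd" using norm_triangle_ineq[of "x - y" y] by (simp add: dist_norm)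
      then show False using \<open>x \<notin> W\<close> by (simp add: W_def)
    qed
    then show ?thesis using R by (simp add: \<gamma>_def)
  qed
  define w where "w i \<omega> = s ^ card (D i \<omega> \<inter> (\<lambda>y. X i \<omega> + y) -` A) * t ^ card (D i \<omega> \<inter> (\<lambda>y. X i \<omega> + y) -` B)" for i \<omega>
  have w01: "0 \<le> w i \<omega>" "w i \<omega> \<le> 1" for i \<omega>
    using s t by (auto simp: w_def intro!: mult_le_one power_le_one)
  have [measurable]: "(\<lambda>(x, S). card (S \<inter> (\<lambda>y. x + y) -` A)) \<in> borel \<Otimes>\<^sub>M point_configs \<rightarrow>\<^sub>M count_space UNIV"
    "(\<lambda>(x, S). card (S \<inter> (\<lambda>y. x + y) -` B)) \<in> borel \<Otimes>\<^sub>M point_configs \<rightarrow>\<^sub>M count_space UNIV"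
    using measurable_card_shift A B by auto
  have f_meas [measurable]: "(\<lambda>(x, S). s ^ card (S \<inter> (\<lambda>y. x + y) -` A) * t ^ card (S \<inter> (\<lambda>y. x + y) -` B))
      \<in> borel_measurable (borel \<Otimes>\<^sub>M point_configs)"
  proof -
    have "(\<lambda>p. s ^ (\<lambda>(x, S). card (S \<inter> (\<lambda>y. x + y) -` A)) p * t ^ (\<lambda>(x, S). card (S \<inter> (\<lambda>y. x + y) -` B)) p)
      \<in> borel_measurable (borel \<Otimes>\<^sub>M point_configs)" by measurable
    then show ?thesis by (simp add: split_beta)
  qed
  have w_meas [measurable]: "w i \<in> borel_measurable M" for i
  proof -
    have "(\<lambda>\<omega>. (X i \<omega>, D i \<omega>)) \<in> M \<rightarrow>\<^sub>M borel \<Otimes>\<^sub>M point_configs" by measurable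
    from measurable_compose[OF this f_meas] show ?thesis
      by (simp add: w_def[abs_def])
  qed
  have partial: "(\<integral>\<omega>. (\<Prod>i<n. w i \<omega>) \<partial>M) = (\<integral>\<omega>. (\<Prod>i<n. \<gamma> (X i \<omega>)) \<partial>M)" for n
  proof -
    let ?f = "\<lambda>(x, S). ennreal (s ^ card (S \<inter> (\<lambda>y. x + y) -` A) * t ^ card (S \<inter> (\<lambda>y. x + y) -` B))"
    have fm: "?f \<in> borel_measurable (borel \<Otimes>\<^sub>M point_configs)"
      using measurable_compose[OF f_meas measurable_ennreal] by (simp add: split_beta)
    have "(\<integral>\<^sup>+\<omega>. ennreal (\<Prod>i<n. w i \<omega>) \<partial>M) = (\<integral>\<^sup>+\<omega>. (\<Prod>i<n. ?f (X i \<omega>, D i \<omega>)) \<partial>M)"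
      using w01 by (simp add: prod_ennreal[symmetric] w_def)
    also have "\<dots> = (\<integral>\<^sup>+\<omega>. (\<Prod>i<n. \<integral>\<^sup>+\<omega>'. ?f (X i \<omega>, D i \<omega>') \<partial>M) \<partial>M)"
      by (rule nn_integral_clusters[where \<phi>="\<lambda>_. ?f"]) (use fm in auto)
    also have "\<dots> = (\<integral>\<^sup>+\<omega>. (\<Prod>i<n. ennreal (\<gamma> (X i \<omega>))) \<partial>M)"
      unfolding prod.case \<gamma>_def using daughter_pgf[OF A B s t] by simp
    also have "\<dots> = (\<integral>\<^sup>+\<omega>. ennreal (\<Prod>i<n. \<gamma> (X i \<omega>)) \<partial>M)"
      using \<gamma>01 by (simp add: prod_ennreal[symmetric])
    finally have "(\<integral>\<^sup>+\<omega>. ennreal (\<Prod>i<n. w i \<omega>) \<partial>M) = (\<integral>\<^sup>+\<omega>. ennreal (\<Prod>i<n. \<gamma> (X i \<omega>)) \<partial>M)" .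
    then show ?thesis
      using w01 \<gamma>01 by (subst (1 2) integral_eq_nn_integral) (auto intro!: prod_nonneg)
  qed
  \<comment> \<open>Local finiteness leaves finitely many parents in \<open>W\<close>; once
    \<open>n\<close> exceeds their indices, both products are constant.\<close>
  have good: "AE \<omega> in M. (\<lambda>n. \<Prod>i<n. w i \<omega>) \<longlonglongrightarrow> s ^ card (\<Phi> \<omega> \<inter> A) * t ^ card (\<Phi> \<omega> \<inter> B)
      \<and> (\<lambda>n. \<Prod>i<n. \<gamma> (X i \<omega>)) \<longlonglongrightarrow> (\<Prod>x\<in>\<Phi>p \<omega> \<inter> W. \<gamma> x)"
    using X_enum AE_clusters_disjoint AE_daughters_subset_cball union AE_space
  proof eventually_elim
    case (elim \<omega>)
    define I where "I = {i. X i \<omega> \<in> W}"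
    have inj: "inj_on (\<lambda>i. X i \<omega>) I" using elim(1) by (auto intro: inj_on_subset)
    have img: "(\<lambda>i. X i \<omega>) ` I = \<Phi>p \<omega> \<inter> W" using elim(1) by (auto simp: I_def)
    have "finite (\<Phi>p \<omega> \<inter> W)"
      using elim(5) by (intro finite_Int_locally_finite poisson_processD(3)[OF parents] W)
    then have fin: "finite I" using finite_imageD[OF _ inj] img by simp
    have lf: "locally_finite_set (D i \<omega>)" for i
      by (rule poisson_processD(3)[OF daughters elim(5)])
    have card: "card (\<Phi> \<omega> \<inter> C) = (\<Sum>i\<in>J. card (D i \<omega> \<inter> (\<lambda>y. X i \<omega> + y) -` C))"
      if "C \<subseteq> cball 0 R" "finite J" "I \<subseteq> J" for C J
      unfolding elim(4) using elim(2,3) that lf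
      by (intro card_cluster_union) (auto simp: I_def W_def)
    have ev: "\<forall>\<^sub>F n in sequentially. I \<subseteq> {..<n}"
    proof -
      obtain m where "\<forall>i\<in>I. i \<le> m" using fin finite_nat_set_iff_bounded_le by blast
      then show ?thesis by (intro eventually_mono[OF eventually_gt_at_top[of m]]) auto
    qed
    from ev have "\<forall>\<^sub>F n in sequentially. (\<Prod>i<n. w i \<omega>) = s ^ card (\<Phi> \<omega> \<inter> A) * t ^ card (\<Phi> \<omega> \<inter> B)"
    proof eventually_elim
      case (elim n)
      then show ?case
        using R card[of A "{..<n}"] card[of B "{..<n}"]
        by (simp add: w_def prod.distrib power_sum)
    qed
    moreover from ev have "\<forall>\<^sub>F n in sequentially. (\<Prod>i<n. \<gamma> (X i \<omega>)) = (\<Prod>x\<in>\<Phi>p \<omega> \<inter> W. \<gamma> x)"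
    proof eventually_elim
      case (elim n)
      then have "(\<Prod>i<n. \<gamma> (X i \<omega>)) = (\<Prod>i\<in>I. \<gamma> (X i \<omega>))"
        using \<gamma>_out by (intro prod.mono_neutral_right) (auto simp: I_def)
      then show ?case
        unfolding img[symmetric] using inj by (simp add: prod.reindex)
    qed
    ultimately show ?case by (auto intro: tendsto_eventually)
  qed
  have [measurable]: "(\<lambda>\<omega>. card (\<Phi> \<omega> \<inter> A)) \<in> M \<rightarrow>\<^sub>M count_space UNIV" "(\<lambda>\<omega>. card (\<Phi> \<omega> \<inter> B)) \<in> M \<rightarrow>\<^sub>M count_space UNIV"
    using A B by (auto intro: card_Phi_meas)
  note pf = poisson_functional[OF parents W \<gamma>_meas \<gamma>01]
  have "(\<lambda>n. \<integral>\<omega>. (\<Prod>i<n. w i \<omega>) \<partial>M) \<longlonglongrightarrow> (\<integral>\<omega>. s ^ card (\<Phi> \<omega> \<inter> A) * t ^ card (\<Phi> \<omega> \<inter> B) \<partial>M)"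
    by (rule integral_dominated_convergence[where w="\<lambda>_. 1"])
      (use good w01 in \<open>auto simp: abs_prod intro!: prod_le_1\<close>)
  moreover have "(\<lambda>n. \<integral>\<omega>. (\<Prod>i<n. w i \<omega>) \<partial>M) \<longlonglongrightarrow> (\<integral>\<omega>. (\<Prod>x\<in>\<Phi>p \<omega> \<inter> W. \<gamma> x) \<partial>M)"
    unfolding partial using pf(1)
    by (intro integral_dominated_convergence[where w="\<lambda>_. 1"])
      (use good \<gamma>01 in \<open>auto simp: abs_prod intro!: prod_le_1\<close>)
  ultimately have "(\<integral>\<omega>. s ^ card (\<Phi> \<omega> \<inter> A) * t ^ card (\<Phi> \<omega> \<inter> B) \<partial>M) = (\<integral>\<omega>. (\<Prod>x\<in>\<Phi>p \<omega> \<inter> W. \<gamma> x) \<partial>M)"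
    by (rule LIMSEQ_unique)
  also have "\<dots> = exp (- (lp * (LINT x:W|lborel. 1 - \<gamma> x)))"
    by (rule pf(2))
  also have "(LINT x:W|lborel. 1 - \<gamma> x) = (\<integral>x. 1 - \<gamma> x \<partial>lborel)"
    unfolding set_lebesgue_integral_def using \<gamma>_out
    by (intro Bochner_Integration.integral_cong) (auto simp: indicator_def)
  finally show ?thesis unfolding \<gamma>_def .
qed

end

section \<open>First moments by differentiating the generating functional\<close>

text \<open>Difference quotients along any sequence in \<open>S\<close> are dominated by
  \<open>w\<close>, so dominated convergence applies. Working within \<open>S\<close> admits an
  endpoint, which is how \<open>t = 1\<close> is reached.\<close>

lemma has_field_derivative_integral:
  fixes f :: "real \<Rightarrow> 'b \<Rightarrow> real"
  assumes t: "t \<in> S" and f: "\<And>s. s \<in> S \<Longrightarrow> integrable M (f s)" and w: "integrable M w"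
    and f' [measurable]: "f' \<in> borel_measurable M"
    and deriv: "\<And>x. x \<in> space M \<Longrightarrow> ((\<lambda>s. f s x) has_field_derivative f' x) (at t within S)"
    and lip: "\<And>s x. s \<in> S \<Longrightarrow> x \<in> space M \<Longrightarrow> \<bar>f s x - f t x\<bar> \<le> \<bar>s - t\<bar> * w x"
  shows "((\<lambda>s. \<integral>x. f s x \<partial>M) has_field_derivative (\<integral>x. f' x \<partial>M)) (at t within S)"
  unfolding has_field_derivative_iff tendsto_at_iff_sequentially
proof (intro allI impI)
  fix X :: "nat \<Rightarrow> real" assume X: "\<forall>i. X i \<in> S - {t}" and lim: "X \<longlonglongrightarrow> t"
  have fm: "f s \<in> borel_measurable M" if "s \<in> S" for s
    using f[OF that] by auto
  let ?q = "\<lambda>n x. (f (X n) x - f t x) / (X n - t)"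
  have "(\<lambda>n. \<integral>x. ?q n x \<partial>M) \<longlonglongrightarrow> (\<integral>x. f' x \<partial>M)"
  proof (rule integral_dominated_convergence[where w=w])
    show "?q n \<in> borel_measurable M" for n
    proof -
      have [measurable]: "f (X n) \<in> borel_measurable M" "f t \<in> borel_measurable M"
        using fm X t by auto
      show ?thesis by measurable
    qed
    show "AE x in M. (\<lambda>n. ?q n x) \<longlonglongrightarrow> f' x"
    proof (rule AE_I2)
      fix x assume "x \<in> space M"
      from deriv[OF this] show "(\<lambda>n. ?q n x) \<longlonglongrightarrow> f' x"
        unfolding has_field_derivative_iff tendsto_at_iff_sequentially using X lim by (auto simp: comp_def)
    qed
    show "AE x in M. norm (?q n x) \<le> w x" for n
    proof (rule AE_I2)
      fix x assume "x \<in> space M"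
      then have "\<bar>f (X n) x - f t x\<bar> \<le> \<bar>X n - t\<bar> * w x" using X by (intro lip) auto
      moreover have "0 < \<bar>X n - t\<bar>" using X by auto
      ultimately show "norm (?q n x) \<le> w x"
        by (simp add: abs_divide pos_divide_le_eq mult.commute)
    qed
  qed (use w in auto)
  moreover have "(\<integral>x. ?q n x \<partial>M) = ((\<integral>x. f (X n) x \<partial>M) - (\<integral>x. f t x \<partial>M)) / (X n - t)" for n
    using X t f[of "X n"] f[of t] by simp
  moreover have "(\<lambda>n. ((\<integral>x. f (X n) x \<partial>M) - (\<integral>x. f t x \<partial>M)) / (X n - t))
      = ((\<lambda>s. ((\<integral>x. f s x \<partial>M) - (\<integral>x. f t x \<partial>M)) / (s - t)) \<circ> X)"
    by (simp add: comp_def)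
  ultimately show "((\<lambda>s. ((\<integral>x. f s x \<partial>M) - (\<integral>x. f t x \<partial>M)) / (s - t)) \<circ> X) \<longlonglongrightarrow> (\<integral>x. f' x \<partial>M)"
    by (simp only:)
qed

lemma abs_exp_minus_diff_le:
  fixes u v :: real
  assumes "0 \<le> u" "0 \<le> v"
  shows "\<bar>exp (- u) - exp (- v)\<bar> \<le> \<bar>u - v\<bar>"
proof -
  have *: "exp (- a) - exp (- b) \<le> b - a" if "0 \<le> a" "a \<le> b" for a b :: real
  proof -
    have "exp (- a) - exp (- b) = exp (- a) * (1 - exp (- (b - a)))"
      by (simp add: exp_diff exp_minus field_simps)
    also have "\<dots> \<le> 1 * (1 - exp (- (b - a)))"
      using that by (intro mult_right_mono) auto
    also have "\<dots> = 1 - exp (- (b - a))" by simp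
    also have "\<dots> \<le> b - a"
      using exp_ge_add_one_self[of "- (b - a)"] by linarith
    finally show ?thesis .
  qed
  show ?thesis
    using *[of u v] *[of v u] assms by (cases "u \<le> v") auto
qed

text \<open>Tonelli on the pairs at distance at most \<open>rd\<close>: for each \<open>y\<close> in
  \<open>A\<close> the admissible \<open>x\<close> fill a ball whose volume does not depend on
  \<open>y\<close>.\<close>

lemma nn_integral_measure_Int_cball:
  fixes A :: "'a::euclidean_space set"
  assumes [measurable]: "A \<in> sets borel"
  shows "(\<integral>\<^sup>+x. ennreal (measure lborel (A \<inter> cball x rd)) \<partial>lborel)
    = emeasure lborel A * ennreal (measure lborel (cball 0 rd :: 'a set))"
proof -
  let ?D = "{p. dist (fst p) (snd p) \<le> rd} :: ('a \<times> 'a) set"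
  have "ennreal (measure lborel (A \<inter> cball x rd)) = (\<integral>\<^sup>+y. indicator A y * indicator ?D (x, y) \<partial>lborel)" for x
  proof -
    have "ennreal (measure lborel (A \<inter> cball x rd)) = (\<integral>\<^sup>+y. indicator (A \<inter> cball x rd) y \<partial>lborel)"
      by (simp add: emeasure_Int_cball_eq)
    also have "\<dots> = (\<integral>\<^sup>+y. indicator A y * indicator ?D (x, y) \<partial>lborel)"
      by (intro nn_integral_cong) (auto simp: indicator_def)
    finally show ?thesis .
  qed
  then have "(\<integral>\<^sup>+x. ennreal (measure lborel (A \<inter> cball x rd)) \<partial>lborel)
      = (\<integral>\<^sup>+x. \<integral>\<^sup>+y. indicator A y * indicator ?D (x, y) \<partial>lborel \<partial>lborel)"
    by simp
  also have "\<dots> = (\<integral>\<^sup>+y. \<integral>\<^sup>+x. indicator A y * indicator ?D (x, y) \<partial>lborel \<partial>lborel)"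
    by (rule lborel_pair.Fubini') measurable
  also have "\<dots> = (\<integral>\<^sup>+y. indicator A y * ennreal (measure lborel (cball 0 rd :: 'a set)) \<partial>lborel)"
  proof (rule nn_integral_cong)
    fix y :: 'a
    have "(\<integral>\<^sup>+x. indicator A y * indicator ?D (x, y) \<partial>lborel) = indicator A y * (\<integral>\<^sup>+x. indicator (cball y rd) x \<partial>lborel)"
      by (subst nn_integral_cmult[symmetric]) (measurable, auto intro!: nn_integral_cong simp: indicator_def dist_commute)
    also have "(\<integral>\<^sup>+x. indicator (cball y rd) x \<partial>lborel) = emeasure lborel (cball y rd)" by simp
    also have "\<dots> = emeasure lborel ((\<lambda>x. - y + x) -` (cball 0 rd :: 'a set))"
      by (rule arg_cong[where f="emeasure lborel"]) (auto simp: dist_norm norm_minus_commute)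
    also have "\<dots> = emeasure lborel (cball 0 rd :: 'a set)"
      by (rule emeasure_lborel_shift) simp
    also have "\<dots> = ennreal (measure lborel (cball 0 rd :: 'a set))"
      using emeasure_bounded_finite[of "cball 0 rd :: 'a set"] by (intro emeasure_eq_ennreal_measure) auto
    finally show "(\<integral>\<^sup>+x. indicator A y * indicator ?D (x, y) \<partial>lborel) = indicator A y * ennreal (measure lborel (cball 0 rd :: 'a set))" .
  qed
  also have "\<dots> = emeasure lborel A * ennreal (measure lborel (cball 0 rd :: 'a set))"
    by (subst nn_integral_multc) auto
  finally show ?thesis .
qed

lemma integrable_measure_Int_cball:
  fixes A :: "'a::euclidean_space set"
  assumes A: "A \<in> sets borel" "bounded A"
  shows "integrable lborel (\<lambda>x. measure lborel (A \<inter> cball x rd))"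
    and "(\<integral>x. measure lborel (A \<inter> cball x rd) \<partial>lborel) = measure lborel A * measure lborel (cball 0 rd :: 'a set)"
proof -
  have "emeasure lborel A = ennreal (measure lborel A)"
    using emeasure_bounded_finite[OF A(2)] by (intro emeasure_eq_ennreal_measure) auto
  then have "(\<integral>\<^sup>+x. ennreal (measure lborel (A \<inter> cball x rd)) \<partial>lborel)
    = ennreal (measure lborel A * measure lborel (cball 0 rd :: 'a set))"
    by (simp add: nn_integral_measure_Int_cball[OF A(1)] ennreal_mult)
  then show "integrable lborel (\<lambda>x. measure lborel (A \<inter> cball x rd))"
    "(\<integral>x. measure lborel (A \<inter> cball x rd) \<partial>lborel) = measure lborel A * measure lborel (cball 0 rd :: 'a set)"
    using borel_measurable_measure_Int_cball[OF A(1), of rd]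
    by (auto intro!: integrableI_nonneg integral_eq_nn_integral[THEN trans])
qed

context cluster_process
begin

lemma cluster_pgf_exponent:
  fixes A B :: "'a set"
  assumes A: "A \<in> sets borel" "bounded A" and B: "B \<in> sets borel" "bounded B"
    and s: "0 \<le> s" "s \<le> 1" and t: "0 \<le> t" "t \<le> 1"
  defines "u \<equiv> \<lambda>x. ld * ((1 - s) * measure lborel (A \<inter> cball x rd) + (1 - t) * measure lborel (B \<inter> cball x rd))"
  shows "integrable lborel (\<lambda>x. 1 - exp (- u x))"
    and "0 \<le> (\<integral>x. 1 - exp (- u x) \<partial>lborel)"
    and "(\<integral>x. 1 - exp (- u x) \<partial>lborel) \<le> (\<integral>x. u x \<partial>lborel)"
proof -
  have [measurable]: "u \<in> borel_measurable borel"
    using borel_measurable_measure_Int_cball[OF A(1), of rd] borel_measurable_measure_Int_cball[OF B(1), of rd]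
    unfolding u_def by measurable
  have u0: "0 \<le> u x" for x
    using ld_pos s t by (simp add: u_def)
  have u_int: "integrable lborel u"
    unfolding u_def using A B by (intro integrable_mult_right Bochner_Integration.integrable_add integrable_measure_Int_cball)
  have le: "0 \<le> 1 - exp (- u x)" "1 - exp (- u x) \<le> u x" for x
    using u0[of x] exp_ge_add_one_self[of "- u x"] by auto
  show int: "integrable lborel (\<lambda>x. 1 - exp (- u x))"
    by (rule Bochner_Integration.integrable_bound[OF u_int]) (use le u0 in \<open>auto simp: abs_of_nonneg\<close>)
  show "0 \<le> (\<integral>x. 1 - exp (- u x) \<partial>lborel)"
    using le by (intro integral_nonneg_AE AE_I2)
  show "(\<integral>x. 1 - exp (- u x) \<partial>lborel) \<le> (\<integral>x. u x \<partial>lborel)"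
    using le by (intro integral_mono int u_int)
qed

text \<open>The finite mean has to precede differentiation, where it supplies the dominating
  function. The quotient \<open>(1 - s ^ N) / (1 - s)\<close> is the sum of \<open>s ^ i\<close>
  over \<open>i < N\<close>; it tends to \<open>N\<close> as \<open>s\<close> tends to 1, its
  expectation is bounded through \<open>cluster_pgf\<close> by \<open>1 - exp (- a) \<le> a\<close>,
  and Fatou concludes.\<close>

lemma integrable_card_Phi:
  assumes A: "A \<in> sets borel" "bounded A"
  shows "integrable M (\<lambda>\<omega>. real (card (\<Phi> \<omega> \<inter> A)))"
proof -
  have [measurable]: "(\<lambda>\<omega>. card (\<Phi> \<omega> \<inter> A)) \<in> M \<rightarrow>\<^sub>M count_space UNIV"
    by (rule card_Phi_meas[OF A])
  define s where "s n = 1 - 1 / real (Suc n)" for n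
  have s: "0 \<le> s n" "s n < 1" for n by (auto simp: s_def divide_simps)
  have s_lim: "s \<longlonglongrightarrow> 1"
    unfolding s_def using tendsto_diff[OF tendsto_const LIMSEQ_Suc[OF lim_const_over_n[of 1]], of "1::real"] by simp
  let ?q = "\<lambda>n \<omega>. \<Sum>i<card (\<Phi> \<omega> \<inter> A). s n ^ i"
  let ?C = "lp * (ld * (measure lborel A * measure lborel (cball 0 rd :: 'a set)))"
  have q: "(\<integral>\<^sup>+\<omega>. ennreal (?q n \<omega>) \<partial>M) \<le> ennreal ?C" for n
  proof -
    have eq: "?q n \<omega> = (1 - s n ^ card (\<Phi> \<omega> \<inter> A)) / (1 - s n)" for \<omega>
      using s[of n] sum_gp_strict[of "s n"] by simp
    have int: "integrable M (\<lambda>\<omega>. s n ^ card (\<Phi> \<omega> \<inter> A))"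
      using s[of n] by (intro integrable_const_bound[where B=1]) (auto simp: power_le_one)
    have "(\<integral>\<omega>. ?q n \<omega> \<partial>M) = (1 - (\<integral>\<omega>. s n ^ card (\<Phi> \<omega> \<inter> A) \<partial>M)) / (1 - s n)"
      unfolding eq using int by (simp add: prob_space)
    \<comment> \<open>The second window is empty with parameter 1; its vanishing term is kept so
      that the integral has the shape of \<open>cluster_pgf_exponent\<close>.\<close>
    also have "(\<integral>\<omega>. s n ^ card (\<Phi> \<omega> \<inter> A) \<partial>M)
        = exp (- (lp * (\<integral>x. 1 - exp (- (ld * ((1 - s n) * measure lborel (A \<inter> cball x rd) + (1 - 1) * measure lborel ({} \<inter> cball x rd)))) \<partial>lborel)))"
      (is "_ = exp (- (lp * ?J))")
      using cluster_pgf[OF A, of "{}" "s n" 1] s[of n] by simp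
    also have "(1 - exp (- (lp * ?J))) / (1 - s n) \<le> (lp * ?J) / (1 - s n)"
      using s[of n] exp_ge_add_one_self[of "- (lp * ?J)"] by (intro divide_right_mono) auto
    also have "\<dots> \<le> (lp * (\<integral>x. ld * ((1 - s n) * measure lborel (A \<inter> cball x rd) + (1 - 1) * measure lborel ({} \<inter> cball x rd)) \<partial>lborel)) / (1 - s n)"
      using s[of n] lp_pos A by (intro divide_right_mono mult_left_mono cluster_pgf_exponent(3)) auto
    also have "\<dots> = ?C"
      using s[of n] integrable_measure_Int_cball[OF A, of rd] by simp
    finally have "(\<integral>\<omega>. ?q n \<omega> \<partial>M) \<le> ?C" .
    moreover have "integrable M (?q n)"
      unfolding eq using int by auto
    ultimately show ?thesis
      using s[of n] by (subst nn_integral_eq_integral) (auto intro!: sum_nonneg ennreal_leI)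
  qed
  have "(\<integral>\<^sup>+\<omega>. ennreal (real (card (\<Phi> \<omega> \<inter> A))) \<partial>M) = (\<integral>\<^sup>+\<omega>. liminf (\<lambda>n. ennreal (?q n \<omega>)) \<partial>M)"
  proof (rule nn_integral_cong)
    fix \<omega>
    have "(\<lambda>n. ?q n \<omega>) \<longlonglongrightarrow> (\<Sum>i<card (\<Phi> \<omega> \<inter> A). 1 ^ i)"
      by (intro tendsto_intros s_lim)
    then have "(\<lambda>n. ennreal (?q n \<omega>)) \<longlonglongrightarrow> ennreal (real (card (\<Phi> \<omega> \<inter> A)))"
      by (intro tendsto_ennrealI) simp
    then show "ennreal (real (card (\<Phi> \<omega> \<inter> A))) = liminf (\<lambda>n. ennreal (?q n \<omega>))"
      using lim_imp_Liminf by force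
  qed
  also have "\<dots> \<le> liminf (\<lambda>n. \<integral>\<^sup>+\<omega>. ennreal (?q n \<omega>) \<partial>M)"
    by (rule nn_integral_liminf) measurable
  also have "\<dots> \<le> ennreal ?C"
    by (intro Liminf_le) (auto intro!: always_eventually q)
  finally show ?thesis
    by (intro integrableI_nonneg) (auto simp: le_less_trans)
qed

text \<open>
  Differentiate \<open>cluster_pgf\<close> for \<open>A\<close> and \<open>B - A\<close> in \<open>s\<close> at \<open>s = t\<close>. Allowing \<open>t = 1\<close>, where the
  derivative is one-sided, gives the first moment as well.
\<close>

lemma cluster_campbell:
  assumes A: "A \<in> sets borel" "bounded A" and B: "B \<in> sets borel" "bounded B" and AB: "A \<subseteq> B"
    and t: "0 < t" "t \<le> 1"
  shows "(\<integral>\<omega>. real (card (\<Phi> \<omega> \<inter> A)) * t ^ card (\<Phi> \<omega> \<inter> B) \<partial>M)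
    = t * (lp * ld) * (\<integral>x. measure lborel (A \<inter> cball x rd) * exp (- (ld * (1 - t) * measure lborel (B \<inter> cball x rd))) \<partial>lborel)
        * (\<integral>\<omega>. t ^ card (\<Phi> \<omega> \<inter> B) \<partial>M)"
proof -
  let ?a = "\<lambda>x. measure lborel (A \<inter> cball x rd)"
  let ?b = "\<lambda>x. measure lborel (B \<inter> cball x rd)"
  let ?c = "\<lambda>x. measure lborel ((B - A) \<inter> cball x rd)"
  let ?N = "\<lambda>\<omega>. card (\<Phi> \<omega> \<inter> A)" and ?K = "\<lambda>\<omega>. card (\<Phi> \<omega> \<inter> (B - A))"
  have C: "B - A \<in> sets borel" "bounded (B - A)" "A \<inter> (B - A) = {}" using A B by (auto intro: bounded_subset)
  have ov: "?b x = ?a x + ?c x" for x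
  proof -
    have "B \<inter> cball x rd = (A \<inter> cball x rd) \<union> ((B - A) \<inter> cball x rd)" using AB by auto
    moreover have "emeasure lborel (S \<inter> cball x rd) \<noteq> \<infinity>" for S :: "'a set"
      using emeasure_bounded_finite[of "S \<inter> cball x rd"] by (simp add: bounded_Int less_top)
    ultimately show ?thesis
      using A C(1) by (simp only:) (intro measure_Union; auto)
  qed
  have cN: "card (\<Phi> \<omega> \<inter> B) = ?N \<omega> + ?K \<omega>" if "\<omega> \<in> space M" for \<omega>
  proof -
    have "\<Phi> \<omega> \<inter> B = (\<Phi> \<omega> \<inter> A) \<union> (\<Phi> \<omega> \<inter> (B - A))" using AB by auto
    then show ?thesis
      using finite_Int_locally_finite[OF Phi_locally_finite[OF that]] A(2) C(2)
      by (simp only:) (rule card_Un_disjoint, auto)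
  qed
  have [measurable]: "?N \<in> M \<rightarrow>\<^sub>M count_space UNIV" "?K \<in> M \<rightarrow>\<^sub>M count_space UNIV"
    using A C by (auto intro: card_Phi_meas)
  define G where "G s = (\<integral>\<omega>. s ^ ?N \<omega> * t ^ ?K \<omega> \<partial>M)" for s
  define u where "u s x = ld * ((1 - s) * ?a x + (1 - t) * ?c x)" for s x
  define J where "J s = (\<integral>x. 1 - exp (- u s x) \<partial>lborel)" for s
  define I where "I = (\<integral>x. ?a x * exp (- (ld * (1 - t) * ?b x)) \<partial>lborel)"
  have am [measurable]: "?a \<in> borel_measurable borel" "?b \<in> borel_measurable borel" "?c \<in> borel_measurable borel"
    by (intro borel_measurable_measure_Int_cball A B C)+
  have G_eq: "G s = exp (- (lp * J s))" if "s \<in> {0..1}" for s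
    using cluster_pgf[OF A C, of s t] that t by (simp add: G_def J_def u_def)
  have G_deriv: "(G has_field_derivative (\<integral>\<omega>. real (?N \<omega>) * t ^ (?N \<omega> - 1) * t ^ ?K \<omega> \<partial>M)) (at t within {0..1})"
    unfolding G_def
  proof (rule has_field_derivative_integral[where w="\<lambda>\<omega>. real (?N \<omega>)"])
    show "integrable M (\<lambda>\<omega>. s ^ ?N \<omega> * t ^ ?K \<omega>)" if "s \<in> {0..1}" for s
      using that t by (intro integrable_const_bound[where B=1]) (auto simp: power_le_one mult_le_one)
    show "integrable M (\<lambda>\<omega>. real (?N \<omega>))" by (rule integrable_card_Phi[OF A])
    show "((\<lambda>s. s ^ ?N \<omega> * t ^ ?K \<omega>) has_field_derivative real (?N \<omega>) * t ^ (?N \<omega> - 1) * t ^ ?K \<omega>) (at t within {0..1})" for \<omega>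
      by (auto intro!: derivative_eq_intros)
    show "\<bar>s ^ ?N \<omega> * t ^ ?K \<omega> - t ^ ?N \<omega> * t ^ ?K \<omega>\<bar> \<le> \<bar>s - t\<bar> * real (?N \<omega>)" if "s \<in> {0..1}" for s \<omega>
    proof -
      have "\<bar>s ^ ?N \<omega> * t ^ ?K \<omega> - t ^ ?N \<omega> * t ^ ?K \<omega>\<bar> = \<bar>s ^ ?N \<omega> - t ^ ?N \<omega>\<bar> * t ^ ?K \<omega>"
        using t by (simp add: left_diff_distrib[symmetric] abs_mult)
      also have "\<dots> \<le> \<bar>s ^ ?N \<omega> - t ^ ?N \<omega>\<bar> * 1"
        using t by (intro mult_left_mono power_le_one) auto
      also have "\<dots> \<le> \<bar>s - t\<bar> * real (?N \<omega>)"
        using norm_power_diff[of s t "?N \<omega>"] that t by (simp add: mult.commute)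
      finally show ?thesis .
    qed
  qed (use t in auto)
  have J_deriv: "(J has_field_derivative (\<integral>x. - (ld * ?a x * exp (- u t x)) \<partial>lborel)) (at t within {0..1})"
    unfolding J_def
  proof (rule has_field_derivative_integral[where w="\<lambda>x. ld * ?a x"])
    show "integrable lborel (\<lambda>x. 1 - exp (- u s x))" if "s \<in> {0..1}" for s
      unfolding u_def using that t A C by (intro cluster_pgf_exponent) auto
    show "integrable lborel (\<lambda>x. ld * ?a x)"
      by (intro integrable_mult_right integrable_measure_Int_cball A)
    show "((\<lambda>s. 1 - exp (- u s x)) has_field_derivative - (ld * ?a x * exp (- u t x))) (at t within {0..1})" for x
      unfolding u_def by (auto intro!: derivative_eq_intros)
    show "\<bar>(1 - exp (- u s x)) - (1 - exp (- u t x))\<bar> \<le> \<bar>s - t\<bar> * (ld * ?a x)" if "s \<in> {0..1}" for s x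
    proof -
      have "\<bar>(1 - exp (- u s x)) - (1 - exp (- u t x))\<bar> = \<bar>exp (- u s x) - exp (- u t x)\<bar>" by simp
      also have "\<dots> \<le> \<bar>u s x - u t x\<bar>"
        using that t ld_pos by (intro abs_exp_minus_diff_le) (auto simp: u_def)
      also have "u s x - u t x = (t - s) * (ld * ?a x)"
        by (simp add: u_def algebra_simps)
      also have "\<bar>\<dots>\<bar> = \<bar>s - t\<bar> * (ld * ?a x)"
        using ld_pos by (simp add: abs_mult abs_minus_commute)
      finally show ?thesis .
    qed
    show "(\<lambda>x. - (ld * ?a x * exp (- u t x))) \<in> borel_measurable lborel"
      unfolding u_def by measurable
  qed (use t in auto)
  \<comment> \<open>At \<open>s = t\<close> both windows carry the same parameter and recombine to
    \<open>B\<close>.\<close>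
  have u_t: "u t x = ld * (1 - t) * ?b x" for x
    by (simp add: u_def ov algebra_simps)
  have J_deriv': "(J has_field_derivative - (ld * I)) (at t within {0..1})"
    using J_deriv unfolding u_t I_def by (simp add: mult.assoc)
  have G_t: "G t = exp (- (lp * J t))" using t by (intro G_eq) auto
  have "((\<lambda>s. exp (- (lp * J s))) has_field_derivative G t * (lp * (ld * I))) (at t within {0..1})"
    unfolding G_t using J_deriv' by (auto intro!: derivative_eq_intros)
  then have "(G has_field_derivative G t * (lp * (ld * I))) (at t within {0..1})"
    by (rule has_field_derivative_transform_within[where d=1]) (use t G_eq in auto)
  \<comment> \<open>Both are derivatives of \<open>G\<close> within \<open>{0..1}\<close>, and
    limits there are unique because \<open>t\<close> is a limit point of the interval, including
    \<open>t = 1\<close>.\<close>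
  with G_deriv have "(\<integral>\<omega>. real (?N \<omega>) * t ^ (?N \<omega> - 1) * t ^ ?K \<omega> \<partial>M) = G t * (lp * (ld * I))"
    unfolding has_field_derivative_iff
    by (rule tendsto_unique[rotated]) (use t in \<open>simp add: trivial_limit_within\<close>)
  \<comment> \<open>The factor \<open>t\<close> restores the exponent lowered by differentiation.
    For a zero count both sides vanish, so the truncated \<open>0 - 1\<close> does no harm.\<close>
  moreover have "(\<integral>\<omega>. real (?N \<omega>) * t ^ card (\<Phi> \<omega> \<inter> B) \<partial>M) = (\<integral>\<omega>. t * (real (?N \<omega>) * t ^ (?N \<omega> - 1) * t ^ ?K \<omega>) \<partial>M)"
  proof (intro Bochner_Integration.integral_cong refl)
    fix \<omega> assume "\<omega> \<in> space M"
    then show "real (?N \<omega>) * t ^ card (\<Phi> \<omega> \<inter> B) = t * (real (?N \<omega>) * t ^ (?N \<omega> - 1) * t ^ ?K \<omega>)"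
      by (cases "?N \<omega>") (simp_all add: cN power_add)
  qed
  moreover have "G t = (\<integral>\<omega>. t ^ card (\<Phi> \<omega> \<inter> B) \<partial>M)"
    unfolding G_def by (intro Bochner_Integration.integral_cong) (simp_all add: cN power_add)
  ultimately show ?thesis
    by (simp add: I_def)
qed

end

section \<open>Palm generating function\<close>

text \<open>With \<open>b = ld * (1 - t)\<close> and divided by the volume of the
  \<open>rd\<close>-ball, this is the generating function at \<open>t\<close> of the number of
  points that a cluster puts into the \<open>\<rho>\<close>-ball around the origin, its parent being
  uniform in \<open>cball 0 rd\<close>.\<close>

definition overlap_laplace :: "'a::euclidean_space itself \<Rightarrow> real \<Rightarrow> real \<Rightarrow> real \<Rightarrow> real" where
  "overlap_laplace _ b rd \<rho> =
     (LINT x:cball (0::'a) rd|lborel. exp (- (b * measure lborel (cball 0 \<rho> \<inter> cball x rd))))"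

lemma nn_integral_lborel_shift:
  fixes f :: "'a::euclidean_space \<Rightarrow> ennreal"
  assumes "f \<in> borel_measurable borel"
  shows "(\<integral>\<^sup>+x. f (c + x) \<partial>lborel) = (\<integral>\<^sup>+x. f x \<partial>lborel)"
proof -
  have "(\<integral>\<^sup>+x. f x \<partial>lborel) = (\<integral>\<^sup>+x. f x \<partial>distr lborel borel ((+) c))"
    by (simp add: lborel_distr_plus)
  also have "\<dots> = (\<integral>\<^sup>+x. f (c + x) \<partial>lborel)"
    using assms by (subst nn_integral_distr) auto
  finally show ?thesis ..
qed

lemma integral_lborel_shift:
  fixes f :: "'a::euclidean_space \<Rightarrow> real"
  assumes "f \<in> borel_measurable borel"
  shows "(\<integral>x. f (c + x) \<partial>lborel) = (\<integral>x. f x \<partial>lborel)"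
proof -
  have "(\<integral>x. f x \<partial>lborel) = (\<integral>x. f x \<partial>distr lborel borel ((+) c))"
    by (simp add: lborel_distr_plus)
  also have "\<dots> = (\<integral>x. f (c + x) \<partial>lborel)"
    using assms by (subst integral_distr) auto
  finally show ?thesis ..
qed

lemma measure_cball_Int_cball_shift:
  fixes v x :: "'a::euclidean_space"
  shows "measure lborel (cball v \<rho> \<inter> cball (v + x) rd) = measure lborel (cball 0 \<rho> \<inter> cball x rd)"
proof -
  have "cball 0 \<rho> \<inter> cball x rd = (\<lambda>y. v + y) -` (cball v \<rho> \<inter> cball (v + x) rd)"
    by (auto simp: dist_norm)
  then show ?thesis
    using measure_lborel_shift[of "cball v \<rho> \<inter> cball (v + x) rd" v] by simp
qed

lemma measure_Int_cball_mono:
  fixes A B :: "'a::euclidean_space set"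
  assumes "A \<subseteq> B" "A \<in> sets borel" "B \<in> sets borel"
  shows "measure lborel (A \<inter> cball x rd) \<le> measure lborel (B \<inter> cball x rd)"
proof (rule measure_mono_fmeasurable)
  show "B \<inter> cball x rd \<in> fmeasurable lborel"
    using assms emeasure_Int_cball_eq[OF assms(3), of x rd] by (simp add: fmeasurable_def)
qed (use assms in auto)

text \<open>Here \<open>y\<close> is a point of the window and \<open>x\<close> a parent that can
  reach it. Substituting \<open>y + x\<close> for \<open>x\<close> moves \<open>y\<close> to the
  origin, so the value is the same for all \<open>y\<close>.\<close>

lemma ennreal_overlap_laplace:
  fixes y :: "'a::euclidean_space"
  assumes "0 \<le> b"
  shows "(\<integral>\<^sup>+x. indicator {p. dist (fst p) (snd p) \<le> rd} (x, y)
        * ennreal (exp (- (b * measure lborel (cball y \<rho> \<inter> cball x rd)))) \<partial>lborel)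
    = ennreal (overlap_laplace TYPE('a) b rd \<rho>)"
proof -
  let ?e = "\<lambda>x. exp (- (b * measure lborel (cball (0::'a) \<rho> \<inter> cball x rd)))"
  have [measurable]: "?e \<in> borel_measurable borel"
    using borel_measurable_measure_Int_cball[of "cball (0::'a) \<rho>" rd] by measurable
  have eq: "indicator {p. dist (fst p) (snd p) \<le> rd} (y + x, y)
        * ennreal (exp (- (b * measure lborel (cball y \<rho> \<inter> cball (y + x) rd))))
      = ennreal (indicator (cball 0 rd) x * ?e x)" for x
    by (simp add: measure_cball_Int_cball_shift indicator_def dist_norm)
  have [measurable]: "(\<lambda>x. exp (- (b * measure lborel (cball y \<rho> \<inter> cball x rd)))) \<in> borel_measurable borel"
    using borel_measurable_measure_Int_cball[of "cball y \<rho>" rd] by measurable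
  have "(\<integral>\<^sup>+x. indicator {p. dist (fst p) (snd p) \<le> rd} (x, y)
        * ennreal (exp (- (b * measure lborel (cball y \<rho> \<inter> cball x rd)))) \<partial>lborel)
      = (\<integral>\<^sup>+x. ennreal (indicator (cball 0 rd) x * ?e x) \<partial>lborel)"
    by (subst nn_integral_lborel_shift[where c=y, symmetric]) (measurable, simp only: eq)
  also have "\<dots> = ennreal (\<integral>x. indicator (cball 0 rd) x * ?e x \<partial>lborel)"
  proof (rule nn_integral_eq_integral)
    have "integrable lborel (indicator (cball 0 rd) :: 'a \<Rightarrow> real)"
      using emeasure_bounded_finite[of "cball (0::'a) rd"] by (intro integrable_real_indicator) auto
    then show "integrable lborel (\<lambda>x. indicator (cball 0 rd) x * ?e x)"
      by (rule Bochner_Integration.integrable_bound) (use assms in \<open>auto simp: indicator_def\<close>)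
  qed auto
  finally show ?thesis
    by (simp add: overlap_laplace_def set_lebesgue_integral_def)
qed

lemma overlap_laplace_nonneg: "0 \<le> overlap_laplace T b rd \<rho>"
  unfolding overlap_laplace_def set_lebesgue_integral_def
  by (intro integral_nonneg_AE AE_I2) (auto simp: indicator_def)

text \<open>Closed balls are right-continuous in the radius: a point inside stays inside when the
  radius grows, and a point outside has a positive gap.\<close>

lemma tendsto_measure_cball_Int:
  fixes z x :: "'a::euclidean_space"
  assumes d: "\<And>n. 0 \<le> d n" "d \<longlonglongrightarrow> 0"
  shows "(\<lambda>n. measure lborel (cball z (\<rho> + d n) \<inter> cball x rd)) \<longlonglongrightarrow> measure lborel (cball z \<rho> \<inter> cball x rd)"
proof -
  have "(\<lambda>n. \<integral>y. indicator (cball z (\<rho> + d n) \<inter> cball x rd) y \<partial>lborel)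
      \<longlonglongrightarrow> (\<integral>y. indicator (cball z \<rho> \<inter> cball x rd) y \<partial>lborel :: real)"
  proof (rule integral_dominated_convergence[where w="indicator (cball x rd)"])
    show "integrable lborel (indicator (cball x rd) :: 'a \<Rightarrow> real)"
      using emeasure_bounded_finite[of "cball x rd"] by (intro integrable_real_indicator) auto
    show "AE y in lborel. (\<lambda>n. indicator (cball z (\<rho> + d n) \<inter> cball x rd) y :: real)
        \<longlonglongrightarrow> indicator (cball z \<rho> \<inter> cball x rd) y"
    proof (rule AE_I2, rule tendsto_eventually)
      fix y
      have "\<forall>\<^sub>F n in sequentially. y \<in> cball z (\<rho> + d n) \<longleftrightarrow> y \<in> cball z \<rho>"
      proof (cases "dist z y \<le> \<rho>")
        case True
        then have "dist z y \<le> \<rho> + d n" for n using d(1)[of n] by linarith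
        then show ?thesis using True by simp
      next
        case False
        then have "\<forall>\<^sub>F n in sequentially. d n < dist z y - \<rho>"
          by (intro order_tendstoD(2)[OF d(2)]) simp
        then show ?thesis
          by eventually_elim (use False in auto)
      qed
      then show "\<forall>\<^sub>F n in sequentially. indicator (cball z (\<rho> + d n) \<inter> cball x rd) y
          = (indicator (cball z \<rho> \<inter> cball x rd) y :: real)"
        by eventually_elim (auto simp: indicator_def)
    qed
  qed (auto simp: indicator_def)
  then show ?thesis by simp
qed

lemma tendsto_overlap_laplace:
  assumes d: "\<And>n. 0 \<le> d n" "d \<longlonglongrightarrow> 0" and b: "0 \<le> b"
  shows "(\<lambda>n. overlap_laplace TYPE('a::euclidean_space) b rd (\<rho> + d n)) \<longlonglongrightarrow> overlap_laplace TYPE('a) b rd \<rho>"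
  unfolding overlap_laplace_def set_lebesgue_integral_def
proof (rule integral_dominated_convergence[where w="indicator (cball 0 rd)"])
  have m: "(\<lambda>x. measure lborel (cball (0::'a) \<sigma> \<inter> cball x rd)) \<in> borel_measurable borel" for \<sigma>
    by (rule borel_measurable_measure_Int_cball) simp
  have "(\<lambda>x. indicator (cball 0 rd) x *\<^sub>R exp (- (b * measure lborel (cball (0::'a) \<sigma> \<inter> cball x rd)))) \<in> borel_measurable borel" for \<sigma>
  proof -
    have [measurable]: "(\<lambda>x. measure lborel (cball (0::'a) \<sigma> \<inter> cball x rd)) \<in> borel_measurable borel" "cball (0::'a) rd \<in> sets borel"
      using m by auto
    show ?thesis by measurable
  qed
  then show "(\<lambda>x. indicator (cball 0 rd) x *\<^sub>R exp (- (b * measure lborel (cball (0::'a) (\<rho> + d n) \<inter> cball x rd)))) \<in> borel_measurable lborel"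
    "(\<lambda>x. indicator (cball 0 rd) x *\<^sub>R exp (- (b * measure lborel (cball (0::'a) \<rho> \<inter> cball x rd)))) \<in> borel_measurable lborel" for n
    by auto
  show "integrable lborel (indicator (cball 0 rd) :: 'a \<Rightarrow> real)"
    using emeasure_bounded_finite[of "cball 0 rd :: 'a set"] by (intro integrable_real_indicator) auto
  show "AE x in lborel. (\<lambda>n. indicator (cball 0 rd) x *\<^sub>R exp (- (b * measure lborel (cball (0::'a) (\<rho> + d n) \<inter> cball x rd))))
      \<longlonglongrightarrow> indicator (cball 0 rd) x *\<^sub>R exp (- (b * measure lborel (cball (0::'a) \<rho> \<inter> cball x rd)))"
    by (intro AE_I2 tendsto_intros tendsto_measure_cball_Int d)
  show "AE x in lborel. norm (indicator (cball 0 rd) x *\<^sub>R exp (- (b * measure lborel (cball (0::'a) (\<rho> + d n) \<inter> cball x rd))))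
      \<le> indicator (cball 0 rd) x" for n
    using b by (intro AE_I2) (auto simp: indicator_def)
qed

text \<open>The measure of \<open>A \<inter> cball x rd\<close> is an integral over \<open>y\<close>
  in \<open>A\<close>. After exchanging the integrals, \<open>B\<close> is compared with balls
  around \<open>y\<close> itself, whose contribution is independent of \<open>y\<close>. The
  exponential decreases as \<open>B\<close> grows, so the inner radius \<open>r1\<close> gives the
  upper bound.\<close>

lemma overlap_integral_bounds:
  fixes A B :: "'a::euclidean_space set" and rd :: real
  assumes A: "A \<in> sets borel" "bounded A" and B: "B \<in> sets borel" and b: "0 \<le> b"
    and sub: "\<And>y. y \<in> A \<Longrightarrow> cball y r1 \<subseteq> B" "\<And>y. y \<in> A \<Longrightarrow> B \<subseteq> cball y r2"
  defines "I \<equiv> (\<integral>x. measure lborel (A \<inter> cball x rd) * exp (- (b * measure lborel (B \<inter> cball x rd))) \<partial>lborel)"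
  shows "measure lborel A * overlap_laplace TYPE('a) b rd r2 \<le> I"
    and "I \<le> measure lborel A * overlap_laplace TYPE('a) b rd r1"
proof -
  let ?D = "{p. dist (fst p) (snd p) \<le> rd} :: ('a \<times> 'a) set"
  let ?e = "\<lambda>x. exp (- (b * measure lborel (B \<inter> cball x rd)))"
  let ?eb = "\<lambda>\<rho> y x. exp (- (b * measure lborel (cball y \<rho> \<inter> cball x rd)))"
  have [measurable]: "A \<in> sets borel" "(\<lambda>x. measure lborel (A \<inter> cball x rd)) \<in> borel_measurable borel"
      "?e \<in> borel_measurable borel"
    using A(1) borel_measurable_measure_Int_cball[OF A(1), of rd] borel_measurable_measure_Int_cball[OF B, of rd]
    by measurable
  have fin: "emeasure lborel A = ennreal (measure lborel A)"
    using emeasure_bounded_finite[OF A(2)] by (intro emeasure_eq_ennreal_measure) auto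
  have int: "integrable lborel (\<lambda>x. measure lborel (A \<inter> cball x rd) * ?e x)"
    by (rule Bochner_Integration.integrable_bound[OF integrable_measure_Int_cball(1)[OF A, of rd]])
      (use b in \<open>auto intro!: mult_left_le\<close>)
  have "ennreal I = (\<integral>\<^sup>+x. ennreal (measure lborel (A \<inter> cball x rd) * ?e x) \<partial>lborel)"
    unfolding I_def by (rule nn_integral_eq_integral[OF int, symmetric]) simp
  also have "\<dots> = (\<integral>\<^sup>+x. \<integral>\<^sup>+y. indicator A y * (indicator ?D (x, y) * ennreal (?e x)) \<partial>lborel \<partial>lborel)"
  proof (rule nn_integral_cong)
    fix x :: 'a
    have "ennreal (measure lborel (A \<inter> cball x rd) * ?e x) = (\<integral>\<^sup>+y. indicator (A \<inter> cball x rd) y \<partial>lborel) * ennreal (?e x)"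
      using A(1) by (simp add: emeasure_Int_cball_eq ennreal_mult)
    also have "\<dots> = (\<integral>\<^sup>+y. indicator (A \<inter> cball x rd) y * ennreal (?e x) \<partial>lborel)"
      by (rule nn_integral_multc[symmetric]) (use borel_measurable_indicator[of "A \<inter> cball x rd" borel] A(1) in simp)
    also have "\<dots> = (\<integral>\<^sup>+y. indicator A y * (indicator ?D (x, y) * ennreal (?e x)) \<partial>lborel)"
      by (intro nn_integral_cong) (auto simp: indicator_def)
    finally show "ennreal (measure lborel (A \<inter> cball x rd) * ?e x)
        = (\<integral>\<^sup>+y. indicator A y * (indicator ?D (x, y) * ennreal (?e x)) \<partial>lborel)" .
  qed
  also have "\<dots> = (\<integral>\<^sup>+y. \<integral>\<^sup>+x. indicator A y * (indicator ?D (x, y) * ennreal (?e x)) \<partial>lborel \<partial>lborel)"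
    by (rule lborel_pair.Fubini') measurable
  also have "\<dots> = (\<integral>\<^sup>+y. indicator A y * (\<integral>\<^sup>+x. indicator ?D (x, y) * ennreal (?e x) \<partial>lborel) \<partial>lborel)"
    by (intro nn_integral_cong nn_integral_cmult) measurable
  finally have I: "ennreal I = (\<integral>\<^sup>+y. indicator A y * (\<integral>\<^sup>+x. indicator ?D (x, y) * ennreal (?e x) \<partial>lborel) \<partial>lborel)" .
  have const: "(\<integral>\<^sup>+y. indicator A y * ennreal c \<partial>lborel) = ennreal (measure lborel A * c)" if "0 \<le> c" for c
    using that by (subst nn_integral_multc) (auto simp: fin ennreal_mult)
  have I0: "0 \<le> I" unfolding I_def by (intro integral_nonneg_AE AE_I2) simp
  have "ennreal (measure lborel A * overlap_laplace TYPE('a) b rd r2) \<le> ennreal I"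
    unfolding I const[OF overlap_laplace_nonneg, symmetric]
  proof (rule nn_integral_mono)
    fix y
    show "indicator A y * ennreal (overlap_laplace TYPE('a) b rd r2)
        \<le> indicator A y * (\<integral>\<^sup>+x. indicator ?D (x, y) * ennreal (?e x) \<partial>lborel)"
    proof (cases "y \<in> A")
      case True
      have "ennreal (overlap_laplace TYPE('a) b rd r2) \<le> (\<integral>\<^sup>+x. indicator ?D (x, y) * ennreal (?e x) \<partial>lborel)"
        unfolding ennreal_overlap_laplace[OF b, of rd y r2, symmetric]
        using sub(2)[OF True] B b
        by (intro nn_integral_mono mult_left_mono ennreal_leI) (auto intro!: mult_left_mono measure_Int_cball_mono)
      then show ?thesis by (intro mult_left_mono) auto
    qed simp
  qed
  then show "measure lborel A * overlap_laplace TYPE('a) b rd r2 \<le> I"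
    using I0 by (simp add: ennreal_le_iff)
  have "ennreal I \<le> ennreal (measure lborel A * overlap_laplace TYPE('a) b rd r1)"
    unfolding I const[OF overlap_laplace_nonneg, symmetric]
  proof (rule nn_integral_mono)
    fix y
    show "indicator A y * (\<integral>\<^sup>+x. indicator ?D (x, y) * ennreal (?e x) \<partial>lborel)
        \<le> indicator A y * ennreal (overlap_laplace TYPE('a) b rd r1)"
    proof (cases "y \<in> A")
      case True
      have "(\<integral>\<^sup>+x. indicator ?D (x, y) * ennreal (?e x) \<partial>lborel) \<le> ennreal (overlap_laplace TYPE('a) b rd r1)"
        unfolding ennreal_overlap_laplace[OF b, of rd y r1, symmetric]
        using sub(1)[OF True] B b
        by (intro nn_integral_mono mult_left_mono ennreal_leI) (auto intro!: mult_left_mono measure_Int_cball_mono)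
      then show ?thesis by (intro mult_left_mono) auto
    qed simp
  qed
  then show "I \<le> measure lborel A * overlap_laplace TYPE('a) b rd r1"
    by (simp add: ennreal_le_iff overlap_laplace_nonneg)
qed

section \<open>Passage to the limit along the grid\<close>

context cluster_process
begin

text \<open>A sum over random points is not visibly measurable; it becomes so as a pointwise limit
  of grid sums. All of these are dominated by \<open>U\<close> times the number of points in
  \<open>C\<close>.\<close>

lemma palm_sum_limit:
  fixes u :: "nat \<Rightarrow> real" and r :: real
  assumes C: "C \<in> sets borel" "bounded C" and u: "\<And>k. \<bar>u k\<bar> \<le> U"
  defines "f \<equiv> \<lambda>\<omega>. \<Sum>x\<in>\<Phi> \<omega> \<inter> C. u (card (\<Phi> \<omega> \<inter> cball x r))"
  shows "integrable M f"
    and "(\<lambda>n. \<Sum>v\<in>grid n ` C. \<integral>\<omega>. real (card (\<Phi> \<omega> \<inter> (C \<inter> grid n -` {v}))) *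
            u (card (\<Phi> \<omega> \<inter> cball v (r + mesh TYPE('a) n))) \<partial>M) \<longlonglongrightarrow> (\<integral>\<omega>. f \<omega> \<partial>M)"
proof -
  let ?g = "\<lambda>n \<omega>. \<Sum>v\<in>grid n ` C. real (card (\<Phi> \<omega> \<inter> (C \<inter> grid n -` {v}))) *
            u (card (\<Phi> \<omega> \<inter> cball v (r + mesh TYPE('a) n)))"
  have cells: "C \<inter> grid n -` {v} \<in> sets borel" "bounded (C \<inter> grid n -` {v})" for n v
    using C by (auto intro: bounded_subset)
  have [measurable]: "(\<lambda>\<omega>. card (\<Phi> \<omega> \<inter> (C \<inter> grid n -` {v}))) \<in> M \<rightarrow>\<^sub>M count_space UNIV"
    "(\<lambda>\<omega>. card (\<Phi> \<omega> \<inter> cball v \<rho>)) \<in> M \<rightarrow>\<^sub>M count_space UNIV" for n v \<rho>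
    using cells by (auto intro: card_Phi_meas)
  have g_meas [measurable]: "?g n \<in> borel_measurable M" for n by measurable
  have lim: "(\<lambda>n. ?g n \<omega>) \<longlonglongrightarrow> f \<omega>" if "\<omega> \<in> space M" for \<omega>
    unfolding f_def by (rule grid_sum_tendsto[OF C(2) Phi_locally_finite[OF that]])
  have f_meas [measurable]: "f \<in> borel_measurable M"
    by (rule borel_measurable_LIMSEQ_real[OF lim g_meas])
  have U: "0 \<le> U" using order_trans[OF abs_ge_zero u] .
  have int_w: "integrable M (\<lambda>\<omega>. U * real (card (\<Phi> \<omega> \<inter> C)))"
    by (intro integrable_mult_right integrable_card_Phi C)
  show f_int: "integrable M f"
  proof (rule Bochner_Integration.integrable_bound[OF int_w f_meas], rule AE_I2)
    fix \<omega>
    have "\<bar>f \<omega>\<bar> \<le> (\<Sum>x\<in>\<Phi> \<omega> \<inter> C. U)"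
      unfolding f_def by (intro order_trans[OF sum_abs] sum_mono u)
    then show "norm (f \<omega>) \<le> norm (U * real (card (\<Phi> \<omega> \<inter> C)))"
      using U by (simp add: mult.commute)
  qed
  have cell_int: "integrable M (\<lambda>\<omega>. real (card (\<Phi> \<omega> \<inter> (C \<inter> grid n -` {v}))) * u (card (\<Phi> \<omega> \<inter> cball v (r + mesh TYPE('a) n))))" for n v
  proof (rule Bochner_Integration.integrable_bound)
    show "integrable M (\<lambda>\<omega>. U * real (card (\<Phi> \<omega> \<inter> (C \<inter> grid n -` {v}))))"
      by (intro integrable_mult_right integrable_card_Phi cells)
    show "AE \<omega> in M. norm (real (card (\<Phi> \<omega> \<inter> (C \<inter> grid n -` {v}))) * u (card (\<Phi> \<omega> \<inter> cball v (r + mesh TYPE('a) n))))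
        \<le> norm (U * real (card (\<Phi> \<omega> \<inter> (C \<inter> grid n -` {v}))))"
      using u U by (intro AE_I2) (auto simp: abs_mult mult.commute intro!: mult_right_mono)
  qed measurable
  have "(\<lambda>n. \<integral>\<omega>. ?g n \<omega> \<partial>M) \<longlonglongrightarrow> (\<integral>\<omega>. f \<omega> \<partial>M)"
  proof (rule integral_dominated_convergence[OF f_meas g_meas int_w])
    show "AE \<omega> in M. (\<lambda>n. ?g n \<omega>) \<longlonglongrightarrow> f \<omega>" by (intro AE_I2 lim)
    show "AE \<omega> in M. norm (?g n \<omega>) \<le> U * real (card (\<Phi> \<omega> \<inter> C))" for n
    proof (rule AE_I2)
      fix \<omega> assume "\<omega> \<in> space M"
      then have "?g n \<omega> = (\<Sum>x\<in>\<Phi> \<omega> \<inter> C. u (card (\<Phi> \<omega> \<inter> cball (grid n x) (r + mesh TYPE('a) n))))"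
        by (intro sum_card_grid_cells C Phi_locally_finite)
      also have "norm \<dots> \<le> (\<Sum>x\<in>\<Phi> \<omega> \<inter> C. U)"
        unfolding real_norm_def by (intro order_trans[OF sum_abs] sum_mono u)
      finally show "norm (?g n \<omega>) \<le> U * real (card (\<Phi> \<omega> \<inter> C))" by (simp add: mult.commute)
    qed
  qed
  then show "(\<lambda>n. \<Sum>v\<in>grid n ` C. \<integral>\<omega>. real (card (\<Phi> \<omega> \<inter> (C \<inter> grid n -` {v}))) *
            u (card (\<Phi> \<omega> \<inter> cball v (r + mesh TYPE('a) n))) \<partial>M) \<longlonglongrightarrow> (\<integral>\<omega>. f \<omega> \<partial>M)"
    using cell_int by (simp add: Bochner_Integration.integral_sum)
qed

text \<open>Stationarity for ball counts: the exponent in \<open>cluster_pgf\<close> is a Lebesgue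
  integral over parent positions, which may be translated along with the centre.\<close>

lemma pgf_cball_shift:
  fixes t :: real
  assumes t: "0 \<le> t" "t \<le> 1"
  shows "(\<integral>\<omega>. t ^ card (\<Phi> \<omega> \<inter> cball v \<rho>) \<partial>M) = (\<integral>\<omega>. t ^ card (\<Phi> \<omega> \<inter> cball 0 \<rho>) \<partial>M)"
proof -
  let ?h = "\<lambda>(v::'a) x. 1 - exp (- (ld * ((1 - t) * measure lborel (cball v \<rho> \<inter> cball x rd))))"
  have pgf: "(\<integral>\<omega>. t ^ card (\<Phi> \<omega> \<inter> cball v \<rho>) \<partial>M) = exp (- (lp * (\<integral>x. ?h v x \<partial>lborel)))" for v
    using cluster_pgf[of "cball v \<rho>" "{}" t 1] t by simp
  have [measurable]: "?h v \<in> borel_measurable borel"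
    using borel_measurable_measure_Int_cball[of "cball v \<rho>" rd] by measurable
  have "(\<integral>x. ?h v x \<partial>lborel) = (\<integral>x. ?h v (v + x) \<partial>lborel)"
    by (rule integral_lborel_shift[symmetric]) measurable
  also have "\<dots> = (\<integral>x. ?h 0 x \<partial>lborel)"
    by (simp add: measure_cball_Int_cball_shift)
  finally show ?thesis unfolding pgf by simp
qed

text \<open>On each cell \<open>cluster_campbell\<close> is exact. Its overlap integral is squeezed
  between the values for the radii \<open>r\<close> and \<open>r + 2 * mesh\<close>, proportionally
  to the cell volume, so the cell volumes add up to that of \<open>C\<close> and both bounds meet in
  the limit.\<close>

lemma palm_pgf:
  assumes C: "C \<in> sets borel" "bounded C" and t: "0 < t" "t \<le> 1" and r: "0 \<le> r"
  shows "(\<integral>\<omega>. (\<Sum>x\<in>\<Phi> \<omega> \<inter> C. t ^ card (\<Phi> \<omega> \<inter> cball x r)) \<partial>M)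
    = t * (lp * ld) * (measure lborel C * overlap_laplace TYPE('a) (ld * (1 - t)) rd r)
        * (\<integral>\<omega>. t ^ card (\<Phi> \<omega> \<inter> cball 0 r) \<partial>M)"
proof -
  let ?m = "mesh TYPE('a)"
  let ?cell = "\<lambda>n v. C \<inter> grid n -` {v}"
  define P where "P \<rho> = (\<integral>\<omega>. t ^ card (\<Phi> \<omega> \<inter> cball 0 \<rho>) \<partial>M)" for \<rho>
  define I where "I n v = (\<integral>x. measure lborel (?cell n v \<inter> cball x rd)
      * exp (- (ld * (1 - t) * measure lborel (cball v (r + ?m n) \<inter> cball x rd))) \<partial>lborel)" for n v
  have cells: "?cell n v \<in> sets borel" "bounded (?cell n v)" for n v
    using C by (auto intro: bounded_subset)
  have b: "0 \<le> ld * (1 - t)" using ld_pos t by simp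
  have near: "dist v y \<le> ?m n" if "y \<in> ?cell n v" for y v n
    using that dist_grid[of n y] by auto
  \<comment> \<open>As \<open>r \<ge> 0\<close>, the enlarged ball contains the whole cell, the
    inclusion that \<open>cluster_campbell\<close> asks for. Moving the ball to the origin makes the
    last factor common to all cells.\<close>
  have cell_val: "(\<integral>\<omega>. real (card (\<Phi> \<omega> \<inter> ?cell n v)) * t ^ card (\<Phi> \<omega> \<inter> cball v (r + ?m n)) \<partial>M)
      = t * (lp * ld) * I n v * P (r + ?m n)" for n v
  proof -
    have "?cell n v \<subseteq> cball v (r + ?m n)"
      using near[of _ n v] r by (force simp: subset_eq)
    then show ?thesis
      using cells t pgf_cball_shift[of t v "r + ?m n"] by (subst cluster_campbell) (auto simp: I_def P_def)
  qed
  have I_le: "I n v \<le> measure lborel (?cell n v) * overlap_laplace TYPE('a) (ld * (1 - t)) rd r"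
    and I_ge: "measure lborel (?cell n v) * overlap_laplace TYPE('a) (ld * (1 - t)) rd (r + 2 * ?m n) \<le> I n v" for n v
  proof -
    have s1: "cball y r \<subseteq> cball v (r + ?m n)" if "y \<in> ?cell n v" for y
    proof
      fix z assume "z \<in> cball y r"
      then show "z \<in> cball v (r + ?m n)" using near[OF that] dist_triangle[of v z y] by simp
    qed
    have s2: "cball v (r + ?m n) \<subseteq> cball y (r + 2 * ?m n)" if "y \<in> ?cell n v" for y
    proof
      fix z assume "z \<in> cball v (r + ?m n)"
      then show "z \<in> cball y (r + 2 * ?m n)" using near[OF that] dist_triangle[of y z v] by (simp add: dist_commute)
    qed
    show "I n v \<le> measure lborel (?cell n v) * overlap_laplace TYPE('a) (ld * (1 - t)) rd r"
      "measure lborel (?cell n v) * overlap_laplace TYPE('a) (ld * (1 - t)) rd (r + 2 * ?m n) \<le> I n v"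
      unfolding I_def using s1 s2 by (intro overlap_integral_bounds cells b; auto)+
  qed
  have sum_I: "(\<lambda>n. \<Sum>v\<in>grid n ` C. I n v) \<longlonglongrightarrow> measure lborel C * overlap_laplace TYPE('a) (ld * (1 - t)) rd r"
  proof (rule tendsto_sandwich)
    have "(\<lambda>n. 2 * ?m n) \<longlonglongrightarrow> 2 * 0"
      by (intro tendsto_intros mesh_tendsto_0)
    then show "(\<lambda>n. measure lborel C * overlap_laplace TYPE('a) (ld * (1 - t)) rd (r + 2 * ?m n))
        \<longlonglongrightarrow> measure lborel C * overlap_laplace TYPE('a) (ld * (1 - t)) rd r"
      using mesh_pos[where 'a='a] by (intro tendsto_intros tendsto_overlap_laplace b) (auto intro: less_imp_le)
    show "\<forall>\<^sub>F n in sequentially. measure lborel C * overlap_laplace TYPE('a) (ld * (1 - t)) rd (r + 2 * ?m n) \<le> (\<Sum>v\<in>grid n ` C. I n v)"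
    proof (intro always_eventually allI)
      fix n
      show "measure lborel C * overlap_laplace TYPE('a) (ld * (1 - t)) rd (r + 2 * ?m n) \<le> (\<Sum>v\<in>grid n ` C. I n v)"
        unfolding sum_measure_grid_cells[OF C, of n, symmetric] sum_distrib_right by (intro sum_mono I_ge)
    qed
    show "\<forall>\<^sub>F n in sequentially. (\<Sum>v\<in>grid n ` C. I n v) \<le> measure lborel C * overlap_laplace TYPE('a) (ld * (1 - t)) rd r"
    proof (intro always_eventually allI)
      fix n
      show "(\<Sum>v\<in>grid n ` C. I n v) \<le> measure lborel C * overlap_laplace TYPE('a) (ld * (1 - t)) rd r"
        unfolding sum_measure_grid_cells[OF C, of n, symmetric] sum_distrib_right by (intro sum_mono I_le)
    qed
  qed simp
  have P_lim: "(\<lambda>n. P (r + ?m n)) \<longlonglongrightarrow> P r"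
    unfolding P_def
  proof (rule integral_dominated_convergence[where w="\<lambda>_. 1"])
    have [measurable]: "(\<lambda>\<omega>. card (\<Phi> \<omega> \<inter> cball 0 \<rho>)) \<in> M \<rightarrow>\<^sub>M count_space UNIV" for \<rho>
      by (rule card_Phi_meas) auto
    show "(\<lambda>\<omega>. t ^ card (\<Phi> \<omega> \<inter> cball 0 r)) \<in> borel_measurable M"
      "(\<lambda>\<omega>. t ^ card (\<Phi> \<omega> \<inter> cball 0 (r + ?m n))) \<in> borel_measurable M" for n
      by measurable
    show "AE \<omega> in M. (\<lambda>n. t ^ card (\<Phi> \<omega> \<inter> cball 0 (r + ?m n))) \<longlonglongrightarrow> t ^ card (\<Phi> \<omega> \<inter> cball 0 r)"
    proof (rule AE_I2, rule tendsto_eventually)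
      fix \<omega> assume "\<omega> \<in> space M"
      then show "\<forall>\<^sub>F n in sequentially. t ^ card (\<Phi> \<omega> \<inter> cball 0 (r + ?m n)) = t ^ card (\<Phi> \<omega> \<inter> cball 0 r)"
        \<comment> \<open>The origin is its own corner, \<open>grid n 0 = 0\<close>, so the
          statement on balls around corners covers balls around the origin.\<close>
        using eventually_card_cball_grid[OF Phi_locally_finite, of \<omega> 0 r]
        by (auto simp: grid_def elim!: eventually_mono)
    qed
  qed (use t in \<open>auto simp: power_le_one\<close>)
  have "(\<lambda>n. \<Sum>v\<in>grid n ` C. \<integral>\<omega>. real (card (\<Phi> \<omega> \<inter> ?cell n v)) * t ^ card (\<Phi> \<omega> \<inter> cball v (r + ?m n)) \<partial>M)
      \<longlonglongrightarrow> (\<integral>\<omega>. (\<Sum>x\<in>\<Phi> \<omega> \<inter> C. t ^ card (\<Phi> \<omega> \<inter> cball x r)) \<partial>M)"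
    using t by (intro palm_sum_limit(2)[where U=1] C) (auto simp: power_le_one)
  moreover have "(\<lambda>n. \<Sum>v\<in>grid n ` C. \<integral>\<omega>. real (card (\<Phi> \<omega> \<inter> ?cell n v)) * t ^ card (\<Phi> \<omega> \<inter> cball v (r + ?m n)) \<partial>M)
      \<longlonglongrightarrow> t * (lp * ld) * (measure lborel C * overlap_laplace TYPE('a) (ld * (1 - t)) rd r) * P r"
  proof -
    have "(\<Sum>v\<in>grid n ` C. t * (lp * ld) * I n v * P (r + ?m n)) = t * (lp * ld) * (\<Sum>v\<in>grid n ` C. I n v) * P (r + ?m n)" for n
      by (simp add: sum_distrib_left sum_distrib_right)
    then show ?thesis
      unfolding cell_val by (simp only:) (intro tendsto_intros sum_I P_lim)
  qed
  ultimately show ?thesis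
    unfolding P_def by (rule LIMSEQ_unique)
qed

end

section \<open>Radial integration\<close>

lemma cball_borel [measurable]: "cball x r \<in> sets borel"
  by simp

text \<open>Householder reflection along \<open>w\<close>; division by zero makes it the identity
  for \<open>w = 0\<close>. A single reflection carries any vector to any other of the same norm, so
  general rotations can be avoided.\<close>

definition reflection :: "'a::euclidean_space \<Rightarrow> 'a \<Rightarrow> 'a" where
  "reflection w x = x - (2 * (x \<bullet> w) / (w \<bullet> w)) *\<^sub>R w"

lemma reflection_involution: "reflection w (reflection w x) = x"
proof (cases "w = 0")
  case False
  have "reflection w x \<bullet> w = - (x \<bullet> w)"
    using False by (simp add: reflection_def inner_diff_left)
  then show ?thesis
    by (simp add: reflection_def[of w "reflection w x"]) (simp add: reflection_def)
qed (simp add: reflection_def)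

lemma reflection_diff: "reflection w (x - y) = reflection w x - reflection w y"
  by (simp add: reflection_def inner_diff_left diff_divide_distrib algebra_simps)

lemma reflection_add: "reflection w (x + y) = reflection w x + reflection w y"
  by (simp add: reflection_def inner_add_left add_divide_distrib algebra_simps)

lemma norm_reflection: "norm (reflection w x) = norm x"
proof (cases "w = 0")
  case False
  have "reflection w x \<bullet> reflection w x = x \<bullet> x"
    using False by (simp add: reflection_def inner_diff_left inner_diff_right inner_commute[of w x])
  then show ?thesis by (simp add: norm_eq_sqrt_inner)
qed (simp add: reflection_def)

text \<open>For equal norms, \<open>2 * (u \<bullet> (u - v))\<close> is the squared length of
  \<open>u - v\<close>, so exactly \<open>u - v\<close> is subtracted from \<open>u\<close>.\<close>

lemma reflection_swap:
  assumes "norm u = norm v"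
  shows "reflection (u - v) u = v"
proof (cases "u = v")
  case False
  have eq: "u \<bullet> u = v \<bullet> v" using assms by (simp add: norm_eq_sqrt_inner)
  have "(u - v) \<bullet> (u - v) \<noteq> 0" using False by simp
  moreover have "2 * (u \<bullet> (u - v)) = (u - v) \<bullet> (u - v)"
    using eq by (simp add: inner_diff_left inner_diff_right inner_commute)
  ultimately show ?thesis by (simp add: reflection_def)
qed (simp add: reflection_def)

lemma borel_measurable_reflection [measurable]: "reflection w \<in> borel_measurable borel"
  unfolding reflection_def by measurable

text \<open>
  Haar-measure argument: average over a translation of the unit ball, which commutes with the
  isometry up to relabelling, and exchange the integrals.
\<close>

lemma emeasure_reflection:
  fixes B :: "'a::euclidean_space set"
  assumes [measurable]: "B \<in> sets borel"
  shows "emeasure lborel (reflection w -` B) = emeasure lborel B"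
proof -
  let ?f = "reflection w"
  let ?U = "cball 0 1 :: 'a set"
  have f_B [measurable]: "?f -` B \<in> sets borel"
    using measurable_sets_borel[OF borel_measurable_reflection assms] .
  have "emeasure lborel ?U * emeasure lborel (?f -` B) = (\<integral>\<^sup>+z. indicator ?U z * (\<integral>\<^sup>+x. indicator (?f -` B) x \<partial>lborel) \<partial>lborel)"
    by (subst nn_integral_multc) (auto intro!: borel_measurable_indicator)
  \<comment> \<open>Translating the inner integral by \<open>?f z\<close> turns the argument of
    \<open>B\<close> into \<open>?f (?f z + x)\<close>, which is \<open>z + ?f x\<close> by
    additivity and involution.\<close>
  also have "\<dots> = (\<integral>\<^sup>+z. indicator ?U z * (\<integral>\<^sup>+x. indicator (?f -` B) (?f z + x) \<partial>lborel) \<partial>lborel)"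
    by (simp only: nn_integral_lborel_shift[OF borel_measurable_indicator[OF f_B]])
  also have "\<dots> = (\<integral>\<^sup>+z. \<integral>\<^sup>+x. indicator {p. dist 0 (fst p) \<le> 1} (z, x) * indicator B (z + ?f x) \<partial>lborel \<partial>lborel)"
    by (subst nn_integral_cmult[symmetric])
      (measurable, auto intro!: nn_integral_cong simp: indicator_def reflection_add reflection_involution)
  also have "\<dots> = (\<integral>\<^sup>+x. \<integral>\<^sup>+z. indicator {p. dist 0 (fst p) \<le> 1} (z, x) * indicator B (z + ?f x) \<partial>lborel \<partial>lborel)"
    by (rule lborel_pair.Fubini') measurable
  \<comment> \<open>Translating \<open>z\<close> by \<open>?f x\<close> frees \<open>B\<close> of
    the reflection and puts it into the ball condition, where the isometry turns it into a ball
    around \<open>?f z\<close>.\<close>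
  also have "\<dots> = (\<integral>\<^sup>+x. \<integral>\<^sup>+z. indicator {p. dist (fst p) (?f (snd p)) \<le> 1} (z, x) * indicator B z \<partial>lborel \<partial>lborel)"
  proof (rule nn_integral_cong)
    fix x
    have "(\<integral>\<^sup>+z. indicator {p. dist (fst p) (?f (snd p)) \<le> 1} (z, x) * indicator B z \<partial>lborel)
       = (\<integral>\<^sup>+z. indicator {p. dist (fst p) (?f (snd p)) \<le> 1} (?f x + z, x) * indicator B (?f x + z) \<partial>lborel)"
      by (rule nn_integral_lborel_shift[symmetric]) measurable
    then show "(\<integral>\<^sup>+z. indicator {p. dist 0 (fst p) \<le> 1} (z, x) * indicator B (z + ?f x) \<partial>lborel)
       = (\<integral>\<^sup>+z. indicator {p. dist (fst p) (?f (snd p)) \<le> 1} (z, x) * indicator B z \<partial>lborel)"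
      by (simp add: indicator_def dist_norm add.commute)
  qed
  also have "\<dots> = (\<integral>\<^sup>+z. \<integral>\<^sup>+x. indicator {p. dist (fst p) (?f (snd p)) \<le> 1} (z, x) * indicator B z \<partial>lborel \<partial>lborel)"
    by (rule lborel_pair.Fubini'[symmetric]) measurable
  also have "\<dots> = (\<integral>\<^sup>+z. emeasure lborel ?U * indicator B z \<partial>lborel)"
  proof (rule nn_integral_cong)
    fix z
    have "dist z (?f x) = dist (?f z) x" for x
      using norm_reflection[of w "z - ?f x"] by (simp add: dist_norm reflection_diff reflection_involution)
    then have "(\<integral>\<^sup>+x. indicator {p. dist (fst p) (?f (snd p)) \<le> 1} (z, x) * indicator B z \<partial>lborel)
       = (\<integral>\<^sup>+x. indicator (cball (?f z) 1) x * indicator B z \<partial>lborel)"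
      by (intro nn_integral_cong) (auto simp: indicator_def)
    also have "\<dots> = emeasure lborel (cball (?f z) 1) * indicator B z"
      by (subst nn_integral_multc) auto
    also have "emeasure lborel (cball (?f z) 1) = emeasure lborel ?U"
      by (simp add: emeasure_cball)
    finally show "(\<integral>\<^sup>+x. indicator {p. dist (fst p) (?f (snd p)) \<le> 1} (z, x) * indicator B z \<partial>lborel)
       = emeasure lborel ?U * indicator B z" .
  qed
  also have "\<dots> = emeasure lborel ?U * emeasure lborel B"
    by (subst nn_integral_cmult) auto
  finally have "emeasure lborel ?U * emeasure lborel (?f -` B) = emeasure lborel ?U * emeasure lborel B" .
  moreover have "emeasure lborel ?U \<noteq> 0" "emeasure lborel ?U \<noteq> \<top>"
    using less_imp_neq[OF unit_ball_vol_pos[of "real DIM('a)"]] by (auto simp: emeasure_cball)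
  ultimately show ?thesis
    by (simp add: ennreal_mult_cancel_left)
qed

text \<open>The reflection along \<open>u - v\<close> fixes the origin and exchanges the two
  centres, so it carries one lens onto the other.\<close>

lemma measure_cball_Int_cball_norm:
  fixes u v :: "'a::euclidean_space"
  assumes "norm u = norm v"
  shows "measure lborel (cball 0 r \<inter> cball u rd) = measure lborel (cball 0 r \<inter> cball v rd)"
proof -
  let ?f = "reflection (u - v)"
  have "norm (?f y) = norm y" "dist v (?f y) = dist u y" for y
    using norm_reflection[of "u - v" "u - y"] reflection_swap[OF assms]
    by (simp_all add: norm_reflection reflection_diff dist_norm)
  then have "cball 0 r \<inter> cball u rd = ?f -` (cball 0 r \<inter> cball v rd)"
    by auto
  then show ?thesis
    unfolding measure_def by (simp only:) (subst emeasure_reflection, auto)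
qed

lemma overlap_volume_norm:
  fixes x :: "'a::euclidean_space"
  shows "overlap_volume TYPE('a) r rd (norm x) = measure lborel (cball 0 r \<inter> cball x rd)"
proof -
  have "norm (SOME u::'a. norm u = 1) = 1"
    by (rule someI_ex) (metis vector_choose_size zero_le_one)
  then show ?thesis
    unfolding overlap_volume_def by (intro measure_cball_Int_cball_norm) simp
qed

lemma borel_measurable_overlap_volume:
  "overlap_volume TYPE('a::euclidean_space) r rd \<in> borel_measurable borel"
proof -
  have "(\<lambda>y. measure lborel (cball (0::'a) r \<inter> cball (y *\<^sub>R (SOME u::'a. norm u = 1)) rd)) \<in> borel_measurable borel"
    by (rule measurable_compose[OF _ borel_measurable_measure_Int_cball]) auto
  then show ?thesis by (simp add: overlap_volume_def[abs_def])
qed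

text \<open>Polar coordinates without a surface measure: both measures are determined by the tails
  \<open>{s<..}\<close>. One tail is a difference of two ball volumes, the other an integral with a
  power of \<open>y\<close> as antiderivative.\<close>

lemma distr_norm_cball:
  fixes R :: real
  assumes R: "0 \<le> R"
  shows "distr (density lborel (indicator (cball (0::'a::euclidean_space) R))) borel norm
    = density lborel (\<lambda>y. ennreal (unit_ball_vol (real DIM('a)) * (real DIM('a) * y ^ (DIM('a) - 1)) * indicator {0..R} y))"
    (is "?M1 = density lborel ?g")
proof -
  let ?n = "DIM('a)" and ?c = "unit_ball_vol (real DIM('a))"
  let ?f = "\<lambda>y. ?c * (real ?n * y ^ (?n - 1))"
  have c: "0 \<le> ?c" by simp
  have M1: "emeasure ?M1 {s<..} = ennreal (?c * (R ^ ?n - (min R (max 0 s)) ^ ?n))" for s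
  proof -
    \<comment> \<open>Thresholds are clamped to \<open>[0, R]\<close>: below 0 the tail has full
      mass, above \<open>R\<close> it has none.\<close>
    let ?s = "min R (max 0 s)"
    have "emeasure ?M1 {s<..} = emeasure lborel (cball (0::'a) R \<inter> norm -` {s<..})"
    proof -
      have [measurable]: "norm -` {s<..} \<in> sets (borel :: 'a measure)"
        by (intro borel_open open_vimage continuous_intros)
      have "emeasure ?M1 {s<..} = emeasure (density lborel (indicator (cball (0::'a) R))) (norm -` {s<..})"
        by (subst emeasure_distr) auto
      also have "\<dots> = (\<integral>\<^sup>+x. indicator (cball (0::'a) R) x * indicator (norm -` {s<..}) x \<partial>lborel)"
        by (rule emeasure_density) (auto intro!: borel_measurable_indicator)
      also have "\<dots> = (\<integral>\<^sup>+x. indicator (cball (0::'a) R \<inter> norm -` {s<..}) x \<partial>lborel)"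
        by (intro nn_integral_cong) (auto simp: indicator_def)
      finally show ?thesis by simp
    qed
    also have "\<dots> = emeasure lborel (cball (0::'a) R - cball 0 ?s)"
    proof (rule emeasure_eq_AE)
      show "AE x in lborel. x \<in> cball (0::'a) R \<inter> norm -` {s<..} \<longleftrightarrow> x \<in> cball (0::'a) R - cball 0 ?s"
        \<comment> \<open>For negative \<open>s\<close> the tail contains the origin, which the
          removal of \<open>cball 0 0\<close> takes away; a single point is null.\<close>
        using AE_lborel_singleton[of "0::'a"]
      proof eventually_elim
        case (elim x)
        then have "s < 0 \<Longrightarrow> s < norm x" by (meson less_trans zero_less_norm_iff)
        then show ?case using R elim by (cases "s < 0") (auto simp: min_def max_def)
      qed
      have [measurable]: "norm -` {s<..} \<in> sets (borel :: 'a measure)"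
        by (intro borel_open open_vimage continuous_intros)
      show "cball (0::'a) R \<inter> norm -` {s<..} \<in> sets lborel" by simp
    qed simp
    also have "\<dots> = emeasure lborel (cball (0::'a) R) - emeasure lborel (cball (0::'a) ?s)"
      using emeasure_bounded_finite[of "cball (0::'a) ?s"] by (intro emeasure_Diff) (auto simp: subset_cball)
    also have "\<dots> = ennreal (?c * (R ^ ?n - ?s ^ ?n))"
      using R by (simp add: emeasure_cball right_diff_distrib ennreal_minus)
    finally show ?thesis .
  qed
  have M2: "emeasure (density lborel ?g) {s<..} = ennreal (?c * (R ^ ?n - (min R (max 0 s)) ^ ?n))" for s
  proof -
    let ?s = "min R (max 0 s)"
    have "emeasure (density lborel ?g) {s<..} = (\<integral>\<^sup>+y. ?g y * indicator {s<..} y \<partial>lborel)"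
      by (subst emeasure_density) auto
    also have "\<dots> = (\<integral>\<^sup>+y. ennreal (?f y) * indicator {?s..R} y \<partial>lborel)"
      using AE_lborel_singleton[of ?s]
      by (intro nn_integral_cong_AE, eventually_elim) (use R in \<open>auto simp: indicator_def min_def max_def split: if_splits\<close>)
    also have "\<dots> = ennreal (?c * R ^ ?n - ?c * ?s ^ ?n)"
    proof (rule nn_integral_FTC_Icc)
      fix y assume y: "y \<in> {?s..R}"
      show "((\<lambda>y. ?c * y ^ ?n) has_real_derivative ?f y) (at y)"
        by (auto intro!: derivative_eq_intros)
      show "0 \<le> ?f y" using y R c by (intro mult_nonneg_nonneg) auto
    qed auto
    finally show ?thesis by (simp add: right_diff_distrib)
  qed
  show ?thesis
  proof (rule measure_eqI_lessThan)
    show "emeasure ?M1 {s<..} = emeasure (density lborel ?g) {s<..}" for s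
      by (simp only: M1 M2)
    show "emeasure ?M1 {s<..} < \<infinity>" for s
      unfolding M1 by simp
  qed simp_all
qed

lemma integral_cball_radial:
  fixes h :: "real \<Rightarrow> real"
  assumes R: "0 \<le> R" and h [measurable]: "h \<in> borel_measurable borel"
  shows "(LINT x:cball (0::'a::euclidean_space) R|lborel. h (norm x))
    = unit_ball_vol (real DIM('a)) * (LINT y:{0..R}|lborel. h y * (real DIM('a) * y ^ (DIM('a) - 1)))"
proof -
  let ?d = "\<lambda>y. unit_ball_vol (real DIM('a)) * (real DIM('a) * y ^ (DIM('a) - 1)) * indicator {0..R} y"
  have "(LINT x:cball (0::'a) R|lborel. h (norm x)) = (\<integral>x. h (norm x) \<partial>density lborel (\<lambda>x. ennreal (indicator (cball (0::'a) R) x)))"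
    unfolding set_lebesgue_integral_def by (subst integral_density) (auto intro!: borel_measurable_indicator)
  also have "(\<lambda>x. ennreal (indicator (cball (0::'a) R) x)) = indicator (cball 0 R)"
    by (auto simp: indicator_def)
  also have "(\<integral>x. h (norm x) \<partial>density lborel (indicator (cball (0::'a) R)))
      = (\<integral>y. h y \<partial>distr (density lborel (indicator (cball (0::'a) R))) borel norm)"
    by (subst integral_distr) auto
  also have "\<dots> = (\<integral>y. ?d y *\<^sub>R h y \<partial>lborel)"
    unfolding distr_norm_cball[OF R]
    by (subst integral_density) (auto simp: indicator_def)
  also have "\<dots> = unit_ball_vol (real DIM('a)) * (LINT y:{0..R}|lborel. h y * (real DIM('a) * y ^ (DIM('a) - 1)))"
    unfolding set_lebesgue_integral_def
    by (subst Bochner_Integration.integral_mult_right_zero[symmetric]) (intro Bochner_Integration.integral_cong, auto)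
  finally show ?thesis .
qed

text \<open>The density in \<open>q_weight\<close> is that of the norm of a uniform point of the
  \<open>rd\<close>-ball. Multiplication by the ball volume cancels \<open>rd ^ DIM('a)\<close> and
  leaves Poisson weights of mean \<open>V x\<close>, integrated over the parent position.\<close>

lemma q_weight_eq:
  fixes rd ld r :: real
  assumes rd: "0 < rd"
  defines "V \<equiv> \<lambda>x::'a::euclidean_space. ld * measure lborel (cball 0 r \<inter> cball x rd)"
  shows "measure lborel (cball (0::'a) rd) * q_weight TYPE('a) ld rd j r
    = (LINT x:cball (0::'a) rd|lborel. exp (- V x) * V x ^ j / fact j)"
proof -
  let ?W = "\<lambda>y. ld * overlap_volume TYPE('a) r rd y"
  let ?c = "unit_ball_vol (real DIM('a))"
  have [measurable]: "overlap_volume TYPE('a) r rd \<in> borel_measurable borel"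
    by (rule borel_measurable_overlap_volume)
  have "(LINT x:cball (0::'a) rd|lborel. exp (- V x) * V x ^ j / fact j)
      = (LINT x:cball (0::'a) rd|lborel. (\<lambda>y. exp (- ?W y) * ?W y ^ j / fact j) (norm x))"
    by (simp add: V_def overlap_volume_norm)
  also have "\<dots> = ?c * (LINT y:{0..rd}|lborel. (exp (- ?W y) * ?W y ^ j / fact j) * (real DIM('a) * y ^ (DIM('a) - 1)))"
    using rd by (intro integral_cball_radial) auto
  also have "(LINT y:{0..rd}|lborel. (exp (- ?W y) * ?W y ^ j / fact j) * (real DIM('a) * y ^ (DIM('a) - 1)))
      = rd ^ DIM('a) * q_weight TYPE('a) ld rd j r"
  proof -
    have "rd ^ DIM('a) * q_weight TYPE('a) ld rd j r = (\<integral>y. rd ^ DIM('a) * (1 / fact j * (indicator {0..rd} y *\<^sub>R (?W y ^ j * exp (- ?W y) *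
        (real DIM('a) * y ^ (DIM('a) - 1) / rd ^ DIM('a))))) \<partial>lborel)"
      unfolding q_weight_def set_lebesgue_integral_def by (simp only: integral_mult_right_zero)
    also have "\<dots> = (LINT y:{0..rd}|lborel. (exp (- ?W y) * ?W y ^ j / fact j) * (real DIM('a) * y ^ (DIM('a) - 1)))"
      unfolding set_lebesgue_integral_def using rd by (intro Bochner_Integration.integral_cong) (auto simp: field_simps)
    finally show ?thesis ..
  qed
  finally show ?thesis
    using rd by (simp add: content_cball)
qed

text \<open>Expand \<open>exp (t * V x)\<close> in powers of \<open>t\<close> and integrate term by
  term; with the factor \<open>exp (- V x)\<close> the partial sums lie in \<open>[0, 1]\<close>, so
  the indicator of the ball dominates. The endpoint \<open>t = 1\<close> later supplies absolute
  convergence.\<close>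

lemma sums_overlap_laplace:
  fixes rd ld r t :: real
  assumes rd: "0 < rd" and ld: "0 < ld" and t: "0 \<le> t" "t \<le> 1"
  shows "(\<lambda>j. q_weight TYPE('a::euclidean_space) ld rd j r * t ^ j) sums
    (overlap_laplace TYPE('a) (ld * (1 - t)) rd r / measure lborel (cball (0::'a) rd))"
proof -
  define V where "V x = ld * measure lborel (cball (0::'a) r \<inter> cball x rd)" for x
  have [measurable]: "V \<in> borel_measurable borel"
    using borel_measurable_measure_Int_cball[of "cball (0::'a) r" rd] unfolding V_def by measurable
  have V: "0 \<le> V x" for x using ld by (simp add: V_def)
  let ?B = "cball (0::'a) rd"
  let ?g = "\<lambda>j x. exp (- V x) * V x ^ j / fact j"
  have vol: "0 < measure lborel ?B" using rd by simp
  have B_int: "integrable lborel (indicator ?B :: 'a \<Rightarrow> real)"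
    using emeasure_bounded_finite[of ?B] by (intro integrable_real_indicator) auto
  have exp_V: "(\<lambda>j. ?g j x * t ^ j) sums exp (- ((1 - t) * V x))" for x
  proof -
    have "(\<lambda>j. exp (- V x) * ((t * V x) ^ j /\<^sub>R fact j)) sums (exp (- V x) * exp (t * V x))"
      by (intro sums_mult exp_converges)
    then show ?thesis
      by (simp add: exp_add[symmetric] power_mult_distrib divide_inverse algebra_simps)
  qed
  have partial: "0 \<le> (\<Sum>j<n. ?g j x * t ^ j)" "(\<Sum>j<n. ?g j x * t ^ j) \<le> 1" for n x
  proof -
    show "0 \<le> (\<Sum>j<n. ?g j x * t ^ j)" using V t by (intro sum_nonneg) auto
    have "(\<Sum>j<n. ?g j x * t ^ j) \<le> exp (- ((1 - t) * V x))"
      unfolding sums_unique[OF exp_V] using V t by (intro sum_le_suminf sums_summable[OF exp_V]) auto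
    also have "\<dots> \<le> 1" using V t by simp
    finally show "(\<Sum>j<n. ?g j x * t ^ j) \<le> 1" .
  qed
  have g_int: "integrable lborel (\<lambda>x. indicator ?B x * ?g j x)" for j
  proof (rule Bochner_Integration.integrable_bound[OF B_int])
    have "(\<lambda>x. indicator ?B x * ?g j x) \<in> borel_measurable borel" by measurable
    then show "(\<lambda>x. indicator ?B x * ?g j x) \<in> borel_measurable lborel" by simp
    have "?g j x \<le> 1" for x
    proof -
      have "(\<lambda>j. exp (- V x) * (V x ^ j /\<^sub>R fact j)) sums (exp (- V x) * exp (V x))"
        by (intro sums_mult exp_converges)
      then have s: "(\<lambda>j. ?g j x) sums 1"
        by (simp add: exp_add[symmetric] divide_inverse algebra_simps)
      have "sum (\<lambda>j. ?g j x) {j} \<le> suminf (\<lambda>j. ?g j x)"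
        using V by (intro sum_le_suminf sums_summable[OF s]) auto
      then show ?thesis by (simp add: sums_unique[OF s, symmetric])
    qed
    then show "AE x in lborel. norm (indicator ?B x * ?g j x) \<le> norm (indicator ?B x :: real)"
      using V by (intro AE_I2) (auto simp: indicator_def)
  qed
  have "(\<lambda>n. \<integral>x. indicator ?B x * (\<Sum>j<n. ?g j x * t ^ j) \<partial>lborel) \<longlonglongrightarrow> (\<integral>x. indicator ?B x * exp (- ((1 - t) * V x)) \<partial>lborel)"
  proof (rule integral_dominated_convergence[where w="indicator ?B"])
    show "AE x in lborel. (\<lambda>n. indicator ?B x * (\<Sum>j<n. ?g j x * t ^ j)) \<longlonglongrightarrow> indicator ?B x * exp (- ((1 - t) * V x))"
      using exp_V unfolding sums_def by (intro AE_I2 tendsto_intros)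
    show "AE x in lborel. norm (indicator ?B x * (\<Sum>j<n. ?g j x * t ^ j)) \<le> indicator ?B x" for n
      using partial[of _ n] by (intro AE_I2) (auto simp: indicator_def abs_of_nonneg)
  qed (use B_int in measurable)
  moreover have "(\<integral>x. indicator ?B x * (\<Sum>j<n. ?g j x * t ^ j) \<partial>lborel)
      = measure lborel ?B * (\<Sum>j<n. q_weight TYPE('a) ld rd j r * t ^ j)" for n
  proof -
    have "(\<integral>x. indicator ?B x * (\<Sum>j<n. ?g j x * t ^ j) \<partial>lborel) = (\<integral>x. (\<Sum>j<n. (indicator ?B x * ?g j x) * t ^ j) \<partial>lborel)"
      by (intro Bochner_Integration.integral_cong) (auto simp: sum_distrib_left mult.assoc)
    also have "\<dots> = (\<Sum>j<n. (\<integral>x. indicator ?B x * ?g j x \<partial>lborel) * t ^ j)"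
      by (subst Bochner_Integration.integral_sum) (intro integrable_mult_left g_int, simp)
    also have "\<dots> = (\<Sum>j<n. (measure lborel ?B * q_weight TYPE('a) ld rd j r) * t ^ j)"
      unfolding q_weight_eq[OF rd] set_lebesgue_integral_def by (simp add: V_def)
    finally show ?thesis by (simp add: sum_distrib_left mult.assoc)
  qed
  ultimately have "(\<lambda>n. measure lborel ?B * (\<Sum>j<n. q_weight TYPE('a) ld rd j r * t ^ j))
      \<longlonglongrightarrow> overlap_laplace TYPE('a) (ld * (1 - t)) rd r"
    by (simp add: overlap_laplace_def set_lebesgue_integral_def V_def mult_ac)
  from tendsto_divide[OF this tendsto_const[of "measure lborel ?B"]] show ?thesis
    using vol by (simp add: sums_def)
qed

section \<open>Comparison of coefficients\<close>

text \<open>Letting \<open>t\<close> decrease to 0 isolates the constant coefficient. The identity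
  is given for positive \<open>t\<close>, hence the right-hand limit.\<close>

lemma power_series_zero_const:
  fixes c :: "nat \<Rightarrow> real"
  assumes "\<And>t. 0 < t \<Longrightarrow> t < 1 \<Longrightarrow> (\<lambda>m. c m * t ^ m) sums 0"
  shows "c 0 = 0"
proof -
  define f where "f x = (\<Sum>m. c m * x ^ m)" for x
  have sums: "(\<lambda>m. c m * x ^ m) sums f x" if "norm x < 1 / 2" for x
  proof -
    \<comment> \<open>Convergence at one positive point gives convergence on a disc around 0;
      \<open>1 / 2\<close> is an arbitrary choice in the interval.\<close>
    have "summable (\<lambda>m. c m * (1 / 2) ^ m)"
      by (rule sums_summable[OF assms]) auto
    then have "summable (\<lambda>m. c m * x ^ m)"
      by (rule powser_inside) (use that in simp)
    then show ?thesis by (simp add: f_def summable_sums)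
  qed
  have "(f \<longlongrightarrow> c 0) (at 0)"
    by (rule powser_limit_0_strong[where s="1/2"]) (use sums in auto)
  then have "(f \<longlongrightarrow> c 0) (at_right 0)"
    by (rule filterlim_mono) (auto simp: at_le)
  moreover have "(f \<longlongrightarrow> 0) (at_right 0)"
  proof (rule tendsto_eventually)
    have "\<forall>\<^sub>F x in at_right (0::real). x < 1 \<and> 0 < x"
      using eventually_at_right_real[of 0 1] by (auto elim: eventually_mono)
    then show "\<forall>\<^sub>F x in at_right 0. f x = 0"
      by eventually_elim (use assms in \<open>auto simp: f_def sums_iff\<close>)
  qed
  ultimately show ?thesis
    using tendsto_unique trivial_limit_at_right_real by blast
qed

text \<open>Dropping the vanishing constant term and dividing by \<open>t\<close> shifts the
  coefficients, hence the induction over arbitrary \<open>c\<close>.\<close>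

lemma power_series_zero:
  fixes c :: "nat \<Rightarrow> real"
  assumes "\<And>t. 0 < t \<Longrightarrow> t < 1 \<Longrightarrow> (\<lambda>m. c m * t ^ m) sums 0"
  shows "c m = 0"
  using assms
proof (induction m arbitrary: c)
  case 0
  then show ?case by (rule power_series_zero_const)
next
  case (Suc m)
  have c0: "c 0 = 0" by (rule power_series_zero_const[OF Suc.prems])
  have "(\<lambda>m. c (Suc m) * t ^ m) sums 0" if t: "0 < t" "t < 1" for t
  proof -
    have "(\<lambda>m. c (Suc m) * t ^ Suc m) sums 0"
      using Suc.prems[OF t] c0 by (subst sums_Suc_iff[of "\<lambda>m. c m * t ^ m"]) simp
    then have "(\<lambda>m. 1 / t * (c (Suc m) * t ^ Suc m)) sums (1 / t * 0)"
      by (rule sums_mult)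
    then show ?thesis using t by simp
  qed
  then show ?case by (rule Suc.IH)
qed

lemma unit_cube: "cbox 0 One \<in> sets borel" "bounded (cbox 0 One)" "measure lborel (cbox 0 One :: 'a::euclidean_space set) = 1"
proof -
  have "measure lborel (cbox 0 One :: 'a set) = (\<Prod>b\<in>(Basis::'a set). 1)"
    by (subst measure_lborel_cbox_eq) auto
  then show "measure lborel (cbox 0 One :: 'a set) = 1" by simp
qed auto

section \<open>Coefficients of the Palm generating function\<close>

context cluster_process
begin

definition intensity :: real where
  "intensity = lp * ld * measure lborel (cball (0::'a) rd)"

lemma intensity_pos: "0 < intensity"
  using lp_pos ld_pos rd_pos by (simp add: intensity_def)

text \<open>The case \<open>t = 1\<close> of \<open>cluster_campbell\<close>, where all powers and
  exponentials are 1.\<close>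

lemma expectation_card_Phi:
  assumes A: "A \<in> sets borel" "bounded A"
  shows "(\<integral>\<omega>. real (card (\<Phi> \<omega> \<inter> A)) \<partial>M) = intensity * measure lborel A"
  using cluster_campbell[OF A A, of 1] integrable_measure_Int_cball(2)[OF A, of rd]
  by (simp add: prob_space intensity_def)

text \<open>Not divided by the intensity, and the ball count includes \<open>x\<close> itself, so
  index \<open>m\<close> belongs to \<open>m - 1\<close> neighbours.\<close>

definition palm_weight :: "real \<Rightarrow> nat \<Rightarrow> real" where
  "palm_weight r m = (\<integral>\<omega>. (\<Sum>x\<in>\<Phi> \<omega> \<inter> cbox 0 One. of_bool (card (\<Phi> \<omega> \<inter> cball x r) = m)) \<partial>M)"

lemma palm_weight_sums:
  assumes t: "0 < t" "t \<le> 1"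
  shows "(\<lambda>m. palm_weight r m * t ^ m) sums
    (\<integral>\<omega>. (\<Sum>x\<in>\<Phi> \<omega> \<inter> cbox 0 One. t ^ card (\<Phi> \<omega> \<inter> cball x r)) \<partial>M)"
proof -
  let ?C = "cbox 0 One :: 'a set"
  let ?u = "\<lambda>n k. if k < n then t ^ k else 0 :: real"
  let ?f = "\<lambda>u \<omega>. \<Sum>x\<in>\<Phi> \<omega> \<inter> ?C. u (card (\<Phi> \<omega> \<inter> cball x r)) :: real"
  have int: "integrable M (?f u)" if "\<And>k. \<bar>u k\<bar> \<le> 1" for u
    by (rule palm_sum_limit(1)[OF unit_cube(1,2) that])
  have u1: "\<bar>?u n k\<bar> \<le> 1" "\<bar>t ^ k\<bar> \<le> 1" for n k
    using t by (auto simp: power_le_one)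
  have partial: "(\<Sum>m<n. palm_weight r m * t ^ m) = (\<integral>\<omega>. ?f (?u n) \<omega> \<partial>M)" for n
  proof -
    have "(\<Sum>m<n. palm_weight r m * t ^ m) = (\<integral>\<omega>. (\<Sum>m<n. ?f (\<lambda>k. of_bool (k = m)) \<omega> * t ^ m) \<partial>M)"
      unfolding palm_weight_def
      by (subst Bochner_Integration.integral_sum) (auto intro!: integrable_mult_left int)
    also have "\<dots> = (\<integral>\<omega>. ?f (?u n) \<omega> \<partial>M)"
    proof (intro Bochner_Integration.integral_cong refl)
      fix \<omega>
      have "(\<Sum>m<n. ?f (\<lambda>k. of_bool (k = m)) \<omega> * t ^ m)
          = (\<Sum>x\<in>\<Phi> \<omega> \<inter> ?C. \<Sum>m<n. of_bool (card (\<Phi> \<omega> \<inter> cball x r) = m) * t ^ m)"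
        by (simp only: sum_distrib_right) (rule sum.swap)
      also have "\<dots> = ?f (?u n) \<omega>"
      proof (rule sum.cong[OF refl])
        fix x
        have "(\<Sum>m<n. of_bool (card (\<Phi> \<omega> \<inter> cball x r) = m) * t ^ m)
            = (\<Sum>m<n. if m = card (\<Phi> \<omega> \<inter> cball x r) then t ^ m else 0)"
          by (intro sum.cong) auto
        also have "\<dots> = ?u n (card (\<Phi> \<omega> \<inter> cball x r))"
          by (subst sum.delta) auto
        finally show "(\<Sum>m<n. of_bool (card (\<Phi> \<omega> \<inter> cball x r) = m) * t ^ m) = ?u n (card (\<Phi> \<omega> \<inter> cball x r))" .
      qed
      finally show "(\<Sum>m<n. ?f (\<lambda>k. of_bool (k = m)) \<omega> * t ^ m) = ?f (?u n) \<omega>" .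
    qed
    finally show ?thesis .
  qed
  have "(\<lambda>n. \<integral>\<omega>. ?f (?u n) \<omega> \<partial>M) \<longlonglongrightarrow> (\<integral>\<omega>. ?f (\<lambda>k. t ^ k) \<omega> \<partial>M)"
  proof (rule integral_dominated_convergence[where w="\<lambda>\<omega>. real (card (\<Phi> \<omega> \<inter> ?C))"])
    show "?f (\<lambda>k. t ^ k) \<in> borel_measurable M" "?f (?u n) \<in> borel_measurable M" for n
      using int[OF u1(2)] int[OF u1(1)] by (auto intro: borel_measurable_integrable)
    show "integrable M (\<lambda>\<omega>. real (card (\<Phi> \<omega> \<inter> ?C)))"
      by (intro integrable_card_Phi unit_cube)
    show "AE \<omega> in M. (\<lambda>n. ?f (?u n) \<omega>) \<longlonglongrightarrow> ?f (\<lambda>k. t ^ k) \<omega>"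
    proof (intro AE_I2 tendsto_sum tendsto_eventually)
      fix \<omega> x
      show "\<forall>\<^sub>F n in sequentially. ?u n (card (\<Phi> \<omega> \<inter> cball x r)) = t ^ card (\<Phi> \<omega> \<inter> cball x r)"
        by (intro eventually_mono[OF eventually_gt_at_top[of "card (\<Phi> \<omega> \<inter> cball x r)"]]) simp
    qed
    show "AE \<omega> in M. norm (?f (?u n) \<omega>) \<le> real (card (\<Phi> \<omega> \<inter> ?C))" for n
    proof (rule AE_I2)
      fix \<omega>
      have "\<bar>?f (?u n) \<omega>\<bar> \<le> (\<Sum>x\<in>\<Phi> \<omega> \<inter> ?C. 1)"
        by (intro order_trans[OF sum_abs] sum_mono u1(1))
      then show "norm (?f (?u n) \<omega>) \<le> real (card (\<Phi> \<omega> \<inter> ?C))" by simp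
    qed
  qed
  then show ?thesis
    unfolding sums_def partial .
qed

text \<open>The product of the series for the own cluster and for the whole process has convolutions
  as coefficients; the factor \<open>t\<close> in \<open>palm_pgf\<close> moves each of them from
  index \<open>m\<close> to \<open>Suc m\<close>.\<close>

lemma palm_weight_Suc:
  assumes r: "0 \<le> r"
  shows "palm_weight r (Suc m) = intensity *
    (\<Sum>i\<le>m. q_weight TYPE('a) ld rd i r * prob {\<omega> \<in> space M. card (\<Phi> \<omega> \<inter> cball 0 r) = m - i})"
proof -
  define q where "q i = q_weight TYPE('a) ld rd i r" for i
  define p where "p k = prob {\<omega> \<in> space M. card (\<Phi> \<omega> \<inter> cball 0 r) = k}" for k
  define b where "b m = intensity * (\<Sum>i\<le>m. q i * p (m - i))" for m
  have p_sums: "(\<lambda>k. p k * t ^ k) sums (\<integral>\<omega>. t ^ card (\<Phi> \<omega> \<inter> cball 0 r) \<partial>M)" if "0 \<le> t" "t \<le> 1" for t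
  proof -
    have "(\<lambda>k. t ^ k * p k) sums (\<integral>\<omega>. t ^ card (\<Phi> \<omega> \<inter> cball 0 r) \<partial>M)"
      unfolding p_def using that
      by (intro sums_expectation_nat[where C=1] card_Phi_meas) (auto simp: power_le_one)
    then show ?thesis by (simp add: mult.commute)
  qed
  have q_sums: "(\<lambda>j. q j * t ^ j) sums (overlap_laplace TYPE('a) (ld * (1 - t)) rd r / measure lborel (cball (0::'a) rd))"
    if "0 \<le> t" "t \<le> 1" for t
    unfolding q_def by (rule sums_overlap_laplace[OF rd_pos ld_pos that])
  \<comment> \<open>The factor \<open>t\<close> leaves no constant term, hence the value 0 at index
    0.\<close>
  have diff: "palm_weight r m - (case m of 0 \<Rightarrow> 0 | Suc m \<Rightarrow> b m) = 0" for m
  proof (rule power_series_zero)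
    fix t :: real assume t: "0 < t" "t < 1"
    \<comment> \<open>The Cauchy product asks for absolute convergence, which holds for
      \<open>t < 1\<close> because both series converge at 1.\<close>
    have summ: "summable (\<lambda>j. norm (c j * t ^ j))" if "summable (\<lambda>j. c j * 1 ^ j)" for c :: "nat \<Rightarrow> real"
      by (rule powser_insidea[OF that]) (use t in simp)
    have "(\<lambda>m. \<Sum>i\<le>m. (q i * t ^ i) * (p (m - i) * t ^ (m - i))) sums ((\<Sum>k. q k * t ^ k) * (\<Sum>k. p k * t ^ k))"
      using q_sums[of 1] p_sums[of 1] by (intro Cauchy_product_sums summ) (auto intro: sums_summable)
    also have "(\<Sum>k. q k * t ^ k) = overlap_laplace TYPE('a) (ld * (1 - t)) rd r / measure lborel (cball (0::'a) rd)"
      using q_sums t by (intro sums_unique[symmetric]) auto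
    also have "(\<Sum>k. p k * t ^ k) = (\<integral>\<omega>. t ^ card (\<Phi> \<omega> \<inter> cball 0 r) \<partial>M)"
      using p_sums t by (intro sums_unique[symmetric]) auto
    finally have "(\<lambda>m. intensity * t * (\<Sum>i\<le>m. (q i * t ^ i) * (p (m - i) * t ^ (m - i)))) sums
        (intensity * t * (overlap_laplace TYPE('a) (ld * (1 - t)) rd r / measure lborel (cball (0::'a) rd) * (\<integral>\<omega>. t ^ card (\<Phi> \<omega> \<inter> cball 0 r) \<partial>M)))"
      by (rule sums_mult)
    moreover have "intensity * t * (\<Sum>i\<le>m. (q i * t ^ i) * (p (m - i) * t ^ (m - i))) = b m * t ^ Suc m" for m
    proof -
      have "(\<Sum>i\<le>m. (q i * t ^ i) * (p (m - i) * t ^ (m - i))) = (\<Sum>i\<le>m. q i * p (m - i)) * t ^ m"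
        unfolding sum_distrib_right
      proof (rule sum.cong[OF refl])
        fix i assume "i \<in> {..m}"
        then have "t ^ i * t ^ (m - i) = t ^ m" by (simp add: power_add[symmetric])
        then show "(q i * t ^ i) * (p (m - i) * t ^ (m - i)) = q i * p (m - i) * t ^ m"
          by (metis mult.assoc mult.left_commute)
      qed
      then show ?thesis by (simp add: b_def)
    qed
    moreover have "intensity * t * (overlap_laplace TYPE('a) (ld * (1 - t)) rd r / measure lborel (cball (0::'a) rd) * (\<integral>\<omega>. t ^ card (\<Phi> \<omega> \<inter> cball 0 r) \<partial>M))
        = (\<integral>\<omega>. (\<Sum>x\<in>\<Phi> \<omega> \<inter> cbox 0 One. t ^ card (\<Phi> \<omega> \<inter> cball x r)) \<partial>M)"
      \<comment> \<open>The ball volume contained in \<open>intensity\<close> cancels the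
        normalisation of \<open>overlap_laplace\<close>.\<close>
      using palm_pgf[OF unit_cube(1,2), of t r] t r rd_pos unit_cube(3) by (simp add: intensity_def)
    ultimately have "(\<lambda>m. b m * t ^ Suc m) sums (\<integral>\<omega>. (\<Sum>x\<in>\<Phi> \<omega> \<inter> cbox 0 One. t ^ card (\<Phi> \<omega> \<inter> cball x r)) \<partial>M)"
      by simp
    then have "(\<lambda>m. (case m of 0 \<Rightarrow> 0 | Suc m \<Rightarrow> b m) * t ^ m) sums (\<integral>\<omega>. (\<Sum>x\<in>\<Phi> \<omega> \<inter> cbox 0 One. t ^ card (\<Phi> \<omega> \<inter> cball x r)) \<partial>M)"
      by (subst (asm) sums_Suc_iff[where f="\<lambda>m. (case m of 0 \<Rightarrow> 0 | Suc m \<Rightarrow> b m) * t ^ m", simplified nat.case]) simp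
    from sums_diff[OF palm_weight_sums[of t r] this] t
    show "(\<lambda>m. (palm_weight r m - (case m of 0 \<Rightarrow> 0 | Suc m \<Rightarrow> b m)) * t ^ m) sums 0"
      by (simp add: left_diff_distrib)
  qed
  show ?thesis
    using diff[of "Suc m"] by (simp add: b_def q_def p_def)
qed

lemma palm_weight_0:
  assumes "0 \<le> r"
  shows "palm_weight r 0 = 0"
proof -
  have "(\<Sum>x\<in>\<Phi> \<omega> \<inter> cbox 0 One. of_bool (card (\<Phi> \<omega> \<inter> cball x r) = 0)) = (0::real)" if "\<omega> \<in> space M" for \<omega>
  proof (rule sum.neutral, rule ballI)
    fix x assume "x \<in> \<Phi> \<omega> \<inter> cbox 0 One"
    then have "x \<in> \<Phi> \<omega> \<inter> cball x r" using assms by simp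
    moreover have "finite (\<Phi> \<omega> \<inter> cball x r)"
      by (intro finite_Int_locally_finite Phi_locally_finite that) simp
    ultimately show "of_bool (card (\<Phi> \<omega> \<inter> cball x r) = 0) = (0::real)"
      by auto
  qed
  then have "palm_weight r 0 = (\<integral>\<omega>. 0 \<partial>M)"
    unfolding palm_weight_def by (intro Bochner_Integration.integral_cong) auto
  then show ?thesis by simp
qed

section \<open>From counts to distance distributions\<close>

text \<open>Removing \<open>x\<close> lowers the ball count by one, so at least \<open>k\<close>
  neighbours means more than \<open>k\<close> points in the ball.\<close>

lemma indicator_kth_neighbor:
  assumes \<omega>: "\<omega> \<in> space M" and x: "x \<in> \<Phi> \<omega>" and r: "0 \<le> r"
  shows "indicator {S. kth_distance k S \<le> ereal r} ((\<lambda>y. y - x) ` \<Phi> \<omega> - {0})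
    = (of_bool (k < card (\<Phi> \<omega> \<inter> cball x r)) :: real)"
proof -
  let ?S = "(\<lambda>y. y - x) ` \<Phi> \<omega> - {0}"
  have shift: "?S \<inter> B = (\<lambda>y. y - x) ` (\<Phi> \<omega> \<inter> (\<lambda>y. - x + y) -` B - {x})" for B
    by auto
  have fin: "finite (\<Phi> \<omega> \<inter> (\<lambda>y. - x + y) -` B)" if "bounded B" for B
    by (intro finite_Int_locally_finite Phi_locally_finite \<omega> bounded_vimage_shift that)
  have lf: "locally_finite_set ?S"
    unfolding locally_finite_set_def
  proof (intro allI impI)
    fix B :: "'a set" assume "bounded B"
    then show "finite (?S \<inter> B)" unfolding shift using fin by blast
  qed
  have ball: "(\<lambda>y. - x + y) -` cball 0 r = cball x r"
    by (auto simp: dist_norm norm_minus_commute)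
  have "card (?S \<inter> cball 0 r) = card (\<Phi> \<omega> \<inter> cball x r - {x})"
    unfolding shift ball by (intro card_image) (auto simp: inj_on_def)
  also have "\<dots> = card (\<Phi> \<omega> \<inter> cball x r) - 1"
    using x r by (intro card_Diff_singleton) auto
  finally have c: "card (?S \<inter> cball 0 r) = card (\<Phi> \<omega> \<inter> cball x r) - 1" .
  \<comment> \<open>Excludes truncated subtraction: for an empty ball the two sides would differ at
    \<open>k = 0\<close>.\<close>
  have "card (\<Phi> \<omega> \<inter> cball x r) > 0"
    using x r fin[OF bounded_cball, of 0 r, unfolded ball] by (auto simp: card_gt_0_iff)
  then show ?thesis
    using kth_distance_le_iff[OF lf r, of k] c by (auto simp: indicator_def)
qed

text \<open>The index \<open>m = k\<close> belongs to the subtracted sum because the point itself is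
  counted: fewer than \<open>k\<close> neighbours means at most \<open>k\<close> points in the
  ball.\<close>

lemma nearest_neighbor_cdf_eq:
  assumes r: "0 \<le> r"
  shows "nearest_neighbor_cdf M \<Phi> k r = 1 - (\<Sum>m\<le>k. palm_weight r m) / intensity"
proof -
  let ?C = "cbox 0 One :: 'a set"
  let ?f = "\<lambda>m \<omega>. \<Sum>x\<in>\<Phi> \<omega> \<inter> ?C. of_bool (card (\<Phi> \<omega> \<inter> cball x r) = m) :: real"
  have int: "integrable M (?f m)" for m
    by (rule palm_sum_limit(1)[OF unit_cube(1,2), where U=1]) simp
  have "(\<integral>\<omega>. (\<Sum>x\<in>\<Phi> \<omega> \<inter> ?C. indicator {S. kth_distance k S \<le> ereal r} ((\<lambda>y. y - x) ` \<Phi> \<omega> - {0})) \<partial>M)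
      = (\<integral>\<omega>. real (card (\<Phi> \<omega> \<inter> ?C)) - (\<Sum>m\<le>k. ?f m \<omega>) \<partial>M)"
  proof (intro Bochner_Integration.integral_cong refl)
    fix \<omega> assume \<omega>: "\<omega> \<in> space M"
    have "(\<Sum>x\<in>\<Phi> \<omega> \<inter> ?C. indicator {S. kth_distance k S \<le> ereal r} ((\<lambda>y. y - x) ` \<Phi> \<omega> - {0}))
        = (\<Sum>x\<in>\<Phi> \<omega> \<inter> ?C. 1 - (\<Sum>m\<le>k. of_bool (card (\<Phi> \<omega> \<inter> cball x r) = m)) :: real)"
    proof (rule sum.cong[OF refl])
      fix x assume x: "x \<in> \<Phi> \<omega> \<inter> ?C"
      have "(\<Sum>m\<le>k. of_bool (card (\<Phi> \<omega> \<inter> cball x r) = m)) = (\<Sum>m\<le>k. if m = card (\<Phi> \<omega> \<inter> cball x r) then 1 else 0 :: real)"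
        by (intro sum.cong) auto
      also have "\<dots> = of_bool (card (\<Phi> \<omega> \<inter> cball x r) \<le> k)"
        by (subst sum.delta) auto
      finally show "indicator {S. kth_distance k S \<le> ereal r} ((\<lambda>y. y - x) ` \<Phi> \<omega> - {0})
          = 1 - (\<Sum>m\<le>k. of_bool (card (\<Phi> \<omega> \<inter> cball x r) = m) :: real)"
        using indicator_kth_neighbor[OF \<omega> _ r, of x k] x by auto
    qed
    also have "\<dots> = real (card (\<Phi> \<omega> \<inter> ?C)) - (\<Sum>m\<le>k. ?f m \<omega>)"
      unfolding sum_subtractf by (subst sum.swap) simp
    finally show "(\<Sum>x\<in>\<Phi> \<omega> \<inter> ?C. indicator {S. kth_distance k S \<le> ereal r} ((\<lambda>y. y - x) ` \<Phi> \<omega> - {0}))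
        = real (card (\<Phi> \<omega> \<inter> ?C)) - (\<Sum>m\<le>k. ?f m \<omega>)" .
  qed
  also have "\<dots> = intensity - (\<Sum>m\<le>k. palm_weight r m)"
    using int integrable_card_Phi[OF unit_cube(1,2)] expectation_card_Phi[OF unit_cube(1,2)] unit_cube(3)
    by (simp add: palm_weight_def Bochner_Integration.integral_sum Bochner_Integration.integrable_sum)
  finally show ?thesis
    using expectation_card_Phi[OF unit_cube(1,2)] unit_cube(3) intensity_pos
    by (simp add: nearest_neighbor_cdf_def reduced_palm_def diff_divide_distrib)
qed

lemma contact_cdf_eq:
  assumes r: "0 \<le> r"
  shows "1 - contact_cdf M \<Phi> i r = (\<Sum>l<i. prob {\<omega> \<in> space M. card (\<Phi> \<omega> \<inter> cball 0 r) = l})"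
proof -
  let ?N = "\<lambda>\<omega>. card (\<Phi> \<omega> \<inter> cball 0 r)"
  have [measurable]: "?N \<in> M \<rightarrow>\<^sub>M count_space UNIV" by (rule card_Phi_meas) auto
  have eq: "{\<omega> \<in> space M. kth_distance i (\<Phi> \<omega>) \<le> ereal r} = space M - {\<omega> \<in> space M. ?N \<omega> < i}"
    using kth_distance_le_iff[OF Phi_locally_finite r] by auto
  have "1 - contact_cdf M \<Phi> i r = prob {\<omega> \<in> space M. ?N \<omega> < i}"
  proof -
    have "?N -` {..<i} \<inter> space M \<in> events" by (rule measurable_sets[OF card_Phi_meas]) auto
    then have "{\<omega> \<in> space M. ?N \<omega> < i} \<in> events"
      by (simp add: vimage_def Int_def conj_commute)
    then show ?thesis
      unfolding contact_cdf_def eq by (subst prob_compl) simp_all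
  qed
  also have "{\<omega> \<in> space M. ?N \<omega> < i} = (\<Union>l<i. {\<omega> \<in> space M. ?N \<omega> = l})" by auto
  also have "prob \<dots> = (\<Sum>l<i. prob {\<omega> \<in> space M. ?N \<omega> = l})"
    by (intro finite_measure_finite_Union) (auto simp: disjoint_family_on_def)
  finally show ?thesis .
qed

text \<open>Summing the convolution over totals below \<open>k\<close> and fixing the first index
  \<open>i\<close> leaves the probabilities of fewer than \<open>k - i\<close> points in the ball, a
  tail of a contact distance.\<close>

lemma nearest_neighbor_contact:
  assumes r: "0 \<le> r"
  shows "nearest_neighbor_cdf M \<Phi> k r =
    1 - (\<Sum>i=1..k. q_weight TYPE('a) ld rd (k - i) r * (1 - contact_cdf M \<Phi> i r))"
proof -
  define q where "q i = q_weight TYPE('a) ld rd i r" for i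
  define p where "p l = prob {\<omega> \<in> space M. card (\<Phi> \<omega> \<inter> cball 0 r) = l}" for l
  \<comment> \<open>The term \<open>m = 0\<close> vanishes; the shift passes from counts including
    the typical point to numbers of neighbours.\<close>
  have "(\<Sum>m\<le>k. palm_weight r m) = (\<Sum>m<k. palm_weight r (Suc m))"
    by (simp add: sum.lessThan_Suc_shift lessThan_Suc_atMost[symmetric] palm_weight_0[OF r] del: sum.lessThan_Suc)
  also have "\<dots> = intensity * (\<Sum>m<k. \<Sum>i\<le>m. q i * p (m - i))"
    unfolding palm_weight_Suc[OF r] q_def p_def by (simp add: sum_distrib_left)
  also have "(\<Sum>m<k. \<Sum>i\<le>m. q i * p (m - i)) = (\<Sum>(i, l)\<in>{(i, l). i + l < k}. q i * p l)"
    by (rule sum.triangle_reindex[symmetric])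
  also have "{(i, l). i + l < k} = (SIGMA i:{..<k}. {..<k - i})" by auto
  also have "(\<Sum>(i, l)\<in>\<dots>. q i * p l) = (\<Sum>i<k. q i * (\<Sum>l<k - i. p l))"
    by (subst sum.Sigma[symmetric]) (auto simp: sum_distrib_left)
  \<comment> \<open>Reversing the index puts \<open>i\<close> on the contact distance and
    \<open>k - i\<close> on the weight.\<close>
  also have "\<dots> = (\<Sum>i=1..k. q (k - i) * (\<Sum>l<i. p l))"
    by (rule sum.reindex_bij_witness[of _ "\<lambda>i. k - i" "\<lambda>i. k - i"]) auto
  finally show ?thesis
    unfolding nearest_neighbor_cdf_eq[OF r] contact_cdf_eq[OF r] q_def p_def
    using intensity_pos by simp
qed

end

theorem theorem4:
  fixes M :: "'w measure" and \<Phi> :: "'w \<Rightarrow> 'a::euclidean_space set"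
    and lp ld rd r :: real and k :: nat
  assumes "lp > 0" and "ld > 0" and "rd > 0"
    and "matern_cluster_process M lp ld rd \<Phi>"
    and "k \<ge> 1" and "r > 0"
  shows "nearest_neighbor_cdf M \<Phi> k r =
           1 - (\<Sum>i=1..k. q_weight TYPE('a) ld rd (k - i) r * (1 - contact_cdf M \<Phi> i r))"
proof -
  from assms(4) obtain \<Phi>p and X :: "nat \<Rightarrow> 'w \<Rightarrow> 'a" and D :: "nat \<Rightarrow> 'w \<Rightarrow> 'a set" where mcp: "point_process M \<Phi>" "poisson_process M (\<lambda>_. lp) \<Phi>p"
    "\<forall>i. X i \<in> borel_measurable M"
    "AE \<omega> in M. inj (\<lambda>i. X i \<omega>) \<and> range (\<lambda>i. X i \<omega>) = \<Phi>p \<omega>"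
    "\<forall>i. poisson_process M (\<lambda>y. ld * indicator {y. norm y \<le> rd} y) (D i)"
    "prob_space.indep_vars M (\<lambda>_. point_configs) D UNIV"
    "prob_space.indep_set M
          {(\<lambda>\<omega> i. X i \<omega>) -` A \<inter> space M | A. A \<in> sets (Pi\<^sub>M UNIV (\<lambda>_. borel))}
          {(\<lambda>\<omega> i. D i \<omega>) -` A \<inter> space M | A. A \<in> sets (Pi\<^sub>M UNIV (\<lambda>_. point_configs))}"
    "AE \<omega> in M. \<Phi> \<omega> = (\<Union>i. (\<lambda>y. X i \<omega> + y) ` D i \<omega>)"
    unfolding matern_cluster_process_def by blast
  interpret prob_space M using mcp(1) by (simp add: point_process_def)
  interpret cluster_process M lp ld rd \<Phi> \<Phi>p X D
    using assms mcp by unfold_locales (auto simp: point_process_def)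
  show ?thesis
    using assms by (intro nearest_neighbor_contact) simp
qed

end
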